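(* Let $o_{1n}=u_{11}\in A_o(n)$ and let $\int$ be the Haar functional of $A_o(n)$. As formal power series in $z$, $$\sum_{k=0}^\infty z^k\int\left(n^{1/2}o_{1n}\right)^k=\frac{2}{1+\sqrt{1-4z^2}}-n^{-1}\,\frac{32\,z^4}{\left(1+\sqrt{1-4z^2}\right)^4\sqrt{1-4z^2}}+O(n^{-2})$$ as $n\to\infty$, where $O(n^{-2})$ is understood coefficient-wise: for each $k$, the difference between the coefficients of $z^k$ of the left-hand side and of the sum of the first two terms on the right-hand side is $O(n^{-2})$ as $n\to\infty$ (with a constant that may depend on $k$).
   Context: $A_o(n)$ is the universal (unital) $C^*$-algebra generated by $n^2$ elements $u_{ij}$, $1\le i,j\le n$, subject to the relations making $u=(u_{ij})$ an orthogonal matrix, i.e. $u_{ij}=u_{ij}^*$ for all $i,j$ and $uu^t=u^tu=1$. It is a Hopf $C^*$-algebra with comultiplication $\Delta(u_{ij})=\sum_{k} u_{ik}\otimes u_{kj}$. The Haar functional $\int:A_o(n)\to\mathbb{C}$ is the unique positive unital linear form satisfying $(\mathrm{id}\otimes\int)\Delta(a)=(\int\otimes \mathrm{id})\Delta(a)=(\int a)\,1$ for all $a$. The square root $\sqrt{1-4z^2}$ denotes the power series in $z$ with constant term $1$. *)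

theory Defs
  imports
    "HOL-Algebra.Module"
    "HOL-Computational_Algebra.Formal_Power_Series"
    "HOL-Library.Landau_Symbols"
    "HOL-Library.Nonpos_Ints"
begin

section \<open>Unital complex *-algebras and C*-seminorms\<close>

record 'a star_algebra = "(complex, 'a) module" +
  star :: "'a \<Rightarrow> 'a"

text \<open>A C*-algebra is represented by its *-algebra structure together with its norm.\<close>

record 'a normed_star_algebra = "'a star_algebra" +
  cnorm :: "'a \<Rightarrow> real"

definition cstar_seminorm :: "('a, 'x) star_algebra_scheme \<Rightarrow> ('a \<Rightarrow> real) \<Rightarrow> bool" where
  "cstar_seminorm A p \<longleftrightarrow>
     (\<forall>a\<in>carrier A. p a \<ge> 0) \<and>
     (\<forall>a\<in>carrier A. \<forall>b\<in>carrier A. p (a \<oplus>\<^bsub>A\<^esub> b) \<le> p a + p b) \<and>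
     (\<forall>c. \<forall>a\<in>carrier A. p (c \<odot>\<^bsub>A\<^esub> a) = cmod c * p a) \<and>
     (\<forall>a\<in>carrier A. \<forall>b\<in>carrier A. p (a \<otimes>\<^bsub>A\<^esub> b) \<le> p a * p b) \<and>
     (\<forall>a\<in>carrier A. p (star A a \<otimes>\<^bsub>A\<^esub> a) = (p a)\<^sup>2)"

definition linear_on_carrier ::
  "('a, 'x) star_algebra_scheme \<Rightarrow> ('b, 'y) star_algebra_scheme \<Rightarrow> ('a \<Rightarrow> 'b) \<Rightarrow> bool" where
  "linear_on_carrier A B f \<longleftrightarrow>
     f \<in> carrier A \<rightarrow> carrier B \<and>
     (\<forall>a\<in>carrier A. \<forall>b\<in>carrier A. f (a \<oplus>\<^bsub>A\<^esub> b) = f a \<oplus>\<^bsub>B\<^esub> f b) \<and>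
     (\<forall>c. \<forall>a\<in>carrier A. f (c \<odot>\<^bsub>A\<^esub> a) = c \<odot>\<^bsub>B\<^esub> f a)"

definition bounded_linear_on_carrier ::
  "'a normed_star_algebra \<Rightarrow> 'b normed_star_algebra \<Rightarrow> ('a \<Rightarrow> 'b) \<Rightarrow> bool" where
  "bounded_linear_on_carrier A B f \<longleftrightarrow>
     linear_on_carrier A B f \<and> (\<exists>K. \<forall>a\<in>carrier A. cnorm B (f a) \<le> K * cnorm A a)"

definition unital_star_hom ::
  "('a, 'x) star_algebra_scheme \<Rightarrow> ('b, 'y) star_algebra_scheme \<Rightarrow> ('a \<Rightarrow> 'b) \<Rightarrow> bool" where
  "unital_star_hom A B f \<longleftrightarrow>
     f \<in> ring_hom A B \<and> linear_on_carrier A B f \<and>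
     (\<forall>a\<in>carrier A. f (star A a) = star B (f a))"

definition positive_form :: "('a, 'x) star_algebra_scheme \<Rightarrow> ('a \<Rightarrow> complex) \<Rightarrow> bool" where
  "positive_form A \<phi> \<longleftrightarrow>
     (\<forall>a\<in>carrier A. \<forall>b\<in>carrier A. \<phi> (a \<oplus>\<^bsub>A\<^esub> b) = \<phi> a + \<phi> b) \<and>
     (\<forall>c. \<forall>a\<in>carrier A. \<phi> (c \<odot>\<^bsub>A\<^esub> a) = c * \<phi> a) \<and>
     (\<forall>a\<in>carrier A. \<phi> (star A a \<otimes>\<^bsub>A\<^esub> a) \<in> \<real>\<^sub>\<ge>\<^sub>0)"

text \<open>States: positive linear forms of norm one.\<close>

definition state :: "'a normed_star_algebra \<Rightarrow> ('a \<Rightarrow> complex) \<Rightarrow> bool" where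
  "state A \<phi> \<longleftrightarrow>
     positive_form A \<phi> \<and> \<phi> \<one>\<^bsub>A\<^esub> = 1 \<and> (\<forall>a\<in>carrier A. cmod (\<phi> a) \<le> cnorm A a)"


section \<open>Separation and completion\<close>

text \<open>The Hausdorff completion of a *-algebra with respect to a seminorm: Cauchy sequences
  modulo sequences tending to 0.\<close>

definition cauchy_seqs :: "('a, 'x) star_algebra_scheme \<Rightarrow> ('a \<Rightarrow> real) \<Rightarrow> (nat \<Rightarrow> 'a) set" where
  "cauchy_seqs A p = {x. (\<forall>m. x m \<in> carrier A) \<and>
     (\<forall>e>0. \<exists>N. \<forall>m\<ge>N. \<forall>l\<ge>N. p (x m \<ominus>\<^bsub>A\<^esub> x l) < e)}"

definition cauchy_rel ::
  "('a, 'x) star_algebra_scheme \<Rightarrow> ('a \<Rightarrow> real) \<Rightarrow> ((nat \<Rightarrow> 'a) \<times> (nat \<Rightarrow> 'a)) set" where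
  "cauchy_rel A p = {(x, y). x \<in> cauchy_seqs A p \<and> y \<in> cauchy_seqs A p \<and>
     (\<lambda>m. p (x m \<ominus>\<^bsub>A\<^esub> y m)) \<longlonglongrightarrow> 0}"

definition embed :: "('a, 'x) star_algebra_scheme \<Rightarrow> ('a \<Rightarrow> real) \<Rightarrow> 'a \<Rightarrow> (nat \<Rightarrow> 'a) set" where
  "embed A p a = cauchy_rel A p `` {\<lambda>_. a}"

definition completion ::
  "('a, 'x) star_algebra_scheme \<Rightarrow> ('a \<Rightarrow> real) \<Rightarrow> (nat \<Rightarrow> 'a) set normed_star_algebra" where
  "completion A p =
    \<lparr> carrier = cauchy_seqs A p // cauchy_rel A p,
      monoid.mult = (\<lambda>X Y. \<Union>x\<in>X. \<Union>y\<in>Y. cauchy_rel A p `` {\<lambda>m. x m \<otimes>\<^bsub>A\<^esub> y m}),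
      one = embed A p \<one>\<^bsub>A\<^esub>,
      zero = embed A p \<zero>\<^bsub>A\<^esub>,
      add = (\<lambda>X Y. \<Union>x\<in>X. \<Union>y\<in>Y. cauchy_rel A p `` {\<lambda>m. x m \<oplus>\<^bsub>A\<^esub> y m}),
      smult = (\<lambda>c X. \<Union>x\<in>X. cauchy_rel A p `` {\<lambda>m. c \<odot>\<^bsub>A\<^esub> x m}),
      star = (\<lambda>X. \<Union>x\<in>X. cauchy_rel A p `` {\<lambda>m. star A (x m)}),
      cnorm = (\<lambda>X. THE r. \<exists>x\<in>X. (\<lambda>m. p (x m)) \<longlonglongrightarrow> r) \<rparr>"


section \<open>The complex *-algebra of a monoid with involution\<close>

record 'm star_monoid = "'m monoid" +
  mstar :: "'m \<Rightarrow> 'm"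

text \<open>Formal linear combinations of elements of \<open>M\<close>, i.e. finitely supported functions on
  \<open>carrier M\<close>. The product is convolution, and the involution is the antilinear extension of
  that of \<open>M\<close>.\<close>

definition star_monoid_algebra :: "'m star_monoid \<Rightarrow> ('m \<Rightarrow> complex) star_algebra" where
  "star_monoid_algebra M =
    \<lparr> carrier = {f. finite {w. f w \<noteq> 0} \<and> {w. f w \<noteq> 0} \<subseteq> carrier M},
      monoid.mult = (\<lambda>f g w. \<Sum>(a, b) | f a \<noteq> 0 \<and> g b \<noteq> 0 \<and> a \<otimes>\<^bsub>M\<^esub> b = w. f a * g b),
      one = (\<lambda>w. if w = \<one>\<^bsub>M\<^esub> then 1 else 0),
      zero = (\<lambda>_. 0),
      add = (\<lambda>f g w. f w + g w),
      smult = (\<lambda>c f w. c * f w),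
      star = (\<lambda>f w. if w \<in> carrier M then cnj (f (mstar M w)) else 0) \<rparr>"

definition basis_elem :: "'m \<Rightarrow> 'm \<Rightarrow> complex" where
  "basis_elem v = (\<lambda>w. if w = v then 1 else 0)"


section \<open>Universal C*-algebras given by generators and relations\<close>

text \<open>Words in the letters \<open>(g, False)\<close>, standing for the generator \<open>g\<close>, and \<open>(g, True)\<close>,
  standing for its adjoint.\<close>

definition free_star_monoid :: "'g set \<Rightarrow> ('g \<times> bool) list star_monoid" where
  "free_star_monoid G =
    \<lparr> carrier = lists (G \<times> UNIV),
      monoid.mult = (@),
      one = [],
      mstar = (\<lambda>w. rev (map (\<lambda>(g, b). (g, \<not> b)) w)) \<rparr>"

definition free_star_algebra :: "'g set \<Rightarrow> (('g \<times> bool) list \<Rightarrow> complex) star_algebra" where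
  "free_star_algebra G = star_monoid_algebra (free_star_monoid G)"

definition free_gen :: "'g \<Rightarrow> ('g \<times> bool) list \<Rightarrow> complex" where
  "free_gen g = basis_elem [(g, False)]"

text \<open>The largest C*-seminorm on the free *-algebra that kills the relations \<open>R\<close> (elements which
  are to become 0). It exists whenever the C*-seminorms killing \<open>R\<close> are bounded at each generator,
  which is the case for the relations of \<open>A_o\<close> below.\<close>

definition universal_seminorm ::
  "'g set \<Rightarrow> (('g \<times> bool) list \<Rightarrow> complex) set \<Rightarrow> (('g \<times> bool) list \<Rightarrow> complex) \<Rightarrow> real" where
  "universal_seminorm G R x =
     (SUP p\<in>{p. cstar_seminorm (free_star_algebra G) p \<and> (\<forall>r\<in>R. p r = 0)}. p x)"

definition universal_cstar ::
  "'g set \<Rightarrow> (('g \<times> bool) list \<Rightarrow> complex) set \<Rightarrow>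
   (nat \<Rightarrow> ('g \<times> bool) list \<Rightarrow> complex) set normed_star_algebra" where
  "universal_cstar G R = completion (free_star_algebra G) (universal_seminorm G R)"


section \<open>The minimal tensor product of C*-algebras\<close>

definition prod_star_monoid ::
  "('a, 'x) star_algebra_scheme \<Rightarrow> ('b, 'y) star_algebra_scheme \<Rightarrow> ('a \<times> 'b) star_monoid" where
  "prod_star_monoid A B =
    \<lparr> carrier = carrier A \<times> carrier B,
      monoid.mult = (\<lambda>(a, b) (c, d). (a \<otimes>\<^bsub>A\<^esub> c, b \<otimes>\<^bsub>B\<^esub> d)),
      one = (\<one>\<^bsub>A\<^esub>, \<one>\<^bsub>B\<^esub>),
      mstar = (\<lambda>(a, b). (star A a, star B b)) \<rparr>"

text \<open>The *-algebra of formal linear combinations of symbols \<open>(a, b)\<close>. The algebraic tensor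
  product is its quotient by the bilinearity relations. These relations are killed by all the
  forms \<open>\<phi> \<otimes> \<psi>\<close> below, hence by the minimal seminorm, so that separation with respect to that
  seminorm performs this quotient.\<close>

definition formal_tensor ::
  "('a, 'x) star_algebra_scheme \<Rightarrow> ('b, 'y) star_algebra_scheme \<Rightarrow>
   ('a \<times> 'b \<Rightarrow> complex) star_algebra" where
  "formal_tensor A B = star_monoid_algebra (prod_star_monoid A B)"

definition tensor_form ::
  "('a \<Rightarrow> complex) \<Rightarrow> ('b \<Rightarrow> complex) \<Rightarrow> ('a \<times> 'b \<Rightarrow> complex) \<Rightarrow> complex" where
  "tensor_form \<phi> \<psi> x = (\<Sum>(a, b) | x (a, b) \<noteq> 0. x (a, b) * \<phi> a * \<psi> b)"

text \<open>The minimal (spatial) C*-norm of \<open>x\<close>: the supremum over states \<open>\<phi>\<close>, \<open>\<psi>\<close> of the operator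
  norm of \<open>x\<close> in the tensor product of the GNS representations of \<open>\<phi>\<close> and \<open>\<psi>\<close>, in which the
  vectors \<open>y\<close> of the formal tensor product are dense and have squared norm \<open>(\<phi> \<otimes> \<psi>)(y\<^sup>* y)\<close>.\<close>

definition min_seminorm ::
  "'a normed_star_algebra \<Rightarrow> 'b normed_star_algebra \<Rightarrow> ('a \<times> 'b \<Rightarrow> complex) \<Rightarrow> real" where
  "min_seminorm A B x =
    (let F = formal_tensor A B in
     SUP (\<phi>, \<psi>, y)\<in>{(\<phi>, \<psi>, y). state A \<phi> \<and> state B \<psi> \<and> y \<in> carrier F \<and>
                     tensor_form \<phi> \<psi> (star F y \<otimes>\<^bsub>F\<^esub> y) = 1}.
       sqrt (Re (tensor_form \<phi> \<psi> (star F (x \<otimes>\<^bsub>F\<^esub> y) \<otimes>\<^bsub>F\<^esub> (x \<otimes>\<^bsub>F\<^esub> y)))))"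

definition min_tensor ::
  "'a normed_star_algebra \<Rightarrow> 'b normed_star_algebra \<Rightarrow>
   (nat \<Rightarrow> 'a \<times> 'b \<Rightarrow> complex) set normed_star_algebra" where
  "min_tensor A B = completion (formal_tensor A B) (min_seminorm A B)"

definition elem_tensor ::
  "'a normed_star_algebra \<Rightarrow> 'b normed_star_algebra \<Rightarrow> 'a \<Rightarrow> 'b \<Rightarrow>
   (nat \<Rightarrow> 'a \<times> 'b \<Rightarrow> complex) set" where
  "elem_tensor A B a b = embed (formal_tensor A B) (min_seminorm A B) (basis_elem (a, b))"

text \<open>The slice maps \<open>id \<otimes> \<psi> : A \<otimes> B \<rightarrow> A\<close> and \<open>\<phi> \<otimes> id : A \<otimes> B \<rightarrow> B\<close>. On the carrier they are
  uniquely determined, since the elementary tensors span a dense subspace.\<close>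

definition is_slice_right ::
  "'a normed_star_algebra \<Rightarrow> 'b normed_star_algebra \<Rightarrow> ('b \<Rightarrow> complex) \<Rightarrow>
   ((nat \<Rightarrow> 'a \<times> 'b \<Rightarrow> complex) set \<Rightarrow> 'a) \<Rightarrow> bool" where
  "is_slice_right A B \<psi> S \<longleftrightarrow>
     bounded_linear_on_carrier (min_tensor A B) A S \<and>
     (\<forall>a\<in>carrier A. \<forall>b\<in>carrier B. S (elem_tensor A B a b) = \<psi> b \<odot>\<^bsub>A\<^esub> a)"

definition is_slice_left ::
  "'a normed_star_algebra \<Rightarrow> 'b normed_star_algebra \<Rightarrow> ('a \<Rightarrow> complex) \<Rightarrow>
   ((nat \<Rightarrow> 'a \<times> 'b \<Rightarrow> complex) set \<Rightarrow> 'b) \<Rightarrow> bool" where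
  "is_slice_left A B \<phi> S \<longleftrightarrow>
     bounded_linear_on_carrier (min_tensor A B) B S \<and>
     (\<forall>a\<in>carrier A. \<forall>b\<in>carrier B. S (elem_tensor A B a b) = \<phi> a \<odot>\<^bsub>B\<^esub> b)"


section \<open>The Hopf C*-algebra \<open>A_o(n)\<close> and its Haar functional\<close>

definition Ao_index :: "nat \<Rightarrow> (nat \<times> nat) set" where
  "Ao_index n = {1..n} \<times> {1..n}"

text \<open>The relations \<open>u\<^sub>i\<^sub>j = u\<^sub>i\<^sub>j\<^sup>*\<close>, \<open>u u\<^sup>t = 1\<close> and \<open>u\<^sup>t u = 1\<close>.\<close>

definition Ao_relations :: "nat \<Rightarrow> (((nat \<times> nat) \<times> bool) list \<Rightarrow> complex) set" where
  "Ao_relations n =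
    (let F = free_star_algebra (Ao_index n);
         u = (\<lambda>i j. free_gen (i, j));
         \<delta> = (\<lambda>i j. if i = j then \<one>\<^bsub>F\<^esub> else \<zero>\<^bsub>F\<^esub>)
     in {u i j \<ominus>\<^bsub>F\<^esub> star F (u i j) | i j. i \<in> {1..n} \<and> j \<in> {1..n}} \<union>
        {(\<Oplus>\<^bsub>F\<^esub>k\<in>{1..n}. u i k \<otimes>\<^bsub>F\<^esub> u j k) \<ominus>\<^bsub>F\<^esub> \<delta> i j | i j. i \<in> {1..n} \<and> j \<in> {1..n}} \<union>
        {(\<Oplus>\<^bsub>F\<^esub>k\<in>{1..n}. u k i \<otimes>\<^bsub>F\<^esub> u k j) \<ominus>\<^bsub>F\<^esub> \<delta> i j | i j. i \<in> {1..n} \<and> j \<in> {1..n}})"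

type_synonym Ao_elem = "(nat \<Rightarrow> ((nat \<times> nat) \<times> bool) list \<Rightarrow> complex) set"

type_synonym Ao_tensor_elem = "(nat \<Rightarrow> Ao_elem \<times> Ao_elem \<Rightarrow> complex) set"

definition Ao :: "nat \<Rightarrow> Ao_elem normed_star_algebra" where
  "Ao n = universal_cstar (Ao_index n) (Ao_relations n)"

definition Ao_gen :: "nat \<Rightarrow> nat \<Rightarrow> nat \<Rightarrow> Ao_elem" where
  "Ao_gen n i j = embed (free_star_algebra (Ao_index n))
     (universal_seminorm (Ao_index n) (Ao_relations n)) (free_gen (i, j))"

definition is_comultiplication :: "nat \<Rightarrow> (Ao_elem \<Rightarrow> Ao_tensor_elem) \<Rightarrow> bool" where
  "is_comultiplication n \<Delta> \<longleftrightarrow>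
     (let A = Ao n; T = min_tensor A A in
      unital_star_hom A T \<Delta> \<and>
      (\<forall>i\<in>{1..n}. \<forall>j\<in>{1..n}.
         \<Delta> (Ao_gen n i j) =
           (\<Oplus>\<^bsub>T\<^esub>k\<in>{1..n}. elem_tensor A A (Ao_gen n i k) (Ao_gen n k j))))"

definition is_haar_functional ::
  "nat \<Rightarrow> (Ao_elem \<Rightarrow> Ao_tensor_elem) \<Rightarrow> (Ao_elem \<Rightarrow> complex) \<Rightarrow> bool" where
  "is_haar_functional n \<Delta> h \<longleftrightarrow>
     (let A = Ao n in
      positive_form A h \<and> h \<one>\<^bsub>A\<^esub> = 1 \<and>
      (\<exists>S. is_slice_right A A h S \<and> (\<forall>a\<in>carrier A. S (\<Delta> a) = h a \<odot>\<^bsub>A\<^esub> \<one>\<^bsub>A\<^esub>)) \<and>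
      (\<exists>S. is_slice_left A A h S \<and> (\<forall>a\<in>carrier A. S (\<Delta> a) = h a \<odot>\<^bsub>A\<^esub> \<one>\<^bsub>A\<^esub>)))"


section \<open>The power series \<open>sqrt (1 - 4 z\<^sup>2)\<close>\<close>

text \<open>The first argument of \<^const>\<open>fps_radical\<close> prescribes the constant term, here 1.\<close>

definition sqrt_series :: "complex fps" where
  "sqrt_series = fps_radical (\<lambda>_ _. 1) 2 (1 - 4 * fps_X ^ 2)"

lemma sqrt_series_iff:
  "s = sqrt_series \<longleftrightarrow> s ^ 2 = 1 - 4 * fps_X ^ 2 \<and> fps_nth s 0 = 1"
proof -
  let ?b = "1 - 4 * fps_X ^ 2 :: complex fps"
  have b0: "fps_nth ?b 0 = 1" by simp
  have sq: "fps_radical (\<lambda>_ _. 1) (Suc 1) ?b ^ Suc 1 = ?b"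
    using power_radical[of ?b "\<lambda>_ _. 1" 1] b0 by simp
  have uniq: "s = fps_radical (\<lambda>_ _. 1) (Suc 1) ?b" if "s ^ Suc 1 = ?b" "fps_nth s 0 = 1"
    using radical_unique[of "\<lambda>_ _. 1" 1 ?b s] that b0 by simp
  show ?thesis
    using sq uniq unfolding sqrt_series_def by (auto simp: numeral_2_eq_2)
qed

end

theory Submission
  imports Defs "HOL-Combinatorics.Permutations"
    "HOL-Computational_Algebra.Formal_Laurent_Series"
begin

text \<open>
  Write \<open>\<xi> w\<close> for the Haar integral of the product of the entries \<open>u\<^bsub>w\<^sub>1 1\<^esub>, u\<^bsub>w\<^sub>2 1\<^esub>, \<dots>\<close> of the
  first column. Invariance makes \<open>\<xi>\<close> a fixed vector of a tensor power of \<open>u\<close>. Two families of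
  quotients of \<open>A\<^sub>o(n)\<close> suffice to determine the fixed vectors when \<open>n\<close> is large: the characters
  given by orthogonal matrices make \<open>\<xi>\<close> invariant under permutations and infinitesimal rotations, and
  the diagonal matrices over the free product of \<open>n\<close> copies of the group with two elements force \<open>\<xi> w\<close>
  to vanish unless \<open>w\<close> is trivial in this free product. Hence \<open>\<xi>\<close> is a combination, with
  coefficients \<open>x\<^sub>t\<close>, of the indicators of the words compatible with a noncrossing pairing \<open>t\<close>, and
  the relation \<open>\<Sum>\<^sub>a u\<^bsub>a1\<^esub>\<^sup>2 = 1\<close> gives the Gram system \<open>\<Sum>\<^sub>q x\<^sub>q G(q, t) = 1\<close>. The row sums of \<open>G\<close> are
  \<open>n\<^sup>m (1 + e(t) / n + O(1 / n\<^sup>2))\<close>, where \<open>e(t)\<close> counts the noncrossing pairings that differ from \<open>t\<close>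
  in two arches, so that \<open>n\<^sup>m \<xi>(1\<dots>1) = \<Sum>\<^sub>t x\<^sub>t n\<^sup>m\<close> is the Catalan number minus \<open>\<Sum>\<^sub>t e(t) / n\<close>, up to
  \<open>O(1 / n\<^sup>2)\<close>.

  That the universal seminorm is finite follows from \<open>\<Sum>\<^sub>k u\<^bsub>kj\<^esub>\<^sup>2 = 1\<close> by approximating square
  roots of \<open>1 - f\<close>; that the minimal seminorm is a C*-seminorm follows from Schur's product theorem and
  an iterated Cauchy-Schwarz inequality.
\<close>

section \<open>Words and noncrossing pairings\<close>

text \<open>The classical route reads the moments off the intertwiner spaces of
  \<open>A_o(n)\<close>. Here only explicit quotients are at hand: one of them kills every word
  without a noncrossing pairing, and rotations reduce the other words to those in which each letter
  occurs exactly twice. A rotation needs a letter that does not occur yet, whence the bound of the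
  word length by \<open>n\<close>; for a fixed order of the moment this is harmless as
  \<open>n\<close> grows. The Gram matrix is never inverted. Adding up its equations and using its
  symmetry shows exactly that the coefficients, weighted by their row sums, add up to the number of
  pairings. Therefore two orders of the row sums and one order of the solution already give two
  orders of the moment. On the analytic side an equation between elements of the completion is
  turned back into the vanishing of the universal seminorm on the free *-algebra, where it can be
  tested with functionals that annihilate null elements.\<close>

definition words :: "'a set \<Rightarrow> nat \<Rightarrow> 'a list set" where
  "words A k = {w. set w \<subseteq> A \<and> length w = k}"

lemma finite_words [simp]: "finite A \<Longrightarrow> finite (words A k)"
  unfolding words_def by (rule finite_lists_length_eq)

lemma card_words: "finite A \<Longrightarrow> card (words A k) = card A ^ k"
  unfolding words_def by (rule card_lists_length_eq)

lemma words_0 [simp]: "words A 0 = {[]}"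
  by (auto simp: words_def)

lemma words_Suc: "words A (Suc k) = (\<lambda>(a, w). a # w) ` (A \<times> words A k)"
  by (auto simp: words_def length_Suc_conv image_iff)

lemma words_add: "words A (k + l) = (\<lambda>(u, v). u @ v) ` (words A k \<times> words A l)"
proof -
  have "w \<in> (\<lambda>(u, v). u @ v) ` (words A k \<times> words A l)" if "w \<in> words A (k + l)" for w
  proof -
    have "take k w \<in> words A k" "drop k w \<in> words A l"
      using that set_take_subset[of k w] set_drop_subset[of k w] by (auto simp: words_def)
    then show ?thesis by (intro image_eqI[of _ _ "(take k w, drop k w)"]) auto
  qed
  then show ?thesis by (auto simp: words_def)
qed

lemma sum_words_Suc: "sum f (words A (Suc k)) = (\<Sum>a\<in>A. \<Sum>w\<in>words A k. f (a # w))"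
  unfolding words_Suc
  by (subst sum.reindex) (auto simp: inj_on_def sum.cartesian_product case_prod_unfold)

lemma sum_words_add:
  "sum f (words A (k + l)) = (\<Sum>u\<in>words A k. \<Sum>v\<in>words A l. f (u @ v))"
  unfolding words_add
  by (subst sum.reindex) (auto simp: inj_on_def sum.cartesian_product case_prod_unfold words_def)

text \<open>The noncrossing pairings of \<open>2 m\<close> points are encoded by the binary trees with \<open>m\<close> inner nodes:
  \<open>Nd l r\<close> pairs the first point with the point that follows the points of \<open>l\<close>.\<close>

datatype nct = Lf | Nd nct nct

inductive fits :: "nct \<Rightarrow> 'a list \<Rightarrow> bool" where
  fits_Lf: "fits Lf []"
| fits_Nd: "fits l u \<Longrightarrow> fits r v \<Longrightarrow> fits (Nd l r) (a # u @ a # v)"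

lemma fits_Lf_iff [simp]: "fits Lf w \<longleftrightarrow> w = []"
  by (auto elim: fits.cases intro: fits_Lf)

lemma fits_Nd_iff:
  "fits (Nd l r) w \<longleftrightarrow> (\<exists>a u v. w = a # u @ a # v \<and> fits l u \<and> fits r v)"
  by (subst fits.simps) auto

lemma fits_length: "fits t w \<Longrightarrow> length w = 2 * size t"
  by (induction rule: fits.induct) auto

lemma fits_Nil_iff [simp]: "fits t [] \<longleftrightarrow> t = Lf"
  using fits_length[of t "[]"] by (cases t) auto

definition ncts :: "nat \<Rightarrow> nct set" where
  "ncts m = {t. size t = m}"

lemma ncts_0: "ncts 0 = {Lf}"
proof -
  have "t = Lf" if "size t = 0" for t :: nct using that by (cases t) auto
  then show ?thesis by (auto simp: ncts_def)
qed

lemma ncts_Suc: "ncts (Suc m) = (\<Union>i\<le>m. (\<lambda>(l, r). Nd l r) ` (ncts i \<times> ncts (m - i)))"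
proof -
  have "t \<in> (\<Union>i\<le>m. (\<lambda>(l, r). Nd l r) ` (ncts i \<times> ncts (m - i)))" if "t \<in> ncts (Suc m)" for t
    using that by (cases t) (auto simp: ncts_def image_iff)
  then show ?thesis by (auto simp: ncts_def)
qed

lemma finite_ncts [simp]: "finite (ncts m)"
proof (induction m rule: less_induct)
  case (less m)
  then show ?case by (cases m) (auto simp: ncts_0 ncts_Suc)
qed

lemma sum_ncts_Suc:
  "sum f (ncts (Suc m)) = (\<Sum>i\<le>m. \<Sum>l\<in>ncts i. \<Sum>r\<in>ncts (m - i). f (Nd l r))"
proof -
  have "sum f (ncts (Suc m)) = (\<Sum>i\<le>m. sum f ((\<lambda>(l, r). Nd l r) ` (ncts i \<times> ncts (m - i))))"
    unfolding ncts_Suc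
  proof (rule sum.UNION_disjoint)
    show "\<forall>i\<in>{..m}. finite ((\<lambda>(l, r). Nd l r) ` (ncts i \<times> ncts (m - i)))"
      using finite_ncts by blast
  qed (auto simp: ncts_def)
  also have "\<dots> = (\<Sum>i\<le>m. \<Sum>l\<in>ncts i. \<Sum>r\<in>ncts (m - i). f (Nd l r))"
    by (simp add: sum.reindex inj_on_def sum.cartesian_product case_prod_unfold)
  finally show ?thesis .
qed

text \<open>The word whose letters are paired by \<open>t\<close>, the pairs being labelled by \<open>ls\<close> in the order of their
  first points.\<close>

fun wordt :: "nct \<Rightarrow> 'a list \<Rightarrow> 'a list" where
  "wordt Lf ls = []"
| "wordt (Nd l r) ls =
     hd ls # wordt l (take (size l) (tl ls)) @ hd ls # wordt r (drop (size l) (tl ls))"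

lemma wordt_Nd [simp]:
  assumes "length ls1 = size l"
  shows "wordt (Nd l r) (a # ls1 @ ls2) = a # wordt l ls1 @ a # wordt r ls2"
  using assms by simp

declare wordt.simps(2) [simp del]

lemma labels_NdE:
  assumes "length ls = size (Nd l r)"
  obtains a ls1 ls2 where "ls = a # ls1 @ ls2" "length ls1 = size l" "length ls2 = size r"
proof -
  obtain a ls' where ls: "ls = a # ls'" "length ls' = size l + size r"
    using assms by (cases ls) auto
  show thesis
    using ls by (intro that[of a "take (size l) ls'" "drop (size l) ls'"]) auto
qed

lemma fits_wordt: "length ls = size t \<Longrightarrow> fits t (wordt t ls)"
proof (induction t arbitrary: ls)
  case (Nd l r)
  from Nd.prems obtain a ls1 ls2
    where "ls = a # ls1 @ ls2" "length ls1 = size l" "length ls2 = size r"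
    by (rule labels_NdE)
  then show ?case using Nd.IH by (auto intro: fits_Nd)
qed simp

lemma length_wordt: "length ls = size t \<Longrightarrow> length (wordt t ls) = 2 * size t"
  by (rule fits_length) (rule fits_wordt)

lemma set_wordt: "length ls = size t \<Longrightarrow> set (wordt t ls) = set ls"
proof (induction t arbitrary: ls)
  case (Nd l r)
  from Nd.prems obtain a ls1 ls2
    where "ls = a # ls1 @ ls2" "length ls1 = size l" "length ls2 = size r"
    by (rule labels_NdE)
  then show ?case using Nd.IH by auto
qed simp

lemma count_list_wordt: "length ls = size t \<Longrightarrow> count_list (wordt t ls) x = 2 * count_list ls x"
proof (induction t arbitrary: ls)
  case (Nd l r)
  from Nd.prems obtain a ls1 ls2
    where "ls = a # ls1 @ ls2" "length ls1 = size l" "length ls2 = size r"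
    by (rule labels_NdE)
  then show ?case using Nd.IH by auto
qed simp

lemma map_wordt: "length ls = size t \<Longrightarrow> map f (wordt t ls) = wordt t (map f ls)"
proof (induction t arbitrary: ls)
  case (Nd l r)
  from Nd.prems obtain a ls1 ls2
    where "ls = a # ls1 @ ls2" "length ls1 = size l" "length ls2 = size r"
    by (rule labels_NdE)
  then show ?case using Nd.IH by auto
qed simp

lemma fits_imp_wordt: "fits t w \<Longrightarrow> \<exists>ls. length ls = size t \<and> w = wordt t ls"
proof (induction rule: fits.induct)
  case (fits_Nd l u r v a)
  then obtain ls1 ls2 where "length ls1 = size l" "u = wordt l ls1"
    "length ls2 = size r" "v = wordt r ls2" by auto
  then show ?case by (intro exI[of _ "a # ls1 @ ls2"]) auto
qed auto

lemma wordt_inj: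
  assumes "length ls = size t" "length ls' = size t" "wordt t ls = wordt t ls'"
  shows "ls = ls'"
  using assms
proof (induction t arbitrary: ls ls')
  case (Nd l r)
  from Nd.prems(1) obtain a ls1 ls2
    where 1: "ls = a # ls1 @ ls2" "length ls1 = size l" "length ls2 = size r"
    by (rule labels_NdE)
  from Nd.prems(2) obtain a' ls1' ls2'
    where 2: "ls' = a' # ls1' @ ls2'" "length ls1' = size l" "length ls2' = size r"
    by (rule labels_NdE)
  have "length (wordt l ls1) = length (wordt l ls1')"
    using 1 2 by (simp add: length_wordt)
  then show ?case using Nd.prems(3) Nd.IH 1 2 by auto
qed simp

lemma fitting_words_eq:
  "{w \<in> words A (2 * size t). fits t w} = wordt t ` words A (size t)"
proof -
  have "w \<in> wordt t ` words A (size t)" if "w \<in> words A (2 * size t)" "fits t w" for w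
    using fits_imp_wordt[OF that(2)] that(1) set_wordt[of _ t] by (auto simp: words_def)
  moreover have "wordt t ls \<in> {w \<in> words A (2 * size t). fits t w}"
    if "ls \<in> words A (size t)" for ls
    using that set_wordt[of ls t] length_wordt[of ls t] fits_wordt[of ls t]
    by (auto simp: words_def)
  ultimately show ?thesis by blast
qed

lemma sum_fitting_words:
  "(\<Sum>w | w \<in> words A (2 * size t) \<and> fits t w. f w) = (\<Sum>ls\<in>words A (size t). f (wordt t ls))"
proof -
  have "inj_on (wordt t) (words A (size t))"
    by (auto simp: inj_on_def words_def intro: wordt_inj)
  then show ?thesis
    using fitting_words_eq[of A t] by (simp add: sum.reindex)
qed

lemma sum_labels_Nd:
  "sum f (words A (size (Nd l r))) =
    (\<Sum>a\<in>A. \<Sum>u\<in>words A (size l). \<Sum>v\<in>words A (size r). f (a # u @ v))"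
  by (simp add: sum_words_Suc sum_words_add)

lemma split_at_unique:
  assumes "a # u' @ a # v' = a # u @ a # v" "a \<notin> set u" "a \<notin> set v"
  shows "u' = u \<and> v' = v"
  using assms append_Cons_eq_iff[of a u v u' v'] by auto

text \<open>With distinct labels every letter occurs exactly twice, so the partner of each point is
  forced. Such words isolate one coefficient in \<open>moment_expansion\<close> and give the row
  sums their leading term.\<close>

lemma fits_wordt_distinct:
  assumes "distinct ls" "length ls = size t" "fits t' (wordt t ls)"
  shows "t' = t"
  using assms
proof (induction t arbitrary: ls t')
  case (Nd l r)
  from Nd.prems(2) obtain a ls1 ls2
    where ls: "ls = a # ls1 @ ls2" "length ls1 = size l" "length ls2 = size r"
    by (rule labels_NdE)
  have a: "a \<notin> set (wordt l ls1)" "a \<notin> set (wordt r ls2)"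
    using Nd.prems(1) ls by (auto simp: set_wordt)
  obtain l' r' where t': "t' = Nd l' r'"
    using Nd.prems(3) ls by (cases t') auto
  obtain u v where uv: "a # u @ a # v = a # wordt l ls1 @ a # wordt r ls2" "fits l' u" "fits r' v"
    using Nd.prems(3) ls t' by (auto simp: fits_Nd_iff)
  with a have "u = wordt l ls1" "v = wordt r ls2" using split_at_unique by metis+
  then show ?case using uv Nd.IH Nd.prems(1) ls t' by auto
qed auto

subsection \<open>Words that are trivial in the free product of copies of the group with two elements\<close>

text \<open>Left multiplication by the generator \<open>i\<close> on reduced words of the free
  product: it cancels against an equal first letter and is prepended otherwise. Reducedness is
  \<open>distinct_adj\<close>.\<close>

definition act :: "'a \<Rightarrow> 'a list \<Rightarrow> 'a list" where
  "act i c = (case c of [] \<Rightarrow> [i] | j # c' \<Rightarrow> if i = j then c' else i # c)"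

definition reduced_form :: "'a list \<Rightarrow> 'a list" where
  "reduced_form w = foldr act w []"

text \<open>A word v_0 c_1 v_1 ... c_k v_k whose blocks v_i carry noncrossing pairings. It
  certifies, all along the reduction, that everything except \<open>c\<close> cancels in nested
  pairs; for empty \<open>c\<close> it is a noncrossing pairing of the whole word.\<close>

inductive interleaved :: "'a list \<Rightarrow> 'a list \<Rightarrow> bool" where
  interleaved_Nil: "fits t v \<Longrightarrow> interleaved v []"
| interleaved_Cons: "fits t v \<Longrightarrow> interleaved w c \<Longrightarrow> interleaved (v @ j # w) (j # c)"

lemma interleaved_act: "interleaved w c \<Longrightarrow> interleaved (a # w) (act a c)"
proof (induction rule: interleaved.induct)
  case (interleaved_Nil t v)
  then show ?case
    using interleaved_Cons[OF fits_Lf interleaved.interleaved_Nil[OF interleaved_Nil], of a]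
    by (simp add: act_def)
next
  case (interleaved_Cons t v w c j)
  show ?case
  proof (cases "a = j")
    case True
    \<comment> \<open>The new letter cancels against the first surviving letter \<open>j\<close>.
      The two become the ends of an arch over \<open>v\<close>, which is absorbed into the block
      that follows.\<close>
    from interleaved_Cons(2) have "interleaved (j # v @ j # w) c"
    proof cases
      case (interleaved_Nil t')
      then show ?thesis
        using interleaved_Cons(1) by (auto intro: interleaved.interleaved_Nil fits_Nd)
    next
      case (interleaved_Cons t' v' w' c' i)
      have "interleaved ((j # v @ j # v') @ i # w') (i # c')"
        by (rule interleaved.interleaved_Cons[OF fits_Nd[OF \<open>fits t v\<close> \<open>fits t' v'\<close>] \<open>interleaved w' c'\<close>])
      then show ?thesis using interleaved_Cons by simp
    qed
    then show ?thesis using True by (simp add: act_def)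
  next
    case False
    then show ?thesis
      using interleaved.interleaved_Cons[OF fits_Lf interleaved.interleaved_Cons[OF interleaved_Cons(1,2)], of a j]
      by (simp add: act_def)
  qed
qed

lemma interleaved_reduced_form: "interleaved w (reduced_form w)"
  by (induction w) (auto simp: reduced_form_def intro: interleaved_act interleaved_Nil fits_Lf)

lemma reduced_form_Nil_imp_fits: "reduced_form w = [] \<Longrightarrow> \<exists>t. fits t w"
  using interleaved_reduced_form[of w] by (auto elim: interleaved.cases)

lemma distinct_adj_act: "distinct_adj c \<Longrightarrow> distinct_adj (act i c)"
  by (cases c) (auto simp: act_def distinct_adj_Cons split: list.splits)

lemma act_act: "distinct_adj c \<Longrightarrow> act i (act i c) = c"
  by (cases c) (auto simp: act_def distinct_adj_Cons split: list.splits)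

lemma distinct_adj_foldr_act: "distinct_adj c \<Longrightarrow> distinct_adj (foldr act w c)"
  by (induction w) (auto intro: distinct_adj_act)

text \<open>Each generator is its own inverse. In \<open>free_group_coeff\<close> this lets the
  adjoint of a diagonal word act as its inverse.\<close>

lemma foldr_act_rev: "distinct_adj c \<Longrightarrow> foldr act (rev w) (foldr act w c) = c"
  by (induction w) (auto simp: act_act distinct_adj_foldr_act)

subsection \<open>Infinitesimal rotations\<close>

text \<open>The derivative at angle \<open>0\<close> of the action on tensors of the rotations in the coordinate plane of
  \<open>a\<close> and \<open>b\<close>.\<close>

fun rot_deriv :: "'a \<Rightarrow> 'a \<Rightarrow> ('a list \<Rightarrow> complex) \<Rightarrow> 'a list \<Rightarrow> complex" where
  "rot_deriv a b f [] = 0"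
| "rot_deriv a b f (c # w) = of_bool (c = a) * f (b # w) - of_bool (c = b) * f (a # w)
     + rot_deriv a b (\<lambda>v. f (c # v)) w"

lemma rot_deriv_conv_sum:
  "rot_deriv a b f w =
    (\<Sum>i<length w. of_bool (w ! i = a) * f (w[i := b]) - of_bool (w ! i = b) * f (w[i := a]))"
  by (induction w arbitrary: f) (simp_all add: sum.lessThan_Suc_shift del: sum.lessThan_Suc)

lemma rot_deriv_cong:
  "(\<And>v. length v = length w \<Longrightarrow> f v = g v) \<Longrightarrow> rot_deriv a b f w = rot_deriv a b g w"
  unfolding rot_deriv_conv_sum by (auto intro!: sum.cong)

lemma rot_deriv_append:
  "rot_deriv a b f (u @ v) =
    rot_deriv a b (\<lambda>u'. f (u' @ v)) u + rot_deriv a b (\<lambda>v'. f (u @ v')) v"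
  by (induction u arbitrary: f) simp_all

lemma rot_deriv_0: "rot_deriv a b (\<lambda>_. 0) w = 0"
  by (simp add: rot_deriv_conv_sum)

lemma rot_deriv_cmult: "rot_deriv a b (\<lambda>w. c * f w) w = c * rot_deriv a b f w"
  by (simp add: rot_deriv_conv_sum sum_distrib_left algebra_simps)

lemma rot_deriv_diff: "rot_deriv a b (\<lambda>w. f w - g w) w = rot_deriv a b f w - rot_deriv a b g w"
  by (simp add: rot_deriv_conv_sum sum_subtractf[symmetric] algebra_simps)

lemma rot_deriv_sum:
  "rot_deriv a b (\<lambda>w. \<Sum>t\<in>T. f t w) w = (\<Sum>t\<in>T. rot_deriv a b (f t) w)"
proof (induction w arbitrary: f)
  case (Cons c w)
  show ?case
    by (simp add: Cons.IH[of "\<lambda>t v. f t (c # v)"] sum.distrib sum_subtractf sum_distrib_left)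
qed simp

lemma fits_Nd_append_iff:
  assumes "length u = 2 * size l"
  shows "fits (Nd l r) (c # u @ d # v) \<longleftrightarrow> c = d \<and> fits l u \<and> fits r v"
proof
  assume "fits (Nd l r) (c # u @ d # v)"
  then obtain a u' v' where *: "c # u @ d # v = a # u' @ a # v'" "fits l u'" "fits r v'"
    by (auto simp: fits_Nd_iff)
  with assms have "length u' = length u" by (simp add: fits_length)
  with * show "c = d \<and> fits l u \<and> fits r v" by auto
qed (auto intro: fits_Nd)

text \<open>The indicator of a pairing is a tensor product of copies of the rotation-invariant sum
  of \<open>e_a \<otimes> e_a\<close>. The derivative acts on one arch at a time, and moving its
  left end cancels moving its right end.\<close>

lemma rot_deriv_fits: "rot_deriv a b (\<lambda>w. of_bool (fits t w)) w = 0"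
proof (induction t arbitrary: w)
  case Lf
  show ?case by (cases w) (simp_all add: rot_deriv_0)
next
  case (Nd l r)
  show ?case
  proof (cases "length w = 2 * size (Nd l r)")
    case False
    then have "rot_deriv a b (\<lambda>w. of_bool (fits (Nd l r) w)) w = rot_deriv a b (\<lambda>_. 0) w"
      by (intro rot_deriv_cong) (auto dest: fits_length)
    then show ?thesis by (simp add: rot_deriv_0)
  next
    case True
    then obtain c w' where w: "w = c # w'" "length w' = 2 * size l + 2 * size r + 1"
      by (cases w) auto
    define u where "u = take (2 * size l) w'"
    obtain d v where dv: "drop (2 * size l) w' = d # v"
      using w(2) by (cases "drop (2 * size l) w'") auto
    have w': "w' = u @ d # v" using dv append_take_drop_id[of "2 * size l" w'] by (simp add: u_def)
    have u: "length u = 2 * size l" using w(2) by (simp add: u_def)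
    have 1: "rot_deriv a b (\<lambda>u'. of_bool (fits (Nd l r) (c # u' @ d # v))) u = 0"
    proof -
      have "rot_deriv a b (\<lambda>u'. of_bool (fits (Nd l r) (c # u' @ d # v))) u =
        rot_deriv a b (\<lambda>u'. of_bool (c = d \<and> fits r v) * of_bool (fits l u')) u"
        by (rule rot_deriv_cong) (auto simp: u fits_Nd_append_iff)
      then show ?thesis using Nd.IH by (simp add: rot_deriv_cmult)
    qed
    have 2: "rot_deriv a b (\<lambda>v'. of_bool (fits (Nd l r) (c # u @ d # v'))) v = 0"
    proof -
      have "rot_deriv a b (\<lambda>v'. of_bool (fits (Nd l r) (c # u @ d # v'))) v =
        rot_deriv a b (\<lambda>v'. of_bool (c = d \<and> fits l u) * of_bool (fits r v')) v"
        by (rule rot_deriv_cong) (auto simp: u fits_Nd_append_iff)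
      then show ?thesis using Nd.IH by (simp add: rot_deriv_cmult)
    qed
    \<comment> \<open>Only the two ends of the outer arch remain; their terms share the factor given
      by \<open>fits l u\<close> and \<open>fits r v\<close> and differ in sign.\<close>
    show ?thesis
      unfolding w(1) w' rot_deriv.simps rot_deriv_append 1 2
      by (simp add: fits_Nd_append_iff u)
  qed
qed

text \<open>The complements of the two label sets have the same size, so the positionwise bijection
  extends across them. With it, permutation invariance makes moments of words with distinct labels
  independent of the labels.\<close>

lemma ex_permutes_map_eq:
  assumes "finite A" "distinct xs" "distinct ys" "length xs = length ys"
    "set xs \<subseteq> A" "set ys \<subseteq> A"
  shows "\<exists>\<pi>. \<pi> permutes A \<and> map \<pi> xs = ys"
proof -
  define f where "f = (\<lambda>x. ys ! (THE i. i < length xs \<and> xs ! i = x))"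
  have f: "f (xs ! i) = ys ! i" if "i < length xs" for i
  proof -
    have "(THE j. j < length xs \<and> xs ! j = xs ! i) = i"
      using that assms(2) by (auto simp: nth_eq_iff_index_eq)
    then show ?thesis by (simp add: f_def)
  qed
  have map_f: "map f xs = ys" using f assms(4) by (auto intro: nth_equalityI)
  have bij_f: "bij_betw f (set xs) (set ys)"
    using map_f assms(2,3) by (metis bij_betw_def distinct_map list.set_map)
  have "card (A - set xs) = card (A - set ys)"
    using assms by (simp add: card_Diff_subset distinct_card)
  then obtain g where g: "bij_betw g (A - set xs) (A - set ys)"
    using assms(1) finite_same_card_bij by blast
  define \<pi> where "\<pi> = (\<lambda>x. if x \<in> A then if x \<in> set xs then f x else g x else x)"
  have "bij_betw \<pi> (set xs \<union> (A - set xs)) (set ys \<union> (A - set ys))"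
  proof (rule bij_betw_combine)
    show "bij_betw \<pi> (set xs) (set ys)"
      using bij_f assms(5) by (subst bij_betw_cong[of _ _ f]) (auto simp: \<pi>_def)
    show "bij_betw \<pi> (A - set xs) (A - set ys)"
      using g by (subst bij_betw_cong[of _ _ g]) (auto simp: \<pi>_def)
  qed auto
  then have "bij_betw \<pi> A A" using assms(5,6) by (simp add: Un_absorb1)
  then have "\<pi> permutes A" by (rule bij_imp_permutes) (simp add: \<pi>_def)
  moreover have "map \<pi> xs = ys" using map_f assms(5) by (auto simp: \<pi>_def)
  ultimately show ?thesis by blast
qed

subsection \<open>Moments of the first column\<close>

text \<open>All that the asymptotic half knows about the Haar functional. Rotations enter through
  their derivative, so no trigonometry appears here. The instance is
  \<open>column_moments_moment\<close>.\<close>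

locale column_moments =
  fixes n :: nat and \<xi> :: "nat list \<Rightarrow> complex"
  assumes moment_Nil: "\<xi> [] = 1"
    and contraction: "set u \<subseteq> {1..n} \<Longrightarrow> set v \<subseteq> {1..n} \<Longrightarrow>
      (\<Sum>a\<in>{1..n}. \<xi> (u @ a # a # v)) = \<xi> (u @ v)"
    and perm_invariant: "\<pi> permutes {1..n} \<Longrightarrow> set w \<subseteq> {1..n} \<Longrightarrow> \<xi> (map \<pi> w) = \<xi> w"
    and rot_invariant: "a \<in> {1..n} \<Longrightarrow> b \<in> {1..n} \<Longrightarrow> a \<noteq> b \<Longrightarrow> set w \<subseteq> {1..n} \<Longrightarrow>
      rot_deriv a b \<xi> w = 0"
    and vanishing: "set w \<subseteq> {1..n} \<Longrightarrow> reduced_form w \<noteq> [] \<Longrightarrow> \<xi> w = 0"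
begin

text \<open>The labels 1, ..., m stand for any distinct labels, by \<open>wordt_moment\<close>. No
  other pairing fits such a word, so its moment has to be the coefficient of
  \<open>t\<close>.\<close>

definition coeff_nct :: "nct \<Rightarrow> complex" where
  "coeff_nct t = \<xi> (wordt t [1..<Suc (size t)])"

text \<open>Contraction applies to neighbouring letters only. The ends of an arch become neighbours
  once the word under it is summed out, so arches disappear from the inside; \<open>u\<close> and
  \<open>v\<close> are the surroundings met on the way.\<close>

lemma sum_moments_wordt:
  "set u \<subseteq> {1..n} \<Longrightarrow> set v \<subseteq> {1..n} \<Longrightarrow>
    (\<Sum>ls\<in>words {1..n} (size t). \<xi> (u @ wordt t ls @ v)) = \<xi> (u @ v)"
proof (induction t arbitrary: u v)
  case (Nd l r)
  have "(\<Sum>ls\<in>words {1..n} (size (Nd l r)). \<xi> (u @ wordt (Nd l r) ls @ v)) =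
    (\<Sum>a\<in>{1..n}. \<Sum>x\<in>words {1..n} (size l). \<Sum>y\<in>words {1..n} (size r).
      \<xi> ((u @ a # wordt l x @ [a]) @ wordt r y @ v))"
    unfolding sum_labels_Nd by (intro sum.cong) (simp_all add: words_def)
  also have "\<dots> = (\<Sum>a\<in>{1..n}. \<Sum>x\<in>words {1..n} (size l). \<xi> ((u @ a # wordt l x @ [a]) @ v))"
  proof (intro sum.cong HOL.refl Nd.IH(2))
    fix a x assume "a \<in> {1..n}" "x \<in> words {1..n} (size l)"
    then show "set (u @ a # wordt l x @ [a]) \<subseteq> {1..n}"
      using Nd.prems set_wordt[of x l] by (simp add: words_def)
  qed (rule Nd.prems)
  also have "\<dots> = (\<Sum>a\<in>{1..n}. \<Sum>x\<in>words {1..n} (size l). \<xi> ((u @ [a]) @ wordt l x @ (a # v)))"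
    by simp
  also have "\<dots> = (\<Sum>a\<in>{1..n}. \<xi> ((u @ [a]) @ a # v))"
    by (intro sum.cong HOL.refl Nd.IH(1)) (use Nd.prems in auto)
  also have "\<dots> = \<xi> (u @ v)" using contraction[OF Nd.prems] by simp
  finally show ?case .
qed simp

lemma wordt_moment:
  assumes "distinct ls" "length ls = size t" "set ls \<subseteq> {1..n}" "size t \<le> n"
  shows "\<xi> (wordt t ls) = coeff_nct t"
proof -
  have "\<exists>\<pi>. \<pi> permutes {1..n} \<and> map \<pi> ls = [1..<Suc (size t)]"
    using assms by (intro ex_permutes_map_eq) auto
  then obtain \<pi> where \<pi>: "\<pi> permutes {1..n}" "map \<pi> ls = [1..<Suc (size t)]" by blast
  then show ?thesis
    unfolding coeff_nct_def
    using perm_invariant[OF \<pi>(1), of "wordt t ls"] assms by (simp add: map_wordt set_wordt)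
qed

text \<open>A letter that occurs at least three times is traded for a fresh one by an infinitesimal rotation;
  this reduces everything to words that are pairings, where the moments are known by definition.\<close>

lemma moment_expansion:
  assumes "2 * m \<le> n" "w \<in> words {1..n} (2 * m)"
  shows "\<xi> w = (\<Sum>t\<in>ncts m. coeff_nct t * of_bool (fits t w))"
proof -
  \<comment> \<open>The defect of the expansion. It inherits the rotation equations from
    \<open>\<xi>\<close>, since indicators of pairings satisfy them, and it vanishes on words
    without a pairing and on words with distinct labels.\<close>
  define \<zeta> where "\<zeta> = (\<lambda>w. \<xi> w - (\<Sum>t\<in>ncts m. coeff_nct t * of_bool (fits t w)))"
  have rot: "rot_deriv a b \<zeta> w = 0" if "a \<in> {1..n}" "b \<in> {1..n}" "a \<noteq> b" "set w \<subseteq> {1..n}" for a b w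
    unfolding \<zeta>_def rot_deriv_diff rot_deriv_sum rot_deriv_cmult rot_deriv_fits
    using rot_invariant[OF that] by simp
  have "\<zeta> w = 0" if "w \<in> words {1..n} (2 * m)" for w
    using that
  proof (induction "n - card (set w)" arbitrary: w rule: less_induct)
    case less
    have len: "length w = 2 * m" and sub: "set w \<subseteq> {1..n}" using less.prems by (auto simp: words_def)
    show ?case
    proof (cases "\<exists>t. fits t w")
      case False
      with reduced_form_Nil_imp_fits vanishing[OF sub] have "\<xi> w = 0" by auto
      with False show ?thesis by (simp add: \<zeta>_def)
    next
      case True
      then obtain t where t: "fits t w" by blast
      with len have st: "size t = m" by (simp add: fits_length)
      obtain ls where ls: "length ls = size t" "w = wordt t ls" using fits_imp_wordt[OF t] by blast
      show ?thesis
      proof (cases "distinct ls")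
        case True
        have "fits t' w \<longleftrightarrow> t' = t" for t'
          using fits_wordt_distinct[OF True ls(1)] ls(2) t by auto
        then have "(\<Sum>t'\<in>ncts m. coeff_nct t' * of_bool (fits t' w)) =
            (\<Sum>t'\<in>ncts m. if t' = t then coeff_nct t else 0)"
          by (intro sum.cong) auto
        also have "\<dots> = coeff_nct t" using st by (simp add: ncts_def[symmetric]) (simp add: ncts_def)
        also have "\<dots> = \<xi> w"
          using wordt_moment[OF True ls(1)] ls set_wordt[OF ls(1)] sub st assms(1) by simp
        finally show ?thesis by (simp add: \<zeta>_def)
      next
        case False
        then obtain a xs ys zs where "ls = xs @ [a] @ ys @ [a] @ zs"
          using not_distinct_decomp by blast
        \<comment> \<open>A repeated label means two arches with the same letter, hence four
          occurrences: two can be overwritten and the letter still survives.\<close>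
        then have "card {j. j < length w \<and> a = w ! j} \<ge> 4"
          using count_list_wordt[OF ls(1), of a] ls(2)
          by (simp add: count_list_eq_length_filter length_filter_conv_card)
        have "card (set w) \<le> m"
          using set_wordt[OF ls(1)] ls card_length[of ls] st by simp
        moreover have "m < 2 * m" using ls(1) st \<open>ls = xs @ [a] @ ys @ [a] @ zs\<close> by auto
        ultimately have card_w: "card (set w) < n" using assms(1) by linarith
        obtain b where b: "b \<in> {1..n}" "b \<notin> set w"
          using card_w sub by (metis card_atLeastAtMost card_mono diff_Suc_1 finite_set not_le subsetI)
        have "a \<in> set w"
          using set_wordt[OF ls(1)] ls(2) \<open>ls = xs @ [a] @ ys @ [a] @ zs\<close> by simp
        then obtain p s where w: "w = p @ a # s" "a \<notin> set p" by (meson split_list_first)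
        define k where "k = length p"
        \<comment> \<open>In the rotation equation at \<open>w'\<close>, position \<open>k\<close>
          gives back \<open>w\<close> with a minus sign. Rotating another \<open>a\<close> into
          \<open>b\<close> leaves all letters of \<open>w\<close> present and adds \<open>b\<close>,
          so the induction hypothesis removes these terms.\<close>
        define w' where "w' = p @ b # s"
        have k: "k < length w" "w ! k = a" "w' = w[k := b]" by (simp_all add: k_def w w'_def)
        have zero: "\<zeta> (w'[i := b]) = 0" if i: "i < length w" "w' ! i = a" for i
        proof (rule less.hyps)
          have "c \<in> set (w'[i := b])" if "c \<in> set w" for c
          proof -
            have "\<exists>j<length w. w ! j = c \<and> j \<notin> {k, i}"
            proof (cases "c = a")
              case True
              have "card ({j. j < length w \<and> a = w ! j} - {k, i}) > 0"
                using \<open>card {j. j < length w \<and> a = w ! j} \<ge> 4\<close>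
                  diff_card_le_card_Diff[of "{k, i}" "{j. j < length w \<and> a = w ! j}"]
                  card_insert_le_m1[of 2 "{i}" k] by simp
              then obtain j where "j \<in> {j. j < length w \<and> a = w ! j} - {k, i}"
                by (metis card_gt_0_iff ex_in_conv)
              then show ?thesis using True by auto
            next
              case False
              have "w ! i = a \<or> i = k" using i k by (auto simp: nth_list_update split: if_splits)
              then show ?thesis
                using that False k(2) by (auto simp: in_set_conv_nth)
            qed
            then show ?thesis
              using k(3) by (metis insertCI length_list_update nth_list_update_neq nth_mem)
          qed
          then have "set w \<subseteq> set (w'[i := b])" by blast
          moreover have "b \<in> set (w'[i := b])" using i k(3) by (simp add: set_update_memI)
          ultimately have "card (insert b (set w)) \<le> card (set (w'[i := b]))"
            by (intro card_mono) auto
          then show "n - card (set (w'[i := b])) < n - card (set w)"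
            using b(2) card_w by simp
        next
          have "set (w'[i := b]) \<subseteq> {1..n}"
            using sub b(1) k(3) set_update_subset_insert[of w' i b] set_update_subset_insert[of w k b] by blast
          then show "w'[i := b] \<in> words {1..n} (2 * m)"
            using len k(3) by (simp add: words_def)
        qed
        have "0 = rot_deriv a b \<zeta> w'"
          using w sub b by (subst rot) (auto simp: w'_def)
        also have "\<dots> = (\<Sum>i<length w. if i = k then - \<zeta> w else 0)"
          unfolding rot_deriv_conv_sum
        proof (rule sum.cong)
          fix i assume "i \<in> {..<length w}"
          then show "of_bool (w' ! i = a) * \<zeta> (w'[i := b]) - of_bool (w' ! i = b) * \<zeta> (w'[i := a]) =
              (if i = k then - \<zeta> w else 0)"
            using b(2) k zero[of i] by (auto simp: nth_list_update list_update_same_conv)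
        qed (simp add: k(3))
        also have "\<dots> = - \<zeta> w" using k(1) by simp
        finally show ?thesis by simp
      qed
    qed
  qed
  then show ?thesis using assms(2) by (simp add: \<zeta>_def)
qed

end

subsection \<open>Counting the noncrossing pairings of a word\<close>

definition fit_count :: "'a list \<Rightarrow> nat" where
  "fit_count w = card {t. fits t w}"

lemma fits_subset_ncts: "{t. fits t w} \<subseteq> ncts (length w div 2)"
  by (auto simp: ncts_def dest: fits_length)

lemma finite_fits [simp]: "finite {t. fits t w}"
  using finite_subset[OF fits_subset_ncts] by simp

lemma fit_count_le: "fit_count w \<le> card (ncts (length w div 2))"
  unfolding fit_count_def by (intro card_mono fits_subset_ncts finite_ncts)

lemma fit_count_Nil [simp]: "fit_count [] = 1"
  by (simp add: fit_count_def)

text \<open>Sums over all ways to write a word as \<open>p @ c # s\<close>.\<close>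

fun splits :: "('a list \<Rightarrow> 'a \<Rightarrow> 'a list \<Rightarrow> 'b::comm_monoid_add) \<Rightarrow> 'a list \<Rightarrow> 'b" where
  "splits F [] = 0"
| "splits F (c # w) = F [] c w + splits (\<lambda>p. F (c # p)) w"

lemma splits_append:
  "splits F (u @ v) = splits (\<lambda>p c s. F p c (s @ v)) u + splits (\<lambda>p. F (u @ p)) v"
  by (induction u arbitrary: F) (simp_all add: add.assoc)

lemma splits_cong:
  "(\<And>p c s. w = p @ c # s \<Longrightarrow> F p c s = G p c s) \<Longrightarrow> splits F w = splits G w"
proof (induction w arbitrary: F G)
  case (Cons a w)
  have "splits (\<lambda>p. F (a # p)) w = splits (\<lambda>p. G (a # p)) w"
    by (rule Cons.IH) (use Cons.prems in auto)
  then show ?case using Cons.prems[of "[]" a w] by simp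
qed simp

lemma splits_0 [simp]: "splits (\<lambda>p c s. 0) w = 0"
  by (induction w) simp_all

lemma splits_le:
  fixes F :: "'a list \<Rightarrow> 'a \<Rightarrow> 'a list \<Rightarrow> nat"
  shows "(\<And>p c s. w = p @ c # s \<Longrightarrow> F p c s \<le> B) \<Longrightarrow> splits F w \<le> length w * B"
proof (induction w arbitrary: F)
  case (Cons a w)
  have "splits (\<lambda>p. F (a # p)) w \<le> length w * B"
    by (rule Cons.IH) (use Cons.prems in auto)
  then show ?case using Cons.prems[of "[]" a w] by simp
qed simp

text \<open>The condition \<open>c = a\<close> picks out one label, so the sum over labels is used
  up without a factor \<open>card A\<close>. This is why giving an arch a new partner costs one
  power of \<open>n\<close>.\<close>

lemma sum_splits_letter:
  assumes "finite A" "set w \<subseteq> A"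
  shows "(\<Sum>a\<in>A. splits (\<lambda>p c s. if c = a then F a p s else 0) w) = splits (\<lambda>p c s. F c p s) w"
  using assms(2)
proof (induction w arbitrary: F)
  case (Cons b w)
  have "(\<Sum>a\<in>A. splits (\<lambda>p c s. if c = a then F a (b # p) s else 0) w) =
      splits (\<lambda>p c s. F c (b # p) s) w"
    by (rule Cons.IH) (use Cons.prems in auto)
  then show ?case using Cons.prems assms(1) by (simp add: sum.distrib)
qed simp

lemma fits_Cons_decomp:
  "{t. fits t (a # w)} = (\<lambda>(l, r). Nd l r) `
     (\<Union>(p, s)\<in>{(p, s). w = p @ a # s}. {l. fits l p} \<times> {r. fits r s})" (is "?L = ?R")
proof -
  have "t \<in> ?R" if "fits t (a # w)" for t
    using that by (cases t) (force simp: fits_Nd_iff)+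
  moreover have "?R \<subseteq> ?L" by (auto intro: fits_Nd)
  ultimately show ?thesis by blast
qed

lemma finite_splits: "finite {(p, s). w = p @ a # s}"
proof (rule finite_subset)
  show "{(p, s). w = p @ a # s} \<subseteq> (\<lambda>i. (take i w, drop (Suc i) w)) ` {..length w}"
  proof clarify
    fix p s assume "w = p @ a # s"
    then show "(p, s) \<in> (\<lambda>i. (take i (p @ a # s), drop (Suc i) (p @ a # s))) ` {..length (p @ a # s)}"
      by (intro image_eqI[of _ _ "length p"]) auto
  qed
qed simp

lemma sum_splits_eq:
  "(\<Sum>(p, s)\<in>{(p, s). w = p @ a # s}. F p s) = splits (\<lambda>p c s. if c = a then F p s else 0) w"
proof (induction w arbitrary: F)
  case (Cons b w)
  have *: "{(p, s). b # w = p @ a # s} =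
    (if b = a then {([], w)} else {}) \<union> (\<lambda>(p, s). (b # p, s)) ` {(p, s). w = p @ a # s}"
    by (auto simp: Cons_eq_append_conv image_iff)
  have "(\<Sum>(p, s)\<in>{(p, s). b # w = p @ a # s}. F p s) =
    (\<Sum>(p, s)\<in>(if b = a then {([], w)} else {}). F p s) +
    (\<Sum>(p, s)\<in>(\<lambda>(p, s). (b # p, s)) ` {(p, s). w = p @ a # s}. F p s)"
    unfolding * by (rule sum.union_disjoint) (use finite_splits[of w a] in auto)
  also have "(\<Sum>(p, s)\<in>(\<lambda>(p, s). (b # p, s)) ` {(p, s). w = p @ a # s}. F p s) =
    (\<Sum>(p, s)\<in>{(p, s). w = p @ a # s}. F (b # p) s)"
    by (subst sum.reindex) (auto simp: inj_on_def case_prod_unfold)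
  finally show ?case using Cons.IH[of "\<lambda>p. F (b # p)"] by simp
qed simp

text \<open>The partner of the first letter is an equal letter at some split point; the parts under
  and behind the resulting arch are paired independently.\<close>

lemma fit_count_Cons:
  "fit_count (a # w) = splits (\<lambda>p c s. if c = a then fit_count p * fit_count s else 0) w"
proof -
  have "fit_count (a # w) =
      card (\<Union>x\<in>{(p, s). w = p @ a # s}. {l. fits l (fst x)} \<times> {r. fits r (snd x)})"
    unfolding fit_count_def fits_Cons_decomp
    by (subst card_image) (auto simp: inj_on_def case_prod_unfold)
  also have "\<dots> = (\<Sum>x\<in>{(p, s). w = p @ a # s}. card ({l. fits l (fst x)} \<times> {r. fits r (snd x)}))"
  proof (rule card_UN_disjoint[OF finite_splits])
    \<comment> \<open>The pairing \<open>l\<close> determines the length of the part under the arch,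
      so different split points give disjoint families.\<close>
    have "x = y" if "x \<in> {(p, s). w = p @ a # s}" "y \<in> {(p, s). w = p @ a # s}"
      "fits l (fst x)" "fits l (fst y)" for x y l
    proof -
      have "length (fst x) = length (fst y)" using that(3,4) by (simp add: fits_length)
      then show ?thesis using that(1,2) by (auto simp: append_eq_append_conv)
    qed
    then show "\<forall>x\<in>{(p, s). w = p @ a # s}. \<forall>y\<in>{(p, s). w = p @ a # s}. x \<noteq> y \<longrightarrow>
        {l. fits l (fst x)} \<times> {r. fits r (snd x)} \<inter> {l. fits l (fst y)} \<times> {r. fits r (snd y)} = {}"
      by blast
  qed simp
  also have "\<dots> = (\<Sum>(p, s)\<in>{(p, s). w = p @ a # s}. fit_count p * fit_count s)"
    by (simp add: fit_count_def card_cartesian_product case_prod_unfold)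
  finally show ?thesis unfolding sum_splits_eq .
qed

lemma fit_count_odd: "odd (count_list w x) \<Longrightarrow> fit_count w = 0"
  using fits_imp_wordt[of _ w] count_list_wordt by (fastforce simp: fit_count_def)

lemma fits_append: "fits l u \<Longrightarrow> fits r v \<Longrightarrow> \<exists>t. fits t (u @ v)"
proof (induction rule: fits.induct)
  case (fits_Nd l u r' v' a)
  then obtain t where "fits t (v' @ v)" by blast
  then show ?case using fits.fits_Nd[OF fits_Nd(1), of t _ a] by auto
qed auto

text \<open>A word in which every letter occurs at most twice determines the pairing of its letters.\<close>

definition balanced :: "'a list \<Rightarrow> bool" where
  "balanced w \<longleftrightarrow> (\<exists>t. fits t w) \<and> (\<forall>x. count_list w x \<le> 2)"

lemma balancedD: "balanced w \<Longrightarrow> fit_count w = 1"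
proof -
  assume w: "balanced w"
  then obtain t where t: "fits t w" by (auto simp: balanced_def)
  then obtain ls where ls: "length ls = size t" "w = wordt t ls" using fits_imp_wordt by blast
  have "distinct ls"
  proof (rule ccontr)
    assume "\<not> distinct ls"
    then obtain a xs ys zs where "ls = xs @ [a] @ ys @ [a] @ zs" using not_distinct_decomp by blast
    then have "count_list w a \<ge> 4" using count_list_wordt[OF ls(1), of a] ls(2) by simp
    then show False using w by (auto simp: balanced_def dest: spec[of _ a])
  qed
  then have "{t. fits t w} = {t}" using t fits_wordt_distinct[OF _ ls(1)] ls(2) by auto
  then show ?thesis by (simp add: fit_count_def)
qed

lemma distinct_count_list_le: "distinct xs \<Longrightarrow> count_list xs x \<le> 1"
  by (induction xs) auto

lemma balanced_wordt: "distinct ls \<Longrightarrow> length ls = size t \<Longrightarrow> balanced (wordt t ls)"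
  unfolding balanced_def
  using distinct_count_list_le[of ls] by (auto simp: count_list_wordt intro: fits_wordt)

lemma balanced_append:
  assumes "balanced u" "balanced v" "set u \<inter> set v = {}"
  shows "balanced (u @ v)"
proof -
  have "count_list (u @ v) x \<le> 2" for x
  proof (cases "x \<in> set u")
    case True
    then have "x \<notin> set v" using assms(3) by auto
    then show ?thesis using assms(1) by (simp add: balanced_def)
  qed (use assms(2) in \<open>simp add: balanced_def\<close>)
  then show ?thesis using assms(1,2) fits_append by (auto simp: balanced_def)
qed

lemma balanced_arch:
  assumes "balanced u" "a \<notin> set u"
  shows "balanced (a # u @ [a])"
  using assms fits_Nd[OF _ fits_Lf, of _ u a] by (auto simp: balanced_def)

lemma fit_count_arch:
  assumes "a \<notin> set p" "a \<notin> set s"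
  shows "fit_count (a # p @ a # s) = fit_count p * fit_count s"
proof -
  have "splits (\<lambda>x c y. if c = a then fit_count x * fit_count (y @ a # s) else 0) p = splits (\<lambda>x c y. 0) p"
    by (rule splits_cong) (use assms in auto)
  moreover have "splits (\<lambda>x c y. if c = a then fit_count (p @ a # x) * fit_count y else 0) s =
      splits (\<lambda>x c y. 0) s"
    by (rule splits_cong) (use assms in auto)
  ultimately show ?thesis unfolding fit_count_Cons splits_append by simp
qed

fun root_degree :: "nct \<Rightarrow> nat" where
  "root_degree Lf = 0"
| "root_degree (Nd l r) = Suc (root_degree r)"

text \<open>The number of unordered pairs of arches that border a common region. These are the pairs that can be
  exchanged for another noncrossing pairing of their four end points.\<close>

fun flips :: "nct \<Rightarrow> nat" where
  "flips Lf = 0"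
| "flips (Nd l r) = flips l + flips r + root_degree l + root_degree r"

text \<open>The prefix \<open>p\<close> can be paired only if no arch is open at the split, so
  \<open>c\<close> is the left end of a root arch. Its right end then joins the extra
  \<open>c\<close>, and the remainder pairs uniquely. Each root arch counts once.\<close>

lemma splits_inner:
  assumes "distinct ls" "length ls = size t" "balanced v" "set ls \<inter> set v = {}"
  shows "splits (\<lambda>p c s. fit_count p * fit_count (s @ c # v)) (wordt t ls) = root_degree t"
  using assms
proof (induction t arbitrary: ls)
  case (Nd l r)
  from Nd.prems(2) obtain a ls1 ls2
    where ls: "ls = a # ls1 @ ls2" "length ls1 = size l" "length ls2 = size r"
    by (rule labels_NdE)
  define p q where "p = wordt l ls1" and "q = wordt r ls2"
  have sets: "set p = set ls1" "set q = set ls2" using ls by (simp_all add: p_def q_def set_wordt)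
  have bal: "balanced p" "balanced q"
    using Nd.prems(1) ls by (simp_all add: p_def q_def balanced_wordt)
  have a: "a \<notin> set p" "a \<notin> set q" "a \<notin> set v" using Nd.prems ls sets by auto
  have "balanced (p @ (a # q @ [a]) @ v)"
    using Nd.prems ls sets bal a by (intro balanced_append balanced_arch) auto
  then have 1: "fit_count (p @ a # q @ a # v) = 1" using balancedD by simp
  have 2: "splits (\<lambda>x c s. fit_count (a # x) * fit_count ((s @ a # q) @ c # v)) p = splits (\<lambda>x c s. 0) p"
  proof (rule splits_cong)
    fix x c s assume "p = x @ c # s"
    then have "odd (count_list (a # x) a)" using a by auto
    then show "fit_count (a # x) * fit_count ((s @ a # q) @ c # v) = 0"
      using fit_count_odd[of "a # x" a] by simp
  qed
  have "odd (count_list (a # p) a)" using a by simp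
  then have 3: "fit_count (a # p) = 0" by (rule fit_count_odd)
  have "splits (\<lambda>x c s. fit_count (a # p @ a # x) * fit_count (s @ c # v)) q =
      splits (\<lambda>x c s. fit_count x * fit_count (s @ c # v)) q"
  proof (rule splits_cong)
    fix x c s assume "q = x @ c # s"
    then have "fit_count (a # p @ a # x) = fit_count x"
      using fit_count_arch[of a p x] a bal(1) by (simp add: balancedD)
    then show "fit_count (a # p @ a # x) * fit_count (s @ c # v) = fit_count x * fit_count (s @ c # v)"
      by simp
  qed
  also have "\<dots> = root_degree r"
    unfolding q_def by (rule Nd.IH(2)) (use Nd.prems ls in auto)
  finally have 4: "splits (\<lambda>x c s. fit_count (a # p @ a # x) * fit_count (s @ c # v)) q = root_degree r" .
  show ?case
    using 1 2 3 4 by (simp add: ls p_def[symmetric] q_def[symmetric] splits_append)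
qed simp

text \<open>Mirror image of \<open>splits_inner\<close>: the suffix \<open>s\<close> can be paired
  only if \<open>c\<close> is the right end of a root arch. The word \<open>z\<close> collects the
  root arches already passed, as the induction runs along them from left to right.\<close>

lemma splits_outer:
  assumes "distinct ls" "length ls = size t" "balanced u" "balanced z"
    "set ls \<inter> set u = {}" "set ls \<inter> set z = {}" "set u \<inter> set z = {}"
  shows "splits (\<lambda>p c s. fit_count (u @ c # z @ p) * fit_count s) (wordt t ls) = root_degree t"
  using assms
proof (induction t arbitrary: ls z)
  case (Nd l r)
  from Nd.prems(2) obtain a ls1 ls2
    where ls: "ls = a # ls1 @ ls2" "length ls1 = size l" "length ls2 = size r"
    by (rule labels_NdE)
  define p q where "p = wordt l ls1" and "q = wordt r ls2"
  have sets: "set p = set ls1" "set q = set ls2" using ls by (simp_all add: p_def q_def set_wordt)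
  have bal: "balanced p" "balanced q"
    using Nd.prems(1) ls by (simp_all add: p_def q_def balanced_wordt)
  have a: "a \<notin> set p" "a \<notin> set q" "a \<notin> set u" "a \<notin> set z" using Nd.prems ls sets by auto
  have "odd (count_list (u @ a # z) a)" using a by simp
  then have 1: "fit_count (u @ a # z) = 0" by (rule fit_count_odd)
  have 2: "splits (\<lambda>x c s. fit_count (u @ c # z @ a # x) * fit_count (s @ a # q)) p =
      splits (\<lambda>x c s. 0) p"
  proof (rule splits_cong)
    fix x c s assume "p = x @ c # s"
    then have "odd (count_list (u @ c # z @ a # x) a)" using a by auto
    then show "fit_count (u @ c # z @ a # x) * fit_count (s @ a # q) = 0"
      using fit_count_odd[of "u @ c # z @ a # x"] by auto
  qed
  have "balanced (u @ (a # z @ [a]) @ p)"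
    using Nd.prems ls sets bal a by (intro balanced_append balanced_arch) auto
  then have 3: "fit_count (u @ a # z @ a # p) = 1" using balancedD by simp
  have 4: "fit_count q = 1" using bal by (simp add: balancedD)
  have "splits (\<lambda>x c s. fit_count (u @ c # (z @ a # p @ [a]) @ x) * fit_count s) q = root_degree r"
    unfolding q_def
  proof (rule Nd.IH(2))
    show "balanced (z @ a # p @ [a])"
      using Nd.prems ls sets bal a by (intro balanced_append balanced_arch) auto
  qed (use Nd.prems ls sets a in auto)
  then have 5: "splits (\<lambda>x c s. fit_count (u @ c # z @ a # p @ a # x) * fit_count s) q = root_degree r"
    by simp
  show ?case
    using 1 2 3 4 5 by (simp add: ls p_def[symmetric] q_def[symmetric] splits_append)
qed simp

subsection \<open>Asymptotics of the row sums of the Gram matrix\<close>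

text \<open>Either the tail already repeats a letter or the head is one of its \<open>k\<close>
  letters; the constant survives the induction because k^2 + k is at most (k + 1)^2.\<close>

lemma card_nondistinct_words:
  assumes "finite A"
  shows "card {w \<in> words A k. \<not> distinct w} * card A \<le> k\<^sup>2 * card A ^ k"
proof (induction k)
  case (Suc k)
  let ?N = "\<lambda>k. {w \<in> words A k. \<not> distinct w}"
  have "?N (Suc k) \<subseteq> (\<lambda>(a, w). a # w) ` (A \<times> ?N k) \<union>
      (\<lambda>(i, w). w ! i # w) ` ({..<k} \<times> words A k)"
  proof
    fix x assume x: "x \<in> ?N (Suc k)"
    then obtain a w where w: "x = a # w" "a \<in> A" "w \<in> words A k" by (auto simp: words_Suc)
    show "x \<in> (\<lambda>(a, w). a # w) ` (A \<times> ?N k) \<union> (\<lambda>(i, w). w ! i # w) ` ({..<k} \<times> words A k)"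
    proof (cases "distinct w")
      case True
      with x w obtain i where "i < length w" "w ! i = a" by (auto simp: in_set_conv_nth)
      then have "(i, w) \<in> {..<k} \<times> words A k" using w by (auto simp: words_def)
      then have "w ! i # w \<in> (\<lambda>(i, w). w ! i # w) ` ({..<k} \<times> words A k)"
        by (rule rev_image_eqI) simp
      then show ?thesis using w(1) \<open>w ! i = a\<close> by simp
    next
      case False
      with w have "(a, w) \<in> A \<times> ?N k" by simp
      then have "a # w \<in> (\<lambda>(a, w). a # w) ` (A \<times> ?N k)" by (rule rev_image_eqI) simp
      then show ?thesis using w(1) by simp
    qed
  qed
  then have "card (?N (Suc k)) \<le> card ((\<lambda>(a, w). a # w) ` (A \<times> ?N k) \<union>
      (\<lambda>(i, w). w ! i # w) ` ({..<k} \<times> words A k))"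
    using assms by (intro card_mono) auto
  also have "\<dots> \<le> card ((\<lambda>(a, w). a # w) ` (A \<times> ?N k)) +
      card ((\<lambda>(i, w). w ! i # w) ` ({..<k} \<times> words A k))"
    by (rule card_Un_le)
  also have "\<dots> \<le> card (A \<times> ?N k) + card ({..<k} \<times> words A k)"
    using assms by (intro add_mono card_image_le) auto
  also have "\<dots> = card A * card (?N k) + k * card A ^ k"
    using assms by (simp add: card_cartesian_product card_words)
  finally have "card (?N (Suc k)) * card A \<le> (card A * card (?N k) + k * card A ^ k) * card A"
    by (rule mult_right_mono) simp
  also have "\<dots> = card A * (card (?N k) * card A) + k * card A ^ Suc k"
    by (simp add: algebra_simps)
  also have "\<dots> \<le> card A * (k\<^sup>2 * card A ^ k) + k * card A ^ Suc k"
    by (intro add_right_mono mult_left_mono Suc.IH) simp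
  also have "\<dots> \<le> (Suc k)\<^sup>2 * card A ^ Suc k"
    by (simp add: power2_eq_square algebra_simps)
  finally show ?case .
qed simp

text \<open>Words with a repeated label form a fraction of order 1 / n, so the generic value
  \<open>c\<close> gives the limit and \<open>B\<close> controls the error.\<close>

lemma sum_words_asymp:
  fixes f :: "nat list \<Rightarrow> nat"
  assumes distinct: "\<And>ls. distinct ls \<Longrightarrow> length ls = k \<Longrightarrow> f ls = c"
    and bound: "\<And>ls. length ls = k \<Longrightarrow> f ls \<le> B"
  shows "(\<lambda>n. real (\<Sum>ls\<in>words {1..n} k. f ls) / real n ^ k - real c) \<in> O(\<lambda>n. 1 / real n)"
proof (rule bigoI[where c = "(real B + real c) * real (k\<^sup>2)"], rule eventually_mono[OF eventually_gt_at_top[of 0]])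
  fix n :: nat assume n: "n > 0"
  let ?W = "words {1..n} k"
  let ?N = "{w \<in> ?W. \<not> distinct w}"
  have "real (\<Sum>ls\<in>?W. f ls) - real c * real n ^ k = (\<Sum>ls\<in>?W. real (f ls) - real c)"
    by (simp add: sum_subtractf card_words)
  also have "\<dots> = (\<Sum>ls\<in>?N. real (f ls) - real c)"
    by (rule sum.mono_neutral_right) (use finite_words[of "{1..n}" k] in \<open>auto simp: distinct words_def\<close>)
  finally have "\<bar>real (\<Sum>ls\<in>?W. f ls) - real c * real n ^ k\<bar> \<le> (\<Sum>ls\<in>?N. \<bar>real (f ls) - real c\<bar>)"
    using sum_abs by metis
  also have "\<dots> \<le> (\<Sum>ls\<in>?N. real B + real c)"
  proof (rule sum_mono)
    fix ls assume "ls \<in> ?N"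
    then have "f ls \<le> B" by (auto intro: bound simp: words_def)
    then show "\<bar>real (f ls) - real c\<bar> \<le> real B + real c" by simp
  qed
  also have "\<dots> = (real B + real c) * real (card ?N)" by simp
  finally have 1: "\<bar>real (\<Sum>ls\<in>?W. f ls) - real c * real n ^ k\<bar> \<le> (real B + real c) * real (card ?N)" .
  have "real (card ?N * n) \<le> real (k\<^sup>2 * n ^ k)"
    using card_nondistinct_words[of "{1..n}" k] by (simp only: of_nat_le_iff) simp
  then have 2: "real (card ?N) \<le> real (k\<^sup>2) * real n ^ k / real n"
    using n by (simp add: field_simps)
  have "\<bar>real (\<Sum>ls\<in>?W. f ls) - real c * real n ^ k\<bar> \<le>
      (real B + real c) * (real (k\<^sup>2) * real n ^ k / real n)"
    using 1 mult_left_mono[OF 2, of "real B + real c"] by linarith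
  moreover have "real (\<Sum>ls\<in>?W. f ls) / real n ^ k - real c =
      (real (\<Sum>ls\<in>?W. f ls) - real c * real n ^ k) / real n ^ k"
    using n by (simp add: field_simps)
  ultimately show "norm (real (\<Sum>ls\<in>?W. f ls) / real n ^ k - real c) \<le>
      (real B + real c) * real (k\<^sup>2) * norm (1 / real n)"
    using n by (simp add: abs_div field_simps del: of_nat_sum)
qed

text \<open>A row sum of the Gram matrix by \<open>sum_gram\<close>. Counting all pairings of the
  words that fit \<open>t\<close> gives a recursion along \<open>t\<close> and avoids counting the
  loops formed by two pairings.\<close>

definition row_sum :: "nat \<Rightarrow> nct \<Rightarrow> nat" where
  "row_sum n t = (\<Sum>ls\<in>words {1..n} (size t). fit_count (wordt t ls))"

text \<open>Counts the pairings in which the left end of an arch over \<open>u\<close>, followed by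
  \<open>v\<close>, leaves its partner, the label of this arch being summed out. The two terms are
  for a new partner inside \<open>u\<close> and inside \<open>v\<close>.\<close>

definition cross_count :: "'a list \<Rightarrow> 'a list \<Rightarrow> nat" where
  "cross_count u v = splits (\<lambda>p c s. fit_count p * fit_count (s @ c # v)) u +
     splits (\<lambda>p c s. fit_count (u @ c # p) * fit_count s) v"

lemma sum_fit_count_arch:
  assumes "finite A" "set u \<subseteq> A" "set v \<subseteq> A"
  shows "(\<Sum>a\<in>A. fit_count (a # u @ a # v)) = card A * (fit_count u * fit_count v) + cross_count u v"
proof -
  have "(\<Sum>a\<in>A. fit_count (a # u @ a # v)) =
      (\<Sum>a\<in>A. splits (\<lambda>p c s. if c = a then fit_count p * fit_count (s @ a # v) else 0) u +
        (fit_count u * fit_count v +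
          splits (\<lambda>p c s. if c = a then fit_count (u @ a # p) * fit_count s else 0) v))"
    unfolding fit_count_Cons splits_append by simp
  also have "\<dots> = splits (\<lambda>p c s. fit_count p * fit_count (s @ c # v)) u +
        (card A * (fit_count u * fit_count v) +
          splits (\<lambda>p c s. fit_count (u @ c # p) * fit_count s) v)"
    unfolding sum.distrib
    using sum_splits_letter[OF assms(1,2), of "\<lambda>a p s. fit_count p * fit_count (s @ a # v)"]
      sum_splits_letter[OF assms(1,3), of "\<lambda>a p s. fit_count (u @ a # p) * fit_count s"]
    by simp
  finally show ?thesis by (simp add: cross_count_def)
qed

lemma row_sum_Nd:
  "row_sum n (Nd l r) = n * row_sum n l * row_sum n r +
    (\<Sum>ls\<in>words {1..n} (size l + size r).
      cross_count (wordt l (take (size l) ls)) (wordt r (drop (size l) ls)))"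
proof -
  let ?W = "words {1..n}"
  have "row_sum n (Nd l r) =
      (\<Sum>a\<in>{1..n}. \<Sum>x\<in>?W (size l). \<Sum>y\<in>?W (size r). fit_count (a # wordt l x @ a # wordt r y))"
    unfolding row_sum_def sum_labels_Nd by (intro sum.cong) (simp_all add: words_def)
  also have "\<dots> = (\<Sum>x\<in>?W (size l). \<Sum>y\<in>?W (size r). \<Sum>a\<in>{1..n}. fit_count (a # wordt l x @ a # wordt r y))"
    by (subst sum.swap, rule sum.cong[OF HOL.refl], rule sum.swap)
  also have "\<dots> = (\<Sum>x\<in>?W (size l). \<Sum>y\<in>?W (size r).
      n * (fit_count (wordt l x) * fit_count (wordt r y)) + cross_count (wordt l x) (wordt r y))"
  proof (intro sum.cong HOL.refl)
    fix x y assume "x \<in> ?W (size l)" "y \<in> ?W (size r)"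
    then show "(\<Sum>a\<in>{1..n}. fit_count (a # wordt l x @ a # wordt r y)) =
        n * (fit_count (wordt l x) * fit_count (wordt r y)) + cross_count (wordt l x) (wordt r y)"
      using sum_fit_count_arch[of "{1..n}" "wordt l x" "wordt r y"] by (simp add: words_def set_wordt)
  qed
  also have "\<dots> = n * row_sum n l * row_sum n r +
      (\<Sum>x\<in>?W (size l). \<Sum>y\<in>?W (size r). cross_count (wordt l x) (wordt r y))"
    unfolding row_sum_def sum.distrib mult.assoc sum_product by (simp add: sum_distrib_left)
  also have "(\<Sum>x\<in>?W (size l). \<Sum>y\<in>?W (size r). cross_count (wordt l x) (wordt r y)) =
      (\<Sum>ls\<in>?W (size l + size r). cross_count (wordt l (take (size l) ls)) (wordt r (drop (size l) ls)))"
    unfolding sum_words_add by (intro sum.cong) (simp_all add: words_def)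
  finally show ?thesis .
qed

lemma fit_count_bound: "\<exists>B. \<forall>w::'a list. length w \<le> k \<longrightarrow> fit_count w \<le> B"
proof -
  have "fit_count w \<le> (\<Sum>i\<le>k. card (ncts i))" if "length w \<le> k" for w :: "'a list"
  proof -
    have "card (ncts (length w div 2)) \<le> (\<Sum>i\<le>k. card (ncts i))"
      by (rule member_le_sum) (use that in auto)
    then show ?thesis using fit_count_le[of w] by linarith
  qed
  then show ?thesis by blast
qed

lemma cross_count_bound: "\<exists>B. \<forall>u v::'a list. length u + length v < k \<longrightarrow> cross_count u v \<le> B"
proof -
  obtain B where B: "\<And>w::'a list. length w \<le> k \<Longrightarrow> fit_count w \<le> B"
    using fit_count_bound by metis
  have "cross_count u v \<le> 2 * (k * (B * B))" if "length u + length v < k" for u v :: "'a list"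
  proof -
    have "splits (\<lambda>p c s. fit_count p * fit_count (s @ c # v)) u \<le> length u * (B * B)"
      by (rule splits_le) (use that in \<open>auto intro!: mult_mono B\<close>)
    moreover have "splits (\<lambda>p c s. fit_count (u @ c # p) * fit_count s) v \<le> length v * (B * B)"
      by (rule splits_le) (use that in \<open>auto intro!: mult_mono B\<close>)
    moreover have "length u * (B * B) \<le> k * (B * B)" "length v * (B * B) \<le> k * (B * B)"
      using that by (auto intro: mult_right_mono)
    ultimately show ?thesis unfolding cross_count_def by linarith
  qed
  then show ?thesis by blast
qed

text \<open>By \<open>row_sum_Nd\<close> the normalized row sum of \<open>Nd l r\<close> is the
  product of those of \<open>l\<close> and \<open>r\<close> plus 1 / n times an average of
  \<open>cross_count\<close>. Generic labels turn this average into
  \<open>root_degree l + root_degree r\<close>, the number of arches that can be exchanged with the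
  outer one; this is the recursion of \<open>flips\<close>.\<close>

lemma row_sum_asymp:
  "(\<lambda>n. real (row_sum n t) / real n ^ size t - 1 - real (flips t) / real n) \<in> O(\<lambda>n. 1 / real n ^ 2)"
proof (induction t)
  case Lf
  show ?case by (simp add: row_sum_def)
next
  case (Nd l r)
  define \<gamma> where "\<gamma> = (\<lambda>t n. real (row_sum n t) / real n ^ size t)"
  have first: "(\<lambda>n. \<gamma> t n - 1) \<in> O(\<lambda>n. 1 / real n)" for t
  proof -
    obtain B where B: "\<And>w::nat list. length w \<le> 2 * size t \<Longrightarrow> fit_count w \<le> B"
      using fit_count_bound by metis
    have "(\<lambda>n. real (\<Sum>ls\<in>words {1..n} (size t). fit_count (wordt t ls)) / real n ^ size t - real 1)
        \<in> O(\<lambda>n. 1 / real n)"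
      by (rule sum_words_asymp[where B = B])
        (auto simp: length_wordt balancedD[OF balanced_wordt] intro: B)
    then show ?thesis by (simp add: \<gamma>_def row_sum_def)
  qed
  define f where "f = (\<lambda>ls :: nat list. cross_count (wordt l (take (size l) ls)) (wordt r (drop (size l) ls)))"
  define k where "k = size l + size r"
  define \<phi> where "\<phi> = (\<lambda>n. real (\<Sum>ls\<in>words {1..n} k. f ls) / real n ^ k)"
  have \<phi>: "(\<lambda>n. \<phi> n - real (root_degree l + root_degree r)) \<in> O(\<lambda>n. 1 / real n)"
  proof -
    obtain B where B: "\<And>u v::nat list. length u + length v < Suc (2 * k) \<Longrightarrow> cross_count u v \<le> B"
      using cross_count_bound by metis
    show ?thesis unfolding \<phi>_def
    proof (rule sum_words_asymp[where B = B])
      fix ls :: "nat list" assume ls: "distinct ls" "length ls = k"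
      define x y where "x = take (size l) ls" and "y = drop (size l) ls"
      have xy: "distinct x" "distinct y" "length x = size l" "length y = size r" "set x \<inter> set y = {}"
        using ls by (auto simp: x_def y_def k_def set_take_disj_set_drop_if_distinct)
      have "splits (\<lambda>p c s. fit_count p * fit_count (s @ c # wordt r y)) (wordt l x) = root_degree l"
        by (rule splits_inner) (use xy in \<open>auto simp: set_wordt intro: balanced_wordt\<close>)
      moreover have "splits (\<lambda>p c s. fit_count (wordt l x @ c # [] @ p) * fit_count s) (wordt r y) = root_degree r"
        by (rule splits_outer) (use xy balanced_wordt[of "[]" Lf] in \<open>auto simp: set_wordt intro: balanced_wordt\<close>)
      ultimately show "f ls = root_degree l + root_degree r"
        by (simp add: f_def cross_count_def x_def[symmetric] y_def[symmetric])
    next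
      fix ls :: "nat list" assume "length ls = k"
      then show "f ls \<le> B" unfolding f_def by (intro B) (simp add: length_wordt k_def)
    qed
  qed
  \<comment> \<open>The product \<open>(\<gamma> l n - 1) * (\<gamma> r n - 1)\<close> is of second
    order; the other terms are the two induction hypotheses and 1 / n times the first-order error of
    \<open>\<phi>\<close>.\<close>
  have eq: "eventually (\<lambda>n. \<gamma> (Nd l r) n - 1 - real (flips (Nd l r)) / real n =
      ((\<gamma> l n - 1) * (\<gamma> r n - 1)) + ((\<gamma> l n - 1 - real (flips l) / real n)
      + (\<gamma> r n - 1 - real (flips r) / real n)
      + (1 / real n) * (\<phi> n - real (root_degree l + root_degree r)))) sequentially"
  proof (rule eventually_mono[OF eventually_gt_at_top[of 0]])
    fix n :: nat assume n: "n > 0"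
    have "\<gamma> (Nd l r) n = \<gamma> l n * \<gamma> r n + (1 / real n) * \<phi> n"
      using n unfolding \<gamma>_def \<phi>_def row_sum_Nd f_def[symmetric] k_def
      by (simp add: field_simps power_add del: of_nat_sum)
    then show "\<gamma> (Nd l r) n - 1 - real (flips (Nd l r)) / real n =
      ((\<gamma> l n - 1) * (\<gamma> r n - 1)) + ((\<gamma> l n - 1 - real (flips l) / real n)
      + (\<gamma> r n - 1 - real (flips r) / real n)
      + (1 / real n) * (\<phi> n - real (root_degree l + root_degree r)))"
      using n by (simp add: field_simps)
  qed
  have "(\<lambda>n. (\<gamma> l n - 1) * (\<gamma> r n - 1)) \<in> O(\<lambda>n. 1 / real n ^ 2)"
    using landau_o.big.mult[OF first[of l] first[of r]] by (simp add: power2_eq_square)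
  moreover have "(\<lambda>n. (1 / real n) * (\<phi> n - real (root_degree l + root_degree r))) \<in> O(\<lambda>n. 1 / real n ^ 2)"
    using landau_o.big.mult[OF landau_o.big_refl \<phi>, of "\<lambda>n. 1 / real n"] by (simp add: power2_eq_square)
  ultimately have "(\<lambda>n. ((\<gamma> l n - 1) * (\<gamma> r n - 1)) + ((\<gamma> l n - 1 - real (flips l) / real n)
      + (\<gamma> r n - 1 - real (flips r) / real n)
      + (1 / real n) * (\<phi> n - real (root_degree l + root_degree r)))) \<in> O(\<lambda>n. 1 / real n ^ 2)"
    using Nd.IH unfolding \<gamma>_def by (intro sum_in_bigo(1))
  then show ?case
    using landau_o.big.in_cong[OF eq] by (simp add: \<gamma>_def)
qed

subsection \<open>The Gram system\<close>

definition gram :: "nat \<Rightarrow> nct \<Rightarrow> nct \<Rightarrow> nat" where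
  "gram n q t = card {w \<in> words {1..n} (2 * size t). fits q w \<and> fits t w}"

lemma gram_sym: "size q = size t \<Longrightarrow> gram n q t = gram n t q"
  by (simp add: gram_def conj_commute)

lemma gram_eq_sum: "gram n q t = (\<Sum>ls\<in>words {1..n} (size t). of_bool (fits q (wordt t ls)))"
proof -
  have "gram n q t = (\<Sum>w | w \<in> words {1..n} (2 * size t) \<and> fits t w. of_bool (fits q w))"
    unfolding gram_def by (simp add: Int_def conj_ac)
  then show ?thesis by (simp add: sum_fitting_words)
qed

lemma gram_diag: "gram n t t = n ^ size t"
proof -
  have "gram n t t = (\<Sum>ls\<in>words {1..n} (size t). 1)"
    unfolding gram_eq_sum by (rule sum.cong) (auto simp: words_def fits_wordt)
  then show ?thesis by (simp add: card_words)
qed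

lemma sum_gram: "(\<Sum>q\<in>ncts (size t). gram n q t) = row_sum n t"
proof -
  have "fit_count w = (\<Sum>q\<in>ncts (size t). of_bool (fits q w))" if "length w = 2 * size t" for w :: "nat list"
  proof -
    have "{q. fits q w} = ncts (size t) \<inter> {q. fits q w}"
      using that fits_length by (fastforce simp: ncts_def)
    then show ?thesis by (simp add: fit_count_def)
  qed
  then have "row_sum n t = (\<Sum>ls\<in>words {1..n} (size t). \<Sum>q\<in>ncts (size t). of_bool (fits q (wordt t ls)))"
    unfolding row_sum_def by (intro sum.cong) (auto simp: words_def length_wordt)
  then show ?thesis unfolding gram_eq_sum by (subst sum.swap) simp
qed

context column_moments
begin

lemma gram_system:
  assumes "2 * size t \<le> n"
  shows "(\<Sum>q\<in>ncts (size t). coeff_nct q * of_nat (gram n q t)) = 1"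
proof -
  have "1 = (\<Sum>ls\<in>words {1..n} (size t). \<xi> (wordt t ls))"
    using sum_moments_wordt[of "[]" "[]" t] by (simp add: moment_Nil)
  also have "\<dots> = (\<Sum>ls\<in>words {1..n} (size t). \<Sum>q\<in>ncts (size t). coeff_nct q * of_bool (fits q (wordt t ls)))"
    by (intro sum.cong moment_expansion) (use assms in \<open>auto simp: words_def length_wordt set_wordt\<close>)
  also have "\<dots> = (\<Sum>q\<in>ncts (size t). coeff_nct q * of_nat (gram n q t))"
    unfolding gram_eq_sum of_nat_sum sum_distrib_left by (subst sum.swap) simp
  finally show ?thesis by simp
qed

text \<open>A constant word fits every pairing, so every coefficient enters with weight 1.\<close>

lemma constant_word_moment:
  assumes "2 * m \<le> n" "n \<ge> 1"
  shows "\<xi> (replicate (2 * m) 1) = (\<Sum>t\<in>ncts m. coeff_nct t)"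
proof -
  have "fits t (replicate (2 * size t) 1)" for t
  proof -
    have "set (wordt t (replicate (size t) 1)) \<subseteq> {1}" by (simp add: set_wordt set_replicate_conv_if)
    then have "wordt t (replicate (size t) 1) = replicate (2 * size t) 1"
      by (intro replicate_eqI) (auto simp: length_wordt)
    then show ?thesis using fits_wordt[of "replicate (size t) 1" t] by (metis length_replicate)
  qed
  then have "fits t (replicate (2 * m) 1)" if "t \<in> ncts m" for t
    using that unfolding ncts_def by blast
  then have "(\<Sum>t\<in>ncts m. coeff_nct t * of_bool (fits t (replicate (2 * m) 1))) = (\<Sum>t\<in>ncts m. coeff_nct t)"
    by (intro sum.cong) auto
  moreover have "replicate (2 * m) 1 \<in> words {1..n} (2 * m)"
    using assms(2) by (auto simp: words_def)
  ultimately show ?thesis using moment_expansion[OF assms(1)] by metis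
qed

lemma odd_moment: "odd k \<Longrightarrow> n \<ge> 1 \<Longrightarrow> \<xi> (replicate k 1) = 0"
proof (rule vanishing)
  assume "odd k"
  show "reduced_form (replicate k (1::nat)) \<noteq> []"
  proof
    assume "reduced_form (replicate k (1::nat)) = []"
    then obtain t where "fits t (replicate k (1::nat))" using reduced_form_Nil_imp_fits by blast
    then show False using fits_length \<open>odd k\<close> by fastforce
  qed
qed (simp add: set_replicate_conv_if)

end

section \<open>Perturbation of the Gram system\<close>

lemma bigo_of_real:
  "f \<in> O(g) \<Longrightarrow> (\<lambda>n. complex_of_real (f n)) \<in> O(\<lambda>n. complex_of_real (g n))"
  by (auto simp: bigo_def)

text \<open>Diagonal dominance: if \<open>Y\<close> is the largest modulus of the solution, each
  equation bounds the distance of \<open>y t\<close> from 1 by \<open>Y * \<delta>\<close>, and at a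
  maximal entry this forces \<open>Y \<le> 2\<close>.\<close>

lemma solution_near_one:
  fixes y :: "'a \<Rightarrow> complex" and g :: "'a \<Rightarrow> 'a \<Rightarrow> real"
  assumes fin: "finite T" and diag: "\<And>t. t \<in> T \<Longrightarrow> g t t = 1"
    and nonneg: "\<And>q t. g q t \<ge> 0"
    and rows: "\<And>t. t \<in> T \<Longrightarrow> (\<Sum>q\<in>T. g q t) - 1 \<le> \<delta>" and \<delta>: "\<delta> \<le> 1 / 2"
    and system: "\<And>t. t \<in> T \<Longrightarrow> (\<Sum>q\<in>T. y q * complex_of_real (g q t)) = 1"
    and t: "t \<in> T"
  shows "norm (y t - 1) \<le> 2 * \<delta>"
proof -
  define Y where "Y = Max ((\<lambda>t. norm (y t)) ` T)"
  have Y: "norm (y q) \<le> Y" if "q \<in> T" for q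
    using that fin by (auto simp: Y_def)
  have "Y \<ge> 0" using Y[OF t] norm_ge_zero order_trans by blast
  have near: "norm (y t - 1) \<le> Y * \<delta>" if t: "t \<in> T" for t
  proof -
    have "y t - 1 = - (\<Sum>q\<in>T - {t}. y q * complex_of_real (g q t))"
      using sum.remove[OF fin t, of "\<lambda>q. y q * complex_of_real (g q t)"] system[OF t] diag[OF t]
      by (simp add: algebra_simps)
    then have "norm (y t - 1) \<le> (\<Sum>q\<in>T - {t}. norm (y q) * g q t)"
      using norm_sum[of "\<lambda>q. y q * complex_of_real (g q t)" "T - {t}"] nonneg by (simp add: norm_mult)
    also have "\<dots> \<le> (\<Sum>q\<in>T - {t}. Y * g q t)"
      by (intro sum_mono mult_right_mono Y nonneg) auto
    also have "\<dots> = Y * ((\<Sum>q\<in>T. g q t) - 1)"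
      using sum.remove[OF fin t, of "\<lambda>q. g q t"] diag[OF t] by (simp add: sum_distrib_left)
    also have "\<dots> \<le> Y * \<delta>" by (intro mult_left_mono rows t \<open>Y \<ge> 0\<close>)
    finally show ?thesis .
  qed
  have "Y \<in> (\<lambda>t. norm (y t)) ` T" unfolding Y_def by (rule Max_in) (use fin t in auto)
  then obtain t' where t': "t' \<in> T" "norm (y t') = Y" by blast
  have "Y \<le> 1 + Y * \<delta>" using near[OF t'(1)] t'(2) norm_triangle_sub[of "y t'" 1] by simp
  moreover have "Y * \<delta> \<le> Y * (1 / 2)" by (intro mult_left_mono \<delta> \<open>Y \<ge> 0\<close>)
  ultimately have "Y \<le> 2" by simp
  moreover have "\<delta> \<ge> 0"
    using rows[OF t] sum.remove[OF fin t, of "\<lambda>q. g q t"] diag[OF t] sum_nonneg[of "T - {t}" "\<lambda>q. g q t"] nonneg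
    by auto
  ultimately show ?thesis using near[OF t] mult_right_mono[of Y 2 \<delta>] by linarith
qed

theorem even_moment_asymp:
  assumes moments: "\<And>n. n \<ge> 1 \<Longrightarrow> column_moments n (\<xi> n)"
  shows "(\<lambda>n. of_nat n ^ m * \<xi> n (replicate (2 * m) 1) -
      (of_nat (card (ncts m)) - (\<Sum>t\<in>ncts m. of_nat (flips t)) / of_nat n)) \<in> O(\<lambda>n. 1 / of_nat n ^ 2)"
proof -
  \<comment> \<open>The scaling makes the diagonal of the Gram matrix 1 and lets the solution tend
    to 1.\<close>
  define y where "y = (\<lambda>n t. of_nat n ^ m * column_moments.coeff_nct (\<xi> n) t)"
  define \<gamma> where "\<gamma> = (\<lambda>t n. real (row_sum n t) / real n ^ m)"
  define T where "T = ncts m"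
  have fin: "finite T" by (simp add: T_def)
  have size: "size t = m" if "t \<in> T" for t using that by (simp add: T_def ncts_def)
  have second: "(\<lambda>n. \<gamma> t n - 1 - real (flips t) / real n) \<in> O(\<lambda>n. 1 / real n ^ 2)" if "t \<in> T" for t
    using row_sum_asymp[of t] size[OF that] by (simp add: \<gamma>_def)
  have first: "(\<lambda>n. \<gamma> t n - 1) \<in> O(\<lambda>n. 1 / real n)" if "t \<in> T" for t
  proof -
    have "(\<lambda>n. 1 / real n ^ 2) \<in> O(\<lambda>n. 1 / real n)"
      by (rule bigoI[where c = 1], rule eventually_mono[OF eventually_gt_at_top[of 0]])
        (simp add: power2_eq_square field_simps)
    then have "(\<lambda>n. \<gamma> t n - 1 - real (flips t) / real n) \<in> O(\<lambda>n. 1 / real n)"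
      using second[OF that] landau_o.big.trans by blast
    moreover have "(\<lambda>n. real (flips t) / real n) \<in> O(\<lambda>n. 1 / real n)"
      by (rule bigoI[where c = "real (flips t)"]) simp
    ultimately have "(\<lambda>n. (\<gamma> t n - 1 - real (flips t) / real n) + real (flips t) / real n) \<in> O(\<lambda>n. 1 / real n)"
      by (rule sum_in_bigo(1))
    then show ?thesis by simp
  qed
  have "\<exists>c>0. eventually (\<lambda>n. \<bar>\<gamma> t n - 1\<bar> \<le> c / real n) sequentially" if "t \<in> T" for t
    using first[OF that] by (auto elim!: landau_o.bigE)
  then obtain c where c: "\<And>t. t \<in> T \<Longrightarrow> c t > 0"
    "\<And>t. t \<in> T \<Longrightarrow> eventually (\<lambda>n. \<bar>\<gamma> t n - 1\<bar> \<le> c t / real n) sequentially"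
    by metis
  define K where "K = (\<Sum>t\<in>T. c t)"
  have K: "eventually (\<lambda>n. \<forall>t\<in>T. \<bar>\<gamma> t n - 1\<bar> \<le> K / real n) sequentially"
  proof -
    have "eventually (\<lambda>n. \<forall>t\<in>T. \<bar>\<gamma> t n - 1\<bar> \<le> c t / real n) sequentially"
      using fin c(2) by (intro eventually_ball_finite) auto
    then show ?thesis
    proof (rule eventually_mono)
      fix n :: nat assume *: "\<forall>t\<in>T. \<bar>\<gamma> t n - 1\<bar> \<le> c t / real n"
      have "c t / real n \<le> K / real n" if "t \<in> T" for t
        unfolding K_def using that fin c(1) by (intro divide_right_mono member_le_sum) (auto intro: less_imp_le)
      then show "\<forall>t\<in>T. \<bar>\<gamma> t n - 1\<bar> \<le> K / real n" using * by force
    qed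
  qed
  have row: "(\<Sum>q\<in>T. real (gram n q t) / real n ^ m) = \<gamma> t n" if "t \<in> T" for t n
  proof -
    have "(\<Sum>q\<in>T. real (gram n q t)) = real (row_sum n t)"
      using sum_gram[of n t] size[OF that] unfolding T_def by (metis of_nat_sum)
    then show ?thesis by (simp add: \<gamma>_def sum_divide_distrib[symmetric])
  qed
  have system: "(\<Sum>q\<in>T. y n q * complex_of_real (real (gram n q t) / real n ^ m)) = 1"
    if "t \<in> T" "n \<ge> 1" "n \<ge> 2 * m" for t n
  proof -
    have "(\<Sum>q\<in>T. y n q * complex_of_real (real (gram n q t) / real n ^ m)) =
        (\<Sum>q\<in>ncts (size t). column_moments.coeff_nct (\<xi> n) q * of_nat (gram n q t))"
      using that(2) size[OF that(1)] by (intro sum.cong) (simp_all add: y_def T_def)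
    then show ?thesis
      using column_moments.gram_system[OF moments, of n t] that size[OF that(1)] by simp
  qed
  \<comment> \<open>All equations are added. By symmetry of the Gram matrix each unknown is then
    weighted by its own row sum.\<close>
  have total: "(\<Sum>q\<in>T. y n q * complex_of_real (\<gamma> q n)) = of_nat (card T)" if "n \<ge> 1" "n \<ge> 2 * m" for n
  proof -
    have "(\<Sum>q\<in>T. y n q * complex_of_real (\<gamma> q n)) =
        (\<Sum>q\<in>T. \<Sum>t\<in>T. y n q * complex_of_real (real (gram n q t) / real n ^ m))"
    proof (rule sum.cong)
      fix q assume q: "q \<in> T"
      have "\<gamma> q n = (\<Sum>t\<in>T. real (gram n q t) / real n ^ m)"
        unfolding row[OF q, symmetric] by (intro sum.cong) (use gram_sym size q in auto)
      then show "y n q * complex_of_real (\<gamma> q n) =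
          (\<Sum>t\<in>T. y n q * complex_of_real (real (gram n q t) / real n ^ m))"
        by (simp add: sum_distrib_left)
    qed simp
    also have "\<dots> = (\<Sum>t\<in>T. 1)"
      by (subst sum.swap, intro sum.cong system that) auto
    finally show ?thesis by simp
  qed
  have y1: "(\<lambda>n. y n t - 1) \<in> O(\<lambda>n. 1 / of_nat n)" if "t \<in> T" for t
  proof (rule bigoI[where c = "2 * K"])
    have "eventually (\<lambda>n. n \<ge> 1 \<and> n \<ge> 2 * m \<and> real n \<ge> 2 * K) sequentially"
      using eventually_ge_at_top[of 1] eventually_ge_at_top[of "2 * m"] eventually_ge_at_top[of "nat \<lceil>2 * K\<rceil>"]
      by eventually_elim linarith
    with K show "eventually (\<lambda>n. norm (y n t - 1) \<le> 2 * K * norm (1 / of_nat n :: complex)) sequentially"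
    proof eventually_elim
      case (elim n)
      have "norm (y n t - 1) \<le> 2 * (K / real n)"
      proof (rule solution_near_one[OF fin, where g = "\<lambda>q t. real (gram n q t) / real n ^ m"])
        show "real (gram n t t) / real n ^ m = 1" if "t \<in> T" for t
          using elim size[OF that] by (simp add: gram_diag)
        show "(\<Sum>q\<in>T. real (gram n q t) / real n ^ m) - 1 \<le> K / real n" if "t \<in> T" for t
          using elim that row[OF that] by auto
        show "K / real n \<le> 1 / 2" using elim by (simp add: field_simps)
        show "(\<Sum>q\<in>T. y n q * complex_of_real (real (gram n q t) / real n ^ m)) = 1" if "t \<in> T" for t
          using system[OF that] elim by simp
      qed (use that in auto)
      then show ?case by (simp add: norm_divide)
    qed
  qed
  \<comment> \<open>The sum of the \<open>y n t\<close> equals the number of pairings minus the sum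
    of \<open>y n t * (\<gamma> t n - 1)\<close>. Up to second order, \<open>y n t\<close> may be
    replaced by 1 here and \<open>\<gamma> t n - 1\<close> by its leading term.\<close>
  have ev: "eventually (\<lambda>n. of_nat n ^ m * \<xi> n (replicate (2 * m) 1) -
      (of_nat (card T) - (\<Sum>t\<in>T. of_nat (flips t)) / of_nat n) =
      - (\<Sum>t\<in>T. (y n t - 1) * complex_of_real (\<gamma> t n - 1) +
        complex_of_real (\<gamma> t n - 1 - real (flips t) / real n))) sequentially"
    using eventually_ge_at_top[of 1] eventually_ge_at_top[of "2 * m"]
  proof eventually_elim
    case (elim n)
    have "of_nat n ^ m * \<xi> n (replicate (2 * m) 1) = (\<Sum>t\<in>T. y n t)"
      using column_moments.constant_word_moment[OF moments, of n m] elim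
      by (simp add: y_def T_def sum_distrib_left)
    moreover have "(\<Sum>t\<in>T. (y n t - 1) * complex_of_real (\<gamma> t n - 1) +
        complex_of_real (\<gamma> t n - 1 - real (flips t) / real n)) =
        (\<Sum>t\<in>T. y n t * complex_of_real (\<gamma> t n) - y n t - of_nat (flips t) / of_nat n)"
      by (intro sum.cong) (simp_all add: algebra_simps)
    moreover have "\<dots> = of_nat (card T) - (\<Sum>t\<in>T. y n t) - (\<Sum>t\<in>T. of_nat (flips t)) / of_nat n"
      using total[of n] elim by (simp only: sum_subtractf sum_divide_distrib)
    ultimately show ?case by simp
  qed
  have "(\<lambda>n. - (\<Sum>t\<in>T. (y n t - 1) * complex_of_real (\<gamma> t n - 1) +
        complex_of_real (\<gamma> t n - 1 - real (flips t) / real n))) \<in> O(\<lambda>n. 1 / of_nat n ^ 2)"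
  proof (subst landau_o.big.uminus_in_iff, intro big_sum_in_bigo sum_in_bigo(1))
    fix t assume t: "t \<in> T"
    show "(\<lambda>n. (y n t - 1) * complex_of_real (\<gamma> t n - 1)) \<in> O(\<lambda>n. 1 / of_nat n ^ 2)"
      using landau_o.big.mult[OF y1[OF t] bigo_of_real[OF first[OF t]]]
      by (simp add: power2_eq_square)
    show "(\<lambda>n. complex_of_real (\<gamma> t n - 1 - real (flips t) / real n)) \<in> O(\<lambda>n. 1 / of_nat n ^ 2)"
      using bigo_of_real[OF second[OF t]] by simp
  qed
  then show ?thesis using landau_o.big.in_cong[OF ev] unfolding T_def by blast
qed

subsection \<open>Generating functions\<close>

definition nct_series :: "(nct \<Rightarrow> nat) \<Rightarrow> complex fps" where
  "nct_series f = Abs_fps (\<lambda>m. \<Sum>t\<in>ncts m. of_nat (f t))"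

lemma nth_nct_series_mult:
  "fps_nth (nct_series f * nct_series g) m = (\<Sum>i\<le>m. \<Sum>l\<in>ncts i. \<Sum>r\<in>ncts (m - i). of_nat (f l * g r))"
  by (simp add: nct_series_def fps_mult_nth sum_product atLeast0AtMost)

lemma card_ncts_Suc: "card (ncts (Suc m)) = (\<Sum>i\<le>m. card (ncts i) * card (ncts (m - i)))"
  using sum_ncts_Suc[of "\<lambda>_. 1 :: nat" m] by simp

lemma nct_series_card: "nct_series (\<lambda>_. 1) = 1 + fps_X * nct_series (\<lambda>_. 1) ^ 2"
proof (rule fps_ext)
  fix m
  show "fps_nth (nct_series (\<lambda>_. 1)) m = fps_nth (1 + fps_X * nct_series (\<lambda>_. 1) ^ 2) m"
    by (cases m) (simp_all add: power2_eq_square nth_nct_series_mult,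
        simp_all add: nct_series_def card_ncts_Suc ncts_0)
qed

lemma nct_series_root_degree:
  "nct_series root_degree =
    fps_X * (nct_series (\<lambda>_. 1) * (nct_series (\<lambda>_. 1) + nct_series root_degree))"
proof (rule fps_ext)
  fix m
  show "fps_nth (nct_series root_degree) m =
    fps_nth (fps_X * (nct_series (\<lambda>_. 1) * (nct_series (\<lambda>_. 1) + nct_series root_degree))) m"
    by (cases m) (simp_all add: distrib_left nth_nct_series_mult,
        simp_all add: nct_series_def sum_ncts_Suc ncts_0 sum.distrib distrib_left)
qed

text \<open>The subtrees \<open>l\<close> and \<open>r\<close> enter \<open>flips\<close>
  symmetrically, whence the factor 2.\<close>

lemma nct_series_flips:
  "nct_series flips =
    2 * fps_X * (nct_series (\<lambda>_. 1) * (nct_series root_degree + nct_series flips))"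
proof (rule fps_ext)
  fix m
  let ?W = "nct_series (\<lambda>_. 1)" and ?D = "nct_series root_degree" and ?E = "nct_series flips"
  have *: "2 * fps_X * (?W * (?D + ?E)) = fps_X * (?E * ?W + ?W * ?E + ?D * ?W + ?W * ?D)"
    by (simp add: algebra_simps)
  have "fps_nth ?E m = fps_nth (fps_X * (?E * ?W + ?W * ?E + ?D * ?W + ?W * ?D)) m"
  proof (cases m)
    case (Suc k)
    have "fps_nth ?E (Suc k) =
        fps_nth (?E * ?W) k + fps_nth (?W * ?E) k + fps_nth (?D * ?W) k + fps_nth (?W * ?D) k"
      unfolding nth_nct_series_mult
      by (simp add: nct_series_def sum_ncts_Suc sum.distrib sum_distrib_left)
    then show ?thesis using Suc by (simp only: fps_X_mult_nth fps_add_nth) simp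
  qed (simp add: nct_series_def ncts_0)
  then show "fps_nth ?E m = fps_nth (2 * fps_X * (?W * (?D + ?E))) m"
    unfolding * .
qed

text \<open>\<open>W\<close> is the Catalan series, with inverse \<open>1 - x * W\<close>, which is
  half of \<open>1 + s\<close>; multiplying by it replaces all divisions. The linear equations give
  \<open>D = x * W ^ 3\<close> and \<open>E * s = 2 * x ^ 2 * W ^ 4\<close>, and the constant 32 is
  2 times 2^4.\<close>

lemma series_closed_forms:
  fixes x W D E s :: "'a::field_char_0 fps"
  assumes W: "W = 1 + x * W ^ 2" and D: "D = x * (W * (W + D))" and E: "E = 2 * x * (W * (D + E))"
    and s: "s = 1 - 2 * x * W"
  shows "s ^ 2 = 1 - 4 * x" "W * (1 + s) = 2" "E * ((1 + s) ^ 4 * s) = 32 * x ^ 2"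
proof -
  have W1: "W - x * W ^ 2 = 1" using W by (metis add_diff_cancel_right')
  then have inv: "W * (1 - x * W) = 1" by (simp add: algebra_simps power2_eq_square)
  have "s ^ 2 = 1 - 4 * x * (W - x * W ^ 2)"
    unfolding s by (simp add: algebra_simps power2_eq_square)
  then show "s ^ 2 = 1 - 4 * x" by (simp add: W1)
  have s': "1 + s = 2 * (1 - x * W)" by (simp add: s)
  have "W * (1 + s) = 2 * (W * (1 - x * W))" unfolding s' by (simp only: mult.left_commute)
  then show "W * (1 + s) = 2" by (simp add: inv)
  have "D * (1 - x * W) = x * W ^ 2"
  proof -
    have "D * (1 - x * W) = D - x * (W * D)" by (simp add: algebra_simps)
    also have "\<dots> = x * (W * (W + D)) - x * (W * D)" using D by simp
    finally show ?thesis by (simp add: algebra_simps power2_eq_square)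
  qed
  moreover have "D * (W * (1 - x * W)) = D * (1 - x * W) * W" by (simp only: ac_simps)
  ultimately have "D * (W * (1 - x * W)) = x * W ^ 2 * W" by simp
  then have D': "D = x * W ^ 3" unfolding inv by (simp add: power3_eq_cube power2_eq_square mult.assoc)
  have "E * s = E - 2 * x * (W * E)" by (simp add: s algebra_simps)
  also have "\<dots> = 2 * x * (W * (D + E)) - 2 * x * (W * E)" using E by simp
  also have "\<dots> = 2 * x * (W * D)" by (simp add: algebra_simps)
  also have "\<dots> = 2 * x ^ 2 * W ^ 4" unfolding D' by (simp add: power_def numeral_eq_Suc)
  finally have "E * s = 2 * x ^ 2 * W ^ 4" .
  moreover have "E * ((1 + s) ^ 4 * s) = E * s * (1 + s) ^ 4" by (simp only: ac_simps)
  ultimately have "E * ((1 + s) ^ 4 * s) = 2 * x ^ 2 * W ^ 4 * (2 * (1 - x * W)) ^ 4"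
    unfolding s' by simp
  also have "\<dots> = 32 * x ^ 2 * (W * (1 - x * W)) ^ 4"
    unfolding power_mult_distrib by simp
  finally show "E * ((1 + s) ^ 4 * s) = 32 * x ^ 2" by (simp add: inv)
qed

text \<open>A pairing with \<open>m\<close> arches belongs to the moment of order
  \<open>2 * m\<close>, hence the substitution of the square of the variable.\<close>

definition even_series :: "(nct \<Rightarrow> nat) \<Rightarrow> complex fps" where
  "even_series f = nct_series f oo fps_X ^ 2"

lemma even_series_nth:
  "fps_nth (even_series f) k = (if even k then \<Sum>t\<in>ncts (k div 2). of_nat (f t) else 0)"
  by (simp add: even_series_def fps_nth_compose_X_power nct_series_def)

lemma leading_series: "2 / (1 + sqrt_series) = even_series (\<lambda>_. 1)"
  and correction_series: "32 * fps_X ^ 4 / ((1 + sqrt_series) ^ 4 * sqrt_series) = even_series flips"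
proof -
  let ?W = "even_series (\<lambda>_. 1)" and ?D = "even_series root_degree" and ?E = "even_series flips"
  have X0: "fps_nth (fps_X ^ 2 :: complex fps) 0 = 0" by simp
  note comp = fps_compose_add_distrib fps_compose_mult_distrib[OF X0] fps_compose_power[OF X0]
    fps_compose_1 fps_X_fps_compose_startby0[OF X0]
  have W: "?W = 1 + fps_X ^ 2 * ?W ^ 2"
    using arg_cong[OF nct_series_card, of "\<lambda>f. f oo fps_X ^ 2"]
    unfolding even_series_def comp .
  have D: "?D = fps_X ^ 2 * (?W * (?W + ?D))"
    using arg_cong[OF nct_series_root_degree, of "\<lambda>f. f oo fps_X ^ 2"]
    unfolding even_series_def comp .
  have E: "?E = 2 * fps_X ^ 2 * (?W * (?D + ?E))"
    using arg_cong[OF nct_series_flips, of "\<lambda>f. f oo fps_X ^ 2"]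
    unfolding even_series_def comp numeral_fps_const fps_const_compose .
  define s where "s = 1 - 2 * fps_X ^ 2 * ?W"
  note closed = series_closed_forms[OF W D E s_def]
  \<comment> \<open>Two series have this square; the constant term 1 selects the prescribed
    one.\<close>
  have "s = sqrt_series"
    unfolding sqrt_series_iff
  proof
    show "fps_nth s 0 = 1" by (simp add: s_def)
  qed (rule closed(1))
  have s: "1 + s \<noteq> 0" "s \<noteq> 0"
    using closed(2) sqrt_series_iff[of s] \<open>s = sqrt_series\<close> by auto
  have "2 / (1 + s) = ?W * (1 + s) / (1 + s)" unfolding closed(2) ..
  also have "\<dots> = ?W" using s by simp
  finally show "2 / (1 + sqrt_series) = ?W" using \<open>s = sqrt_series\<close> by simp
  have "32 * fps_X ^ 4 / ((1 + s) ^ 4 * s) = ?E * ((1 + s) ^ 4 * s) / ((1 + s) ^ 4 * s)"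
    unfolding closed(3) power_mult[symmetric] by simp
  also have "\<dots> = ?E" by (rule nonzero_mult_div_cancel_right) (use s in simp)
  finally show "32 * fps_X ^ 4 / ((1 + sqrt_series) ^ 4 * sqrt_series) = ?E"
    using \<open>s = sqrt_series\<close> by simp
qed

text \<open>For odd \<open>k\<close> both sides are zero: the moment because no pairing fits a word
  of odd length, the series because they are series in the square of the variable.\<close>

lemma series_asymp:
  assumes moments: "\<And>n. n \<ge> 1 \<Longrightarrow> column_moments n (\<xi> n)"
    and M: "\<And>n. n \<ge> 1 \<Longrightarrow> M n = complex_of_real (sqrt (real n)) ^ k * \<xi> n (replicate k 1)"
  shows "(\<lambda>n. M n - fps_nth (2 / (1 + sqrt_series) - fps_const (1 / of_nat n) *
      (32 * fps_X ^ 4 / ((1 + sqrt_series) ^ 4 * sqrt_series))) k) \<in> O(\<lambda>n. 1 / of_nat n ^ 2)"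
proof (cases "even k")
  case True
  then obtain m where k: "k = 2 * m" by blast
  have pow: "complex_of_real (sqrt (real n)) ^ k = of_nat n ^ m" for n
    unfolding k power_mult of_real_power[symmetric] by simp
  have ev: "eventually (\<lambda>n. M n - fps_nth (2 / (1 + sqrt_series) - fps_const (1 / of_nat n) *
      (32 * fps_X ^ 4 / ((1 + sqrt_series) ^ 4 * sqrt_series))) k =
    of_nat n ^ m * \<xi> n (replicate (2 * m) 1) -
      (of_nat (card (ncts m)) - (\<Sum>t\<in>ncts m. of_nat (flips t)) / of_nat n)) sequentially"
    using eventually_ge_at_top[of 1]
  proof eventually_elim
    case (elim n)
    then show ?case
      unfolding leading_series correction_series M[OF elim] pow
      by (simp add: even_series_nth k)
  qed
  show ?thesis by (subst landau_o.big.in_cong[OF ev]) (rule even_moment_asymp[OF moments])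
next
  case False
  have ev: "eventually (\<lambda>n. M n - fps_nth (2 / (1 + sqrt_series) - fps_const (1 / of_nat n) *
      (32 * fps_X ^ 4 / ((1 + sqrt_series) ^ 4 * sqrt_series))) k = 0) sequentially"
    using eventually_ge_at_top[of 1]
  proof eventually_elim
    case (elim n)
    have "\<xi> n (replicate k 1) = 0"
      using column_moments.odd_moment[OF moments[OF elim] False elim] .
    then show ?case
      unfolding leading_series correction_series M[OF elim]
      using False by (simp add: even_series_nth)
  qed
  show ?thesis by (subst landau_o.big.in_cong[OF ev]) simp
qed

section \<open>Star algebras\<close>

locale star_alg = ring A for A :: "('a, 'x) star_algebra_scheme" (structure) +
  assumes smult_closed [simp, intro]: "a \<in> carrier A \<Longrightarrow> c \<odot> a \<in> carrier A"
    and smult_l_distr: "a \<in> carrier A \<Longrightarrow> (c + d) \<odot> a = c \<odot> a \<oplus> d \<odot> a"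
    and smult_r_distr: "a \<in> carrier A \<Longrightarrow> b \<in> carrier A \<Longrightarrow> c \<odot> (a \<oplus> b) = c \<odot> a \<oplus> c \<odot> b"
    and smult_smult: "a \<in> carrier A \<Longrightarrow> c \<odot> (d \<odot> a) = (c * d) \<odot> a"
    and smult_one [simp]: "a \<in> carrier A \<Longrightarrow> 1 \<odot> a = a"
    and smult_mult_left: "a \<in> carrier A \<Longrightarrow> b \<in> carrier A \<Longrightarrow> (c \<odot> a) \<otimes> b = c \<odot> (a \<otimes> b)"
    and smult_mult_right: "a \<in> carrier A \<Longrightarrow> b \<in> carrier A \<Longrightarrow> a \<otimes> (c \<odot> b) = c \<odot> (a \<otimes> b)"
    and star_closed [simp, intro]: "a \<in> carrier A \<Longrightarrow> star A a \<in> carrier A"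
    and star_star [simp]: "a \<in> carrier A \<Longrightarrow> star A (star A a) = a"
    and star_add: "a \<in> carrier A \<Longrightarrow> b \<in> carrier A \<Longrightarrow> star A (a \<oplus> b) = star A a \<oplus> star A b"
    and star_smult: "a \<in> carrier A \<Longrightarrow> star A (c \<odot> a) = cnj c \<odot> star A a"
    and star_mult: "a \<in> carrier A \<Longrightarrow> b \<in> carrier A \<Longrightarrow> star A (a \<otimes> b) = star A b \<otimes> star A a"
begin

lemma smult_zero_left [simp]: "a \<in> carrier A \<Longrightarrow> 0 \<odot> a = \<zero>"
  using smult_l_distr[of a 0 0] add.r_cancel_one'[of "0 \<odot> a" "0 \<odot> a"] by simp

lemma smult_zero_right [simp]: "c \<odot> \<zero> = \<zero>"
  using smult_smult[of "\<zero>" c 0] by simp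

lemma a_inv_eq_smult: "a \<in> carrier A \<Longrightarrow> \<ominus> a = (-1) \<odot> a"
  using smult_l_distr[of a 1 "-1"] by (simp add: minus_equality add.m_comm)

lemma minus_eq_smult: "a \<in> carrier A \<Longrightarrow> b \<in> carrier A \<Longrightarrow> a \<ominus> b = a \<oplus> (-1) \<odot> b"
  by (simp add: minus_eq a_inv_eq_smult)

lemma star_one [simp]: "star A \<one> = \<one>"
  using star_mult[of "star A \<one>" \<one>] by simp

lemma star_zero [simp]: "star A \<zero> = \<zero>"
  using star_smult[of \<zero> 0] by simp

lemma star_minus: "a \<in> carrier A \<Longrightarrow> b \<in> carrier A \<Longrightarrow> star A (a \<ominus> b) = star A a \<ominus> star A b"
  by (simp add: minus_eq_smult star_add star_smult)

lemma smult_minus: "a \<in> carrier A \<Longrightarrow> b \<in> carrier A \<Longrightarrow> c \<odot> (a \<ominus> b) = c \<odot> a \<ominus> c \<odot> b"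
  by (simp add: minus_eq_smult smult_r_distr smult_smult)

end

subsection \<open>The star algebra of a monoid with involution\<close>

locale star_monoid = monoid M for M :: "'m star_monoid" (structure) +
  assumes mstar_closed [simp, intro]: "a \<in> carrier M \<Longrightarrow> mstar M a \<in> carrier M"
    and mstar_mstar [simp]: "a \<in> carrier M \<Longrightarrow> mstar M (mstar M a) = a"
    and mstar_mult: "a \<in> carrier M \<Longrightarrow> b \<in> carrier M \<Longrightarrow> mstar M (a \<otimes> b) = mstar M b \<otimes> mstar M a"

text \<open>The linear extension of \<open>\<phi>\<close> from the monoid to its algebra. By
  \<open>pairing_ext\<close> an element is determined by its pairings, so identities between
  convolutions are proved by moving \<open>\<phi>\<close> through the operations instead of
  rearranging sums over factorizations.\<close>

definition pairing :: "('m \<Rightarrow> complex) \<Rightarrow> ('m \<Rightarrow> complex) \<Rightarrow> complex" where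
  "pairing f \<phi> = (\<Sum>w | f w \<noteq> 0. f w * \<phi> w)"

lemma pairing_superset:
  assumes "finite S" "{w. f w \<noteq> 0} \<subseteq> S"
  shows "pairing f \<phi> = (\<Sum>w\<in>S. f w * \<phi> w)"
  unfolding pairing_def by (rule sum.mono_neutral_left) (use assms in auto)

lemma pairing_cong: "(\<And>w. f w \<noteq> 0 \<Longrightarrow> \<phi> w = \<psi> w) \<Longrightarrow> pairing f \<phi> = pairing f \<psi>"
  unfolding pairing_def by (rule sum.cong) auto

lemma pairing_add_right: "pairing f (\<lambda>w. \<phi> w + \<psi> w) = pairing f \<phi> + pairing f \<psi>"
  by (simp add: pairing_def sum.distrib distrib_left)

lemma pairing_cmult_right: "pairing f (\<lambda>w. c * \<phi> w) = c * pairing f \<phi>"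
  by (simp add: pairing_def sum_distrib_left mult_ac)

lemma pairing_swap: "pairing f (\<lambda>a. pairing g (\<lambda>b. \<phi> a b)) = pairing g (\<lambda>b. pairing f (\<lambda>a. \<phi> a b))"
  unfolding pairing_def sum_distrib_left by (subst sum.swap) (simp add: mult_ac)

lemma pairing_zero [simp]: "pairing (\<lambda>_. 0) \<phi> = 0"
  by (simp add: pairing_def)

context star_monoid
begin

abbreviation F where "F \<equiv> star_monoid_algebra M"

lemma carrier_F: "f \<in> carrier F \<longleftrightarrow> finite {w. f w \<noteq> 0} \<and> {w. f w \<noteq> 0} \<subseteq> carrier M"
  by (simp add: star_monoid_algebra_def)

lemma finite_supp: "f \<in> carrier F \<Longrightarrow> finite {w. f w \<noteq> 0}"
  unfolding carrier_F by blast
lemma supp_closed: "f \<in> carrier F \<Longrightarrow> f w \<noteq> 0 \<Longrightarrow> w \<in> carrier M"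
  unfolding carrier_F by blast
lemma F_add: "f \<oplus>\<^bsub>F\<^esub> g = (\<lambda>w. f w + g w)" 
  by (simp add: star_monoid_algebra_def basis_elem_def)
lemma  F_smult: "c \<odot>\<^bsub>F\<^esub> f = (\<lambda>w. c * f w)"
  by (simp add: star_monoid_algebra_def basis_elem_def)
lemma  F_zero: "\<zero>\<^bsub>F\<^esub> = (\<lambda>_. 0)"
  by (simp add: star_monoid_algebra_def basis_elem_def)
lemma  F_one: "\<one>\<^bsub>F\<^esub> = basis_elem \<one>"
  by (simp add: star_monoid_algebra_def basis_elem_def)
lemma  F_star: "star F f = (\<lambda>w. if w \<in> carrier M then cnj (f (mstar M w)) else 0)"
  by (simp add: star_monoid_algebra_def basis_elem_def)
lemma  F_mult: "f \<otimes>\<^bsub>F\<^esub> g = (\<lambda>w. \<Sum>(a, b) | f a \<noteq> 0 \<and> g b \<noteq> 0 \<and> a \<otimes> b = w. f a * g b)"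
  by (simp add: star_monoid_algebra_def basis_elem_def)

declare finite_supp [simp]

lemma pairing_indicator: "f \<in> carrier F \<Longrightarrow> pairing f (\<lambda>v. if v = w then 1 else 0) = f w"
  by (subst pairing_superset[of "insert w {w. f w \<noteq> 0}"]) (auto simp: if_distrib cong: if_cong)

lemma pairing_ext:
  assumes "f \<in> carrier F" "g \<in> carrier F" "\<And>\<phi>. pairing f \<phi> = pairing g \<phi>"
  shows "f = g"
  using assms pairing_indicator by (metis ext)

lemma add_closed_F: "f \<in> carrier F \<Longrightarrow> g \<in> carrier F \<Longrightarrow> f \<oplus>\<^bsub>F\<^esub> g \<in> carrier F"
proof -
  assume *: "f \<in> carrier F" "g \<in> carrier F"
  have "{w. f w + g w \<noteq> 0} \<subseteq> {w. f w \<noteq> 0} \<union> {w. g w \<noteq> 0}" by auto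
  with * show ?thesis unfolding carrier_F F_add by (meson finite_UnI finite_subset le_sup_iff order_trans)
qed

lemma smult_closed_F: "f \<in> carrier F \<Longrightarrow> c \<odot>\<^bsub>F\<^esub> f \<in> carrier F"
  unfolding carrier_F F_smult by (auto elim: finite_subset[rotated])

lemma zero_closed_F: "\<zero>\<^bsub>F\<^esub> \<in> carrier F"
  by (simp add: carrier_F F_zero)

lemma basis_elem_closed [simp]: "v \<in> carrier M \<Longrightarrow> basis_elem v \<in> carrier F"
  by (simp add: carrier_F basis_elem_def)

lemma supp_star: "f \<in> carrier F \<Longrightarrow> {w. star F f w \<noteq> 0} = mstar M ` {w. f w \<noteq> 0}"
  unfolding F_star by (auto simp: image_iff dest: supp_closed) (metis mstar_mstar)

lemma star_closed_F: "f \<in> carrier F \<Longrightarrow> star F f \<in> carrier F"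
  using supp_closed by (simp add: carrier_F[of "star F f"] supp_star) auto

lemma supp_mult:
  "{w. (f \<otimes>\<^bsub>F\<^esub> g) w \<noteq> 0} \<subseteq> (\<lambda>(a, b). a \<otimes> b) ` ({w. f w \<noteq> 0} \<times> {w. g w \<noteq> 0})"
proof
  fix w assume "w \<in> {w. (f \<otimes>\<^bsub>F\<^esub> g) w \<noteq> 0}"
  then obtain p where "p \<in> {(a, b). f a \<noteq> 0 \<and> g b \<noteq> 0 \<and> a \<otimes> b = w}"
    unfolding F_mult by (metis (mono_tags, lifting) mem_Collect_eq sum.not_neutral_contains_not_neutral)
  then show "w \<in> (\<lambda>(a, b). a \<otimes> b) ` ({w. f w \<noteq> 0} \<times> {w. g w \<noteq> 0})" by force
qed

lemma mult_closed_F: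
  assumes "f \<in> carrier F" "g \<in> carrier F"
  shows "f \<otimes>\<^bsub>F\<^esub> g \<in> carrier F"
proof -
  have "finite ((\<lambda>(a, b). a \<otimes> b) ` ({w. f w \<noteq> 0} \<times> {w. g w \<noteq> 0}))"
    using assms by simp
  moreover have "(\<lambda>(a, b). a \<otimes> b) ` ({w. f w \<noteq> 0} \<times> {w. g w \<noteq> 0}) \<subseteq> carrier M"
    using assms by (auto dest: supp_closed)
  ultimately show ?thesis
    unfolding carrier_F using supp_mult[of f g] by (meson finite_subset order_trans)
qed

lemma pairing_add:
  assumes "f \<in> carrier F" "g \<in> carrier F"
  shows "pairing (f \<oplus>\<^bsub>F\<^esub> g) \<phi> = pairing f \<phi> + pairing g \<phi>"
proof -
  let ?S = "{w. f w \<noteq> 0} \<union> {w. g w \<noteq> 0}"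
  have S: "finite ?S" using assms by simp
  have "pairing h \<phi> = (\<Sum>w\<in>?S. h w * \<phi> w)" if "h \<in> {f \<oplus>\<^bsub>F\<^esub> g, f, g}" for h
    by (rule pairing_superset[OF S]) (use that in \<open>auto simp: F_add\<close>)
  then show ?thesis by (simp add: sum.distrib distrib_right) (simp add: F_add sum.distrib distrib_right)
qed

lemma pairing_smult: "f \<in> carrier F \<Longrightarrow> pairing (c \<odot>\<^bsub>F\<^esub> f) \<phi> = c * pairing f \<phi>"
  by (subst (1 2) pairing_superset[of "{w. f w \<noteq> 0}"])
    (auto simp: F_smult sum_distrib_left mult_ac)

lemma pairing_mult:
  assumes "f \<in> carrier F" "g \<in> carrier F"
  shows "pairing (f \<otimes>\<^bsub>F\<^esub> g) \<phi> = pairing f (\<lambda>a. pairing g (\<lambda>b. \<phi> (a \<otimes> b)))"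
proof -
  let ?S = "{w. f w \<noteq> 0} \<times> {w. g w \<noteq> 0}" and ?m = "\<lambda>(a, b). a \<otimes> b"
  have fin: "finite ?S" using assms by simp
  have "pairing (f \<otimes>\<^bsub>F\<^esub> g) \<phi> = (\<Sum>w\<in>?m ` ?S. (f \<otimes>\<^bsub>F\<^esub> g) w * \<phi> w)"
    by (rule pairing_superset) (use fin supp_mult in auto)
  also have "\<dots> = (\<Sum>w\<in>?m ` ?S. \<Sum>p | p \<in> ?S \<and> ?m p = w. f (fst p) * g (snd p) * \<phi> (?m p))"
  proof (rule sum.cong)
    fix w
    have "{(a, b). f a \<noteq> 0 \<and> g b \<noteq> 0 \<and> a \<otimes> b = w} = {p. p \<in> ?S \<and> ?m p = w}" by auto
    then show "(f \<otimes>\<^bsub>F\<^esub> g) w * \<phi> w = (\<Sum>p | p \<in> ?S \<and> ?m p = w. f (fst p) * g (snd p) * \<phi> (?m p))"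
      unfolding F_mult by (simp add: sum_distrib_right case_prod_unfold)
  qed simp
  also have "\<dots> = (\<Sum>p\<in>?S. f (fst p) * g (snd p) * \<phi> (?m p))"
    by (rule sum.group[OF fin]) (use fin in auto)
  also have "\<dots> = pairing f (\<lambda>a. pairing g (\<lambda>b. \<phi> (a \<otimes> b)))"
    by (simp add: pairing_def sum_distrib_left sum.cartesian_product case_prod_unfold mult_ac)
  finally show ?thesis .
qed

lemma pairing_star:
  assumes "f \<in> carrier F"
  shows "pairing (star F f) \<phi> = cnj (pairing f (\<lambda>w. cnj (\<phi> (mstar M w))))"
proof -
  have inj: "inj_on (mstar M) {w. f w \<noteq> 0}"
    by (rule inj_on_inverseI[of _ "mstar M"]) (use assms supp_closed in auto)
  have "pairing (star F f) \<phi> = (\<Sum>w | f w \<noteq> 0. star F f (mstar M w) * \<phi> (mstar M w))"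
    unfolding pairing_def supp_star[OF assms] by (simp add: sum.reindex[OF inj])
  also have "\<dots> = (\<Sum>w | f w \<noteq> 0. cnj (f w * cnj (\<phi> (mstar M w))))"
    by (rule sum.cong) (use assms supp_closed in \<open>auto simp: F_star\<close>)
  finally show ?thesis by (simp add: pairing_def)
qed

lemma pairing_basis_elem [simp]: "pairing (basis_elem v) \<phi> = \<phi> v"
  by (simp add: pairing_def basis_elem_def)

lemma star_alg_F: "star_alg F"
proof -
  note closed = add_closed_F smult_closed_F zero_closed_F mult_closed_F star_closed_F
  have one: "\<one>\<^bsub>F\<^esub> \<in> carrier F" by (simp add: F_one)
  have "ring F"
  proof (intro ringI abelian_groupI monoidI)
    fix f assume f: "f \<in> carrier F"
    show "\<exists>g\<in>carrier F. g \<oplus>\<^bsub>F\<^esub> f = \<zero>\<^bsub>F\<^esub>"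
      by (rule bexI[of _ "(-1) \<odot>\<^bsub>F\<^esub> f"]) (use smult_closed_F[OF f, of "-1"] in \<open>simp_all add: F_add F_smult F_zero\<close>)
    show "\<one>\<^bsub>F\<^esub> \<otimes>\<^bsub>F\<^esub> f = f"
    proof (rule pairing_ext)
      fix \<phi>
      have "pairing f (\<lambda>b. \<phi> (\<one> \<otimes> b)) = pairing f \<phi>"
        by (rule pairing_cong) (use f supp_closed in auto)
      then show "pairing (\<one>\<^bsub>F\<^esub> \<otimes>\<^bsub>F\<^esub> f) \<phi> = pairing f \<phi>"
        using f one by (simp add: pairing_mult) (simp add: F_one)
    qed (use f one closed in auto)
    show "f \<otimes>\<^bsub>F\<^esub> \<one>\<^bsub>F\<^esub> = f"
    proof (rule pairing_ext)
      fix \<phi>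
      have "pairing f (\<lambda>b. \<phi> (b \<otimes> \<one>)) = pairing f \<phi>"
        by (rule pairing_cong) (use f supp_closed in auto)
      then show "pairing (f \<otimes>\<^bsub>F\<^esub> \<one>\<^bsub>F\<^esub>) \<phi> = pairing f \<phi>"
        using f one by (simp add: pairing_mult) (simp add: F_one)
    qed (use f one closed in auto)
  next
    fix f g k assume fgk: "f \<in> carrier F" "g \<in> carrier F" "k \<in> carrier F"
    show "f \<otimes>\<^bsub>F\<^esub> g \<otimes>\<^bsub>F\<^esub> k = f \<otimes>\<^bsub>F\<^esub> (g \<otimes>\<^bsub>F\<^esub> k)"
    proof (rule pairing_ext)
      fix \<phi>
      have "pairing f (\<lambda>a. pairing g (\<lambda>b. pairing k (\<lambda>c. \<phi> (a \<otimes> b \<otimes> c)))) =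
          pairing f (\<lambda>a. pairing g (\<lambda>b. pairing k (\<lambda>c. \<phi> (a \<otimes> (b \<otimes> c)))))"
        by (intro pairing_cong) (use fgk supp_closed in \<open>auto simp: m_assoc\<close>)
      then show "pairing (f \<otimes>\<^bsub>F\<^esub> g \<otimes>\<^bsub>F\<^esub> k) \<phi> = pairing (f \<otimes>\<^bsub>F\<^esub> (g \<otimes>\<^bsub>F\<^esub> k)) \<phi>"
        using fgk by (simp add: pairing_mult closed)
    qed (use fgk closed in auto)
    show "(f \<oplus>\<^bsub>F\<^esub> g) \<otimes>\<^bsub>F\<^esub> k = f \<otimes>\<^bsub>F\<^esub> k \<oplus>\<^bsub>F\<^esub> g \<otimes>\<^bsub>F\<^esub> k"
      by (rule pairing_ext) (use fgk in \<open>auto simp: closed pairing_mult pairing_add\<close>)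
    show "k \<otimes>\<^bsub>F\<^esub> (f \<oplus>\<^bsub>F\<^esub> g) = k \<otimes>\<^bsub>F\<^esub> f \<oplus>\<^bsub>F\<^esub> k \<otimes>\<^bsub>F\<^esub> g"
      by (rule pairing_ext) (use fgk in \<open>auto simp: closed pairing_mult pairing_add pairing_add_right\<close>)
  qed (simp_all add: closed one, simp_all add: F_add F_zero algebra_simps)
  then interpret ring F .
  show ?thesis
  proof (unfold_locales)
    fix f g c assume fg: "f \<in> carrier F" "g \<in> carrier F"
    show "(c \<odot>\<^bsub>F\<^esub> f) \<otimes>\<^bsub>F\<^esub> g = c \<odot>\<^bsub>F\<^esub> (f \<otimes>\<^bsub>F\<^esub> g)"
      by (rule pairing_ext) (use fg in \<open>auto simp: closed pairing_mult pairing_smult\<close>)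
    show "f \<otimes>\<^bsub>F\<^esub> (c \<odot>\<^bsub>F\<^esub> g) = c \<odot>\<^bsub>F\<^esub> (f \<otimes>\<^bsub>F\<^esub> g)"
      by (rule pairing_ext) (use fg in \<open>auto simp: closed pairing_mult pairing_smult pairing_cmult_right\<close>)
    show "star F (f \<otimes>\<^bsub>F\<^esub> g) = star F g \<otimes>\<^bsub>F\<^esub> star F f"
    proof (rule pairing_ext)
      fix \<phi>
      have "pairing f (\<lambda>a. pairing g (\<lambda>b. cnj (\<phi> (mstar M (a \<otimes> b))))) =
          pairing f (\<lambda>a. pairing g (\<lambda>b. cnj (\<phi> (mstar M b \<otimes> mstar M a))))"
        by (intro pairing_cong) (use fg supp_closed in \<open>auto simp: mstar_mult\<close>)
      then show "pairing (star F (f \<otimes>\<^bsub>F\<^esub> g)) \<phi> = pairing (star F g \<otimes>\<^bsub>F\<^esub> star F f) \<phi>"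
        using fg by (simp add: pairing_mult pairing_star closed pairing_swap[of f])
    qed (use fg closed in auto)
  qed (simp_all add: closed, auto simp: F_add F_smult F_star algebra_simps fun_eq_iff dest: supp_closed)
qed

lemma mult_basis_elem:
  "v \<in> carrier M \<Longrightarrow> w \<in> carrier M \<Longrightarrow> basis_elem v \<otimes>\<^bsub>F\<^esub> basis_elem w = basis_elem (v \<otimes> w)"
  by (rule pairing_ext) (auto simp: mult_closed_F pairing_mult)

lemma star_basis_elem: "v \<in> carrier M \<Longrightarrow> star F (basis_elem v) = basis_elem (mstar M v)"
  by (rule pairing_ext) (auto simp: star_closed_F pairing_star)

lemma sum_closed_F:
  assumes "finite I" "\<And>i. i \<in> I \<Longrightarrow> f i \<in> carrier F"
  shows "(\<lambda>w. \<Sum>i\<in>I. c i * f i w) \<in> carrier F"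
  using assms
proof (induction I rule: finite_induct)
  case (insert i I)
  then have "(c i \<odot>\<^bsub>F\<^esub> f i) \<oplus>\<^bsub>F\<^esub> (\<lambda>w. \<Sum>i\<in>I. c i * f i w) \<in> carrier F"
    by (intro add_closed_F smult_closed_F) auto
  then show ?case using insert(1,2) by (simp add: F_add F_smult)
qed (use zero_closed_F in \<open>simp add: F_zero\<close>)

lemma pairing_sum:
  assumes "finite I" "\<And>i. i \<in> I \<Longrightarrow> f i \<in> carrier F"
  shows "pairing (\<lambda>w. \<Sum>i\<in>I. c i * f i w) \<phi> = (\<Sum>i\<in>I. c i * pairing (f i) \<phi>)"
  using assms
proof (induction I rule: finite_induct)
  case (insert i I)
  have "pairing ((c i \<odot>\<^bsub>F\<^esub> f i) \<oplus>\<^bsub>F\<^esub> (\<lambda>w. \<Sum>i\<in>I. c i * f i w)) \<phi> =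
      c i * pairing (f i) \<phi> + pairing (\<lambda>w. \<Sum>i\<in>I. c i * f i w) \<phi>"
    using insert by (simp add: pairing_add pairing_smult smult_closed_F sum_closed_F)
  then show ?case using insert by (simp add: F_add F_smult)
qed simp

end

subsection \<open>C*-seminorms\<close>

locale cstar_seminormed = star_alg A for A :: "('a, 'x) star_algebra_scheme" (structure) +
  fixes p :: "'a \<Rightarrow> real"
  assumes cstar_seminorm: "cstar_seminorm A p"
begin

lemma p_nonneg [simp]: "a \<in> carrier A \<Longrightarrow> 0 \<le> p a"
  and p_triangle: "a \<in> carrier A \<Longrightarrow> b \<in> carrier A \<Longrightarrow> p (a \<oplus> b) \<le> p a + p b"
  and p_smult: "a \<in> carrier A \<Longrightarrow> p (c \<odot> a) = cmod c * p a"
  and p_mult: "a \<in> carrier A \<Longrightarrow> b \<in> carrier A \<Longrightarrow> p (a \<otimes> b) \<le> p a * p b"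
  and p_cstar: "a \<in> carrier A \<Longrightarrow> p (star A a \<otimes> a) = (p a)\<^sup>2"
  using cstar_seminorm unfolding cstar_seminorm_def by simp_all

lemma p_zero [simp]: "p \<zero> = 0"
  using p_smult[of "\<zero>" 0] by simp

text \<open>Submultiplicativity against the C*-identity. Applied to \<open>a\<close> and to its
  adjoint it shows that the involution is isometric, which is not among the clauses of
  \<open>cstar_seminorm\<close>.\<close>

lemma p_star_le: "a \<in> carrier A \<Longrightarrow> p a \<le> p (star A a)"
proof (cases "p a = 0")
  case False
  assume a: "a \<in> carrier A"
  have "p a * p a \<le> p (star A a) * p a"
    using p_mult[of "star A a" a] p_cstar[OF a] a by (simp add: power2_eq_square)
  then show ?thesis using False p_nonneg[OF a] by (simp add: mult_le_cancel_right)
qed simp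

lemma p_star [simp]: "a \<in> carrier A \<Longrightarrow> p (star A a) = p a"
  using p_star_le[of a] p_star_le[of "star A a"] by (simp add: antisym)

lemma p_minus: "a \<in> carrier A \<Longrightarrow> p (\<ominus> a) = p a"
  by (simp add: a_inv_eq_smult p_smult)

lemma p_minus_commute: "a \<in> carrier A \<Longrightarrow> b \<in> carrier A \<Longrightarrow> p (a \<ominus> b) = p (b \<ominus> a)"
proof -
  assume ab: "a \<in> carrier A" "b \<in> carrier A"
  then have "a \<ominus> b = \<ominus> (b \<ominus> a)" by algebra
  then show ?thesis using p_minus[of "b \<ominus> a"] ab by simp
qed

lemma p_minus_triangle:
  assumes "a \<in> carrier A" "b \<in> carrier A" "c \<in> carrier A"
  shows "p (a \<ominus> c) \<le> p (a \<ominus> b) + p (b \<ominus> c)"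
proof -
  have "a \<ominus> c = (a \<ominus> b) \<oplus> (b \<ominus> c)" using assms by algebra
  then show ?thesis using p_triangle[of "a \<ominus> b" "b \<ominus> c"] assms by simp
qed

lemma p_abs_diff: "a \<in> carrier A \<Longrightarrow> b \<in> carrier A \<Longrightarrow> \<bar>p a - p b\<bar> \<le> p (a \<ominus> b)"
proof -
  assume ab: "a \<in> carrier A" "b \<in> carrier A"
  then have "a = (a \<ominus> b) \<oplus> b" "b = (b \<ominus> a) \<oplus> a" by algebra+
  then have "p a \<le> p (a \<ominus> b) + p b" "p b \<le> p (b \<ominus> a) + p a"
    using p_triangle[of "a \<ominus> b" b] p_triangle[of "b \<ominus> a" a] ab by simp_all
  then show ?thesis using p_minus_commute[OF ab] by linarith
qed

lemma p_one_le: "p \<one> \<le> 1"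
  using p_cstar[of \<one>] p_nonneg[of \<one>] by (auto simp: power2_eq_square)

end

subsection \<open>Positive forms\<close>

text \<open>The values t = 1 and t = \<i> force \<open>v = cnj u\<close>. Then \<open>t\<close> a
  real multiple -s of \<open>cnj u\<close> leaves a real quadratic in \<open>s\<close>, taken at its
  minimum \<open>1 / Re Q\<close>, or at a large \<open>s\<close> if
  \<open>Re Q = 0\<close>.\<close>

lemma nonneg_quadratic_complex:
  fixes P Q u v :: complex
  assumes "\<And>t. P + t * u + cnj t * v + cnj t * t * Q \<in> \<real>\<^sub>\<ge>\<^sub>0"
    and P: "P \<in> \<real>\<^sub>\<ge>\<^sub>0" and Q: "Q \<in> \<real>\<^sub>\<ge>\<^sub>0"
  shows "v = cnj u" "(cmod u)\<^sup>2 \<le> Re P * Re Q"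
proof -
  show v: "v = cnj u"
    using assms(1)[of 1] assms(1)[of \<i>] P Q by (auto simp: complex_eq_iff complex_nonneg_Reals_iff)
  have quad: "0 \<le> Re P - 2 * s * (cmod u)\<^sup>2 + s\<^sup>2 * (cmod u)\<^sup>2 * Re Q" for s :: real
    unfolding cmod_power2 using assms(1)[of "- complex_of_real s * cnj u"] v
    by (simp add: complex_nonneg_Reals_iff power2_eq_square algebra_simps)
  have P0: "Re P \<ge> 0" and Q0: "Re Q \<ge> 0" using P Q by (auto simp: complex_nonneg_Reals_iff)
  show "(cmod u)\<^sup>2 \<le> Re P * Re Q"
  proof (cases "Re Q = 0")
    case True
    have "(cmod u)\<^sup>2 = 0"
    proof (rule ccontr)
      assume "(cmod u)\<^sup>2 \<noteq> 0"
      then show False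
        using quad[of "(Re P + 1) / (cmod u)\<^sup>2"] True P0 by simp
    qed
    then show ?thesis using True by simp
  next
    case False
    have "0 \<le> Re P - (cmod u)\<^sup>2 / Re Q"
      using quad[of "1 / Re Q"] False by (simp add: power2_eq_square field_simps)
    then show ?thesis using False Q0 by (simp add: field_simps)
  qed
qed

context star_alg
begin

lemma positive_formD:
  assumes "positive_form A \<phi>"
  shows "a \<in> carrier A \<Longrightarrow> b \<in> carrier A \<Longrightarrow> \<phi> (a \<oplus> b) = \<phi> a + \<phi> b"
    and "a \<in> carrier A \<Longrightarrow> \<phi> (c \<odot> a) = c * \<phi> a"
    and "a \<in> carrier A \<Longrightarrow> \<phi> (star A a \<otimes> a) \<in> \<real>\<^sub>\<ge>\<^sub>0"
  using assms unfolding positive_form_def by blast+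

lemma form_expand:
  assumes "positive_form A \<phi>" "a \<in> carrier A" "b \<in> carrier A"
  shows "\<phi> (star A (a \<oplus> t \<odot> b) \<otimes> (a \<oplus> t \<odot> b)) =
    \<phi> (star A a \<otimes> a) + t * \<phi> (star A a \<otimes> b) + cnj t * \<phi> (star A b \<otimes> a) + cnj t * t * \<phi> (star A b \<otimes> b)"
  using assms(2,3)
  by (simp add: star_add star_smult l_distr r_distr smult_mult_left smult_mult_right smult_smult
      positive_formD[OF assms(1)] smult_r_distr)

lemma form_nonneg: "positive_form A \<phi> \<Longrightarrow> a \<in> carrier A \<Longrightarrow> 0 \<le> Re (\<phi> (star A a \<otimes> a))"
  using positive_formD(3) by (auto simp: complex_nonneg_Reals_iff)

lemma form_real: "positive_form A \<phi> \<Longrightarrow> a \<in> carrier A \<Longrightarrow>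
    \<phi> (star A a \<otimes> a) = complex_of_real (Re (\<phi> (star A a \<otimes> a)))"
  using positive_formD(3)[of \<phi> a] by (auto simp: complex_nonneg_Reals_iff complex_eq_iff)

lemma cauchy_schwarz:
  assumes "positive_form A \<phi>" "a \<in> carrier A" "b \<in> carrier A"
  shows "(cmod (\<phi> (star A a \<otimes> b)))\<^sup>2 \<le> Re (\<phi> (star A a \<otimes> a)) * Re (\<phi> (star A b \<otimes> b))"
    and "\<phi> (star A b \<otimes> a) = cnj (\<phi> (star A a \<otimes> b))"
proof -
  have "\<phi> (star A a \<otimes> a) + t * \<phi> (star A a \<otimes> b) + cnj t * \<phi> (star A b \<otimes> a) + cnj t * t * \<phi> (star A b \<otimes> b)
      \<in> \<real>\<^sub>\<ge>\<^sub>0" for t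
    using positive_formD(3)[OF assms(1), of "a \<oplus> t \<odot> b"] assms
    unfolding form_expand[OF assms] by simp
  note quad = nonneg_quadratic_complex[OF this positive_formD(3)[OF assms(1)] positive_formD(3)[OF assms(1)]]
  show "(cmod (\<phi> (star A a \<otimes> b)))\<^sup>2 \<le> Re (\<phi> (star A a \<otimes> a)) * Re (\<phi> (star A b \<otimes> b))"
    and "\<phi> (star A b \<otimes> a) = cnj (\<phi> (star A a \<otimes> b))"
    using quad assms by simp_all
qed

lemma cauchy_schwarz_sqrt:
  assumes "positive_form A \<phi>" "a \<in> carrier A" "b \<in> carrier A"
  shows "cmod (\<phi> (star A a \<otimes> b)) \<le> sqrt (Re (\<phi> (star A a \<otimes> a))) * sqrt (Re (\<phi> (star A b \<otimes> b)))"
  using real_sqrt_le_mono[OF cauchy_schwarz(1)[OF assms]] by (simp add: real_sqrt_mult)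

lemma form_norm_triangle:
  assumes \<phi>: "positive_form A \<phi>" and ab: "a \<in> carrier A" "b \<in> carrier A"
  shows "sqrt (Re (\<phi> (star A (a \<oplus> b) \<otimes> (a \<oplus> b)))) \<le>
    sqrt (Re (\<phi> (star A a \<otimes> a))) + sqrt (Re (\<phi> (star A b \<otimes> b)))"
proof (rule real_le_lsqrt)
  let ?x = "Re (\<phi> (star A a \<otimes> a))" and ?y = "Re (\<phi> (star A b \<otimes> b))" and ?u = "\<phi> (star A a \<otimes> b)"
  have "Re (\<phi> (star A (a \<oplus> b) \<otimes> (a \<oplus> b))) = ?x + 2 * Re ?u + ?y"
    using form_expand[OF assms, of 1] cauchy_schwarz(2)[OF assms] ab by simp
  also have "\<dots> \<le> ?x + 2 * (sqrt ?x * sqrt ?y) + ?y"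
    using cauchy_schwarz_sqrt[OF assms] complex_Re_le_cmod[of ?u] by linarith
  also have "\<dots> = (sqrt ?x + sqrt ?y)\<^sup>2"
    using form_nonneg[OF \<phi>] ab by (simp add: power2_sum)
  finally show "Re (\<phi> (star A (a \<oplus> b) \<otimes> (a \<oplus> b))) \<le> (sqrt ?x + sqrt ?y)\<^sup>2" .
qed (use form_nonneg[OF \<phi>] ab in simp)

end

text \<open>Taking roots of order 2^m makes the constant disappear.\<close>

lemma power_bound_imp_le:
  fixes a b C :: real
  assumes "a \<ge> 0" "b \<ge> 0" "\<And>m. a ^ (2 ^ m) \<le> C * b ^ (2 ^ m)"
  shows "a \<le> b"
proof (rule ccontr)
  assume "\<not> a \<le> b"
  then have ab: "a > b" by simp
  show False
  proof (cases "b = 0")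
    case True
    then show False using assms(3)[of 0] ab by simp
  next
    case False
    then have r: "a / b > 1" using ab assms(2) by simp
    obtain m where m: "C < (a / b) ^ m" using real_arch_pow[OF r] by blast
    have "(a / b) ^ m \<le> (a / b) ^ (2 ^ m)"
      by (rule power_increasing) (use r in \<open>auto intro: less_imp_le less_exp\<close>)
    also have "\<dots> \<le> C"
      using assms(3)[of m] False assms(2) by (simp add: power_divide field_simps)
    finally show False using m by simp
  qed
qed

text \<open>The operator seminorm of a family of GNS representations.\<close>

locale gns = star_alg A for A :: "('a, 'x) star_algebra_scheme" (structure) +
  fixes \<Phi> :: "('a \<Rightarrow> complex) set" and N :: "'a \<Rightarrow> real"
  assumes forms: "\<phi> \<in> \<Phi> \<Longrightarrow> positive_form A \<phi>"
    and form_bound: "\<phi> \<in> \<Phi> \<Longrightarrow> a \<in> carrier A \<Longrightarrow> cmod (\<phi> a) \<le> N a"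
    and N_mult: "a \<in> carrier A \<Longrightarrow> b \<in> carrier A \<Longrightarrow> N (a \<otimes> b) \<le> N a * N b"
    and N_star: "a \<in> carrier A \<Longrightarrow> N (star A a) = N a"
    and normalized: "\<exists>\<phi>\<in>\<Phi>. \<phi> \<one> = 1"
begin

text \<open>A pair \<open>(\<phi>, y)\<close> stands for the unit vector given by \<open>y\<close>
  in the GNS space of \<open>\<phi>\<close>; working with pairs avoids building that space.\<close>

definition unit_vectors where
  "unit_vectors = {(\<phi>, y). \<phi> \<in> \<Phi> \<and> y \<in> carrier A \<and> \<phi> (star A y \<otimes> y) = 1}"

definition gns_norm :: "'a \<Rightarrow> real" where
  "gns_norm x = (SUP (\<phi>, y)\<in>unit_vectors. sqrt (Re (\<phi> (star A (x \<otimes> y) \<otimes> (x \<otimes> y)))))"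

lemma N_nonneg: "a \<in> carrier A \<Longrightarrow> 0 \<le> N a"
proof -
  assume a: "a \<in> carrier A"
  obtain \<phi> where "\<phi> \<in> \<Phi>" using normalized by blast
  then show "0 \<le> N a" using form_bound[of \<phi> a] a norm_ge_zero order_trans by blast
qed

lemma unit_vectors_nonempty: "unit_vectors \<noteq> {}"
proof -
  obtain \<phi> where "\<phi> \<in> \<Phi>" "\<phi> \<one> = 1" using normalized by blast
  then have "(\<phi>, \<one>) \<in> unit_vectors" by (simp add: unit_vectors_def)
  then show ?thesis by blast
qed

lemma star_power: "a \<in> carrier A \<Longrightarrow> star A a = a \<Longrightarrow> star A (a [^] k) = a [^] (k::nat)"
  by (induction k) (simp_all add: star_mult nat_pow_mult nat_pow_Suc2[symmetric])

text \<open>Iterating the Cauchy-Schwarz inequality removes the dependence on the vector \<open>y\<close>.\<close>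

lemma form_le_N:
  assumes "\<phi> \<in> \<Phi>" "x \<in> carrier A" "y \<in> carrier A" "\<phi> (star A y \<otimes> y) = 1"
  shows "Re (\<phi> (star A (x \<otimes> y) \<otimes> (x \<otimes> y))) \<le> (N x)\<^sup>2"
proof -
  note \<phi> = forms[OF assms(1)]
  define s where "s = star A x \<otimes> x"
  have s: "s \<in> carrier A" "star A s = s" using assms by (simp_all add: s_def star_mult)
  define a where "a = (\<lambda>m. cmod (\<phi> (star A y \<otimes> (s [^] ((2::nat) ^ m) \<otimes> y))))"
  \<comment> \<open>As \<open>y\<close> is a unit vector, the other factor of the Cauchy-Schwarz
    inequality is 1. Hence \<open>a 0\<close> is at most the root of order 2^m of
    \<open>a m\<close>, and the bound \<open>N\<close> of \<open>y\<close> is lost in the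
    limit.\<close>
  have square: "(a m)\<^sup>2 \<le> a (Suc m)" for m
  proof -
    let ?z = "s [^] ((2::nat) ^ m)"
    have z: "?z \<in> carrier A" "star A ?z = ?z" using s by (simp_all add: star_power)
    have zz: "?z \<otimes> ?z = s [^] ((2::nat) ^ Suc m)" using s by (simp add: nat_pow_mult mult_2)
    have "star A (?z \<otimes> y) \<otimes> (?z \<otimes> y) = star A y \<otimes> (?z \<otimes> ?z \<otimes> y)"
      using z assms by (simp add: star_mult m_assoc)
    then have "(a m)\<^sup>2 \<le> Re (\<phi> (star A y \<otimes> (s [^] ((2::nat) ^ Suc m) \<otimes> y)))"
      using cauchy_schwarz(1)[OF \<phi>, of y "?z \<otimes> y"] z assms unfolding a_def zz by simp
    also have "\<dots> \<le> a (Suc m)" unfolding a_def by (rule complex_Re_le_cmod)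
    finally show ?thesis .
  qed
  have pow: "(a 0) ^ (2 ^ m) \<le> a m" for m
  proof (induction m)
    case (Suc m)
    have "(a 0) ^ (2 ^ Suc m) = ((a 0) ^ (2 ^ m))\<^sup>2" by (simp add: power_mult[symmetric] mult.commute)
    also have "\<dots> \<le> (a m)\<^sup>2" by (rule power_mono) (use Suc in \<open>auto simp: a_def\<close>)
    finally show ?case using square[of m] by linarith
  qed simp
  have Npow: "N (s [^] Suc k) \<le> (N s) ^ Suc k" for k
  proof (induction k)
    case (Suc k)
    have "N (s [^] Suc (Suc k)) \<le> N (s [^] Suc k) * N s"
      using N_mult[of "s [^] Suc k" s] s by simp
    also have "\<dots> \<le> (N s) ^ Suc k * N s" by (intro mult_right_mono Suc N_nonneg s)
    finally show ?case by (simp add: mult_ac)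
  qed (use s in simp)
  have bound: "a m \<le> N (star A y) * N y * N s ^ (2 ^ m)" for m
  proof -
    obtain k where k: "(2::nat) ^ m = Suc k" using not0_implies_Suc[of "2 ^ m"] by auto
    have "a m \<le> N (star A y \<otimes> (s [^] Suc k \<otimes> y))"
      unfolding a_def k using assms s by (intro form_bound) auto
    also have "\<dots> \<le> N (star A y) * N (s [^] Suc k \<otimes> y)" using assms s by (intro N_mult) auto
    also have "\<dots> \<le> N (star A y) * (N (s [^] Suc k) * N y)"
      using assms s by (intro mult_left_mono N_mult N_nonneg) auto
    also have "\<dots> \<le> N (star A y) * (N s ^ Suc k * N y)"
      using assms s by (intro mult_left_mono mult_right_mono Npow N_nonneg) auto
    finally show ?thesis by (simp add: k mult_ac)
  qed
  have "a 0 \<le> N s"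
  proof (rule power_bound_imp_le)
    show "a 0 ^ (2 ^ m) \<le> N (star A y) * N y * N s ^ (2 ^ m)" for m
      using pow[of m] bound[of m] by linarith
  qed (use N_nonneg[OF s(1)] in \<open>auto simp: a_def\<close>)
  also have "\<dots> \<le> (N x)\<^sup>2"
    using N_mult[of "star A x" x] N_star[of x] assms by (simp add: s_def power2_eq_square)
  finally have "a 0 \<le> (N x)\<^sup>2" .
  moreover have "star A (x \<otimes> y) \<otimes> (x \<otimes> y) = star A y \<otimes> (s [^] ((2::nat) ^ 0) \<otimes> y)"
    using assms by (simp add: s_def star_mult m_assoc)
  ultimately show ?thesis
    using complex_Re_le_cmod[of "\<phi> (star A y \<otimes> (s [^] ((2::nat) ^ 0) \<otimes> y))"] by (simp add: a_def)
qed

lemma gns_bdd: "x \<in> carrier A \<Longrightarrow>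
    bdd_above ((\<lambda>(\<phi>, y). sqrt (Re (\<phi> (star A (x \<otimes> y) \<otimes> (x \<otimes> y))))) ` unit_vectors)"
  by (rule bdd_aboveI2[where M = "N x"])
    (use form_le_N N_nonneg in \<open>auto simp: unit_vectors_def intro!: real_le_lsqrt form_nonneg forms\<close>)

lemma gns_upper:
  assumes "x \<in> carrier A" "\<phi> \<in> \<Phi>" "y \<in> carrier A" "\<phi> (star A y \<otimes> y) = 1"
  shows "sqrt (Re (\<phi> (star A (x \<otimes> y) \<otimes> (x \<otimes> y)))) \<le> gns_norm x"
proof -
  have "(\<phi>, y) \<in> unit_vectors" using assms by (simp add: unit_vectors_def)
  from cSUP_upper[OF this gns_bdd[OF assms(1)]] show ?thesis by (simp add: gns_norm_def)
qed

lemma gns_least: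
  assumes "\<And>\<phi> y. \<phi> \<in> \<Phi> \<Longrightarrow> y \<in> carrier A \<Longrightarrow> \<phi> (star A y \<otimes> y) = 1 \<Longrightarrow>
    sqrt (Re (\<phi> (star A (x \<otimes> y) \<otimes> (x \<otimes> y)))) \<le> c"
  shows "gns_norm x \<le> c"
  unfolding gns_norm_def
  by (rule cSUP_least[OF unit_vectors_nonempty]) (use assms in \<open>auto simp: unit_vectors_def\<close>)

lemma gns_nonneg: "x \<in> carrier A \<Longrightarrow> 0 \<le> gns_norm x"
proof -
  assume x: "x \<in> carrier A"
  obtain \<phi> y where *: "\<phi> \<in> \<Phi>" "y \<in> carrier A" "\<phi> (star A y \<otimes> y) = 1"
    using unit_vectors_nonempty by (auto simp: unit_vectors_def)
  have "0 \<le> sqrt (Re (\<phi> (star A (x \<otimes> y) \<otimes> (x \<otimes> y))))"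
    using form_nonneg[OF forms[OF *(1)]] * x by simp
  then show ?thesis using gns_upper[OF x *] by linarith
qed

lemma gns_ineq:
  assumes "\<phi> \<in> \<Phi>" "x \<in> carrier A" "z \<in> carrier A"
  shows "sqrt (Re (\<phi> (star A (x \<otimes> z) \<otimes> (x \<otimes> z)))) \<le> gns_norm x * sqrt (Re (\<phi> (star A z \<otimes> z)))"
proof (cases "Re (\<phi> (star A z \<otimes> z)) = 0")
  case True
  note \<phi> = forms[OF assms(1)]
  \<comment> \<open>A null vector cannot be normalized; the Cauchy-Schwarz inequality shows that
    left multiplication keeps it null.\<close>
  have "star A (x \<otimes> z) \<otimes> (x \<otimes> z) = star A z \<otimes> (star A x \<otimes> (x \<otimes> z))"
    using assms by (simp add: star_mult m_assoc)
  then have "cmod (\<phi> (star A (x \<otimes> z) \<otimes> (x \<otimes> z))) \<le> 0"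
    using cauchy_schwarz_sqrt[OF \<phi>, of z "star A x \<otimes> (x \<otimes> z)"] True assms by simp
  then show ?thesis using True by simp
next
  case False
  note \<phi> = forms[OF assms(1)]
  define r where "r = sqrt (Re (\<phi> (star A z \<otimes> z)))"
  have r: "r > 0" using False form_nonneg[OF \<phi> assms(3)] by (simp add: r_def)
  define y where "y = complex_of_real (1 / r) \<odot> z"
  have y: "y \<in> carrier A" using assms by (simp add: y_def)
  have scale: "\<phi> (star A (c \<odot> a) \<otimes> (c \<odot> a)) = cnj c * c * \<phi> (star A a \<otimes> a)" if "a \<in> carrier A" for c a
    using that by (simp add: star_smult smult_mult_left smult_mult_right smult_smult positive_formD[OF \<phi>])
  have "\<phi> (star A z \<otimes> z) = complex_of_real (r * r)"
    using form_real[OF \<phi> assms(3)] form_nonneg[OF \<phi> assms(3)] by (simp add: r_def)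
  then have "\<phi> (star A y \<otimes> y) = 1"
    using r assms by (simp add: y_def scale)
  from gns_upper[OF assms(2,1) y this]
  have "sqrt (Re (\<phi> (star A (x \<otimes> y) \<otimes> (x \<otimes> y)))) \<le> gns_norm x" .
  moreover have "x \<otimes> y = complex_of_real (1 / r) \<odot> (x \<otimes> z)"
    using assms by (simp add: y_def smult_mult_right)
  ultimately have "sqrt (Re (complex_of_real (1 / r * (1 / r)) * \<phi> (star A (x \<otimes> z) \<otimes> (x \<otimes> z)))) \<le> gns_norm x"
    using assms by (simp add: scale)
  then show ?thesis
    using r by (simp add: r_def[symmetric] real_sqrt_divide real_sqrt_mult field_simps)
qed

text \<open>The substance of the C*-identity is \<open>square_le\<close>, the Cauchy-Schwarz
  inequality for \<open>y\<close> and \<open>star A a \<otimes> a \<otimes> y\<close>. Together with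
  submultiplicativity it yields the isometry of the involution and then the other half.\<close>

lemma cstar_seminorm_gns: "cstar_seminorm A gns_norm"
proof -
  have triangle: "gns_norm (a \<oplus> b) \<le> gns_norm a + gns_norm b" if "a \<in> carrier A" "b \<in> carrier A" for a b
  proof (rule gns_least)
    fix \<phi> y assume *: "\<phi> \<in> \<Phi>" "y \<in> carrier A" "\<phi> (star A y \<otimes> y) = 1"
    have "sqrt (Re (\<phi> (star A ((a \<oplus> b) \<otimes> y) \<otimes> ((a \<oplus> b) \<otimes> y)))) \<le>
        sqrt (Re (\<phi> (star A (a \<otimes> y) \<otimes> (a \<otimes> y)))) + sqrt (Re (\<phi> (star A (b \<otimes> y) \<otimes> (b \<otimes> y))))"
      using form_norm_triangle[OF forms[OF *(1)], of "a \<otimes> y" "b \<otimes> y"] * that by (simp add: l_distr)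
    then show "sqrt (Re (\<phi> (star A ((a \<oplus> b) \<otimes> y) \<otimes> ((a \<oplus> b) \<otimes> y)))) \<le> gns_norm a + gns_norm b"
      using gns_upper[OF that(1) *] gns_upper[OF that(2) *] by linarith
  qed
  have scale_le: "gns_norm (c \<odot> a) \<le> cmod c * gns_norm a" if "a \<in> carrier A" for c a
  proof (rule gns_least)
    fix \<phi> y assume *: "\<phi> \<in> \<Phi>" "y \<in> carrier A" "\<phi> (star A y \<otimes> y) = 1"
    have "\<phi> (star A ((c \<odot> a) \<otimes> y) \<otimes> ((c \<odot> a) \<otimes> y)) =
        complex_of_real ((cmod c)\<^sup>2) * \<phi> (star A (a \<otimes> y) \<otimes> (a \<otimes> y))"
      using * that complex_norm_square[of c]
      by (simp add: star_smult smult_mult_left smult_mult_right smult_smult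
          positive_formD[OF forms[OF *(1)]] mult_ac)
    then have "sqrt (Re (\<phi> (star A ((c \<odot> a) \<otimes> y) \<otimes> ((c \<odot> a) \<otimes> y)))) =
        cmod c * sqrt (Re (\<phi> (star A (a \<otimes> y) \<otimes> (a \<otimes> y))))"
      by (simp add: real_sqrt_mult del: of_real_power)
    then show "sqrt (Re (\<phi> (star A ((c \<odot> a) \<otimes> y) \<otimes> ((c \<odot> a) \<otimes> y)))) \<le> cmod c * gns_norm a"
      using gns_upper[OF that *] by (simp add: mult_left_mono)
  qed
  have scale: "gns_norm (c \<odot> a) = cmod c * gns_norm a" if "a \<in> carrier A" for c a
  proof (cases "c = 0")
    case True
    then show ?thesis using scale_le[OF that, of 0] gns_nonneg[of "0 \<odot> a"] that by simp
  next
    case False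
    have "gns_norm a \<le> cmod (inverse c) * gns_norm (c \<odot> a)"
      using scale_le[of "c \<odot> a" "inverse c"] that False by (simp add: smult_smult)
    then have "cmod c * gns_norm a \<le> gns_norm (c \<odot> a)"
      using False by (simp add: norm_inverse norm_divide field_simps)
    then show ?thesis using scale_le[OF that] by (simp add: antisym)
  qed
  have mult: "gns_norm (a \<otimes> b) \<le> gns_norm a * gns_norm b" if "a \<in> carrier A" "b \<in> carrier A" for a b
  proof (rule gns_least)
    fix \<phi> y assume *: "\<phi> \<in> \<Phi>" "y \<in> carrier A" "\<phi> (star A y \<otimes> y) = 1"
    have "sqrt (Re (\<phi> (star A (a \<otimes> (b \<otimes> y)) \<otimes> (a \<otimes> (b \<otimes> y))))) \<le>
        gns_norm a * sqrt (Re (\<phi> (star A (b \<otimes> y) \<otimes> (b \<otimes> y))))"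
      using gns_ineq[OF *(1), of a "b \<otimes> y"] * that by simp
    also have "\<dots> \<le> gns_norm a * gns_norm b"
      by (intro mult_left_mono gns_upper gns_nonneg * that)
    finally show "sqrt (Re (\<phi> (star A (a \<otimes> b \<otimes> y) \<otimes> (a \<otimes> b \<otimes> y)))) \<le> gns_norm a * gns_norm b"
      using * that by (simp add: m_assoc)
  qed
  have square_le: "(gns_norm a)\<^sup>2 \<le> gns_norm (star A a \<otimes> a)" if "a \<in> carrier A" for a
  proof -
    have "gns_norm a \<le> sqrt (gns_norm (star A a \<otimes> a))"
    proof (rule gns_least)
      fix \<phi> y assume *: "\<phi> \<in> \<Phi>" "y \<in> carrier A" "\<phi> (star A y \<otimes> y) = 1"
      have "Re (\<phi> (star A (a \<otimes> y) \<otimes> (a \<otimes> y))) \<le> cmod (\<phi> (star A y \<otimes> (star A a \<otimes> a \<otimes> y)))"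
        using * that complex_Re_le_cmod by (simp add: star_mult m_assoc)
      also have "\<dots> \<le> sqrt (Re (\<phi> (star A (star A a \<otimes> a \<otimes> y) \<otimes> (star A a \<otimes> a \<otimes> y))))"
        using cauchy_schwarz_sqrt[OF forms[OF *(1)], of y "star A a \<otimes> a \<otimes> y"] * that by simp
      also have "\<dots> \<le> gns_norm (star A a \<otimes> a)" by (rule gns_upper) (use * that in auto)
      finally show "sqrt (Re (\<phi> (star A (a \<otimes> y) \<otimes> (a \<otimes> y)))) \<le> sqrt (gns_norm (star A a \<otimes> a))"
        by (rule real_sqrt_le_mono)
    qed
    then show ?thesis using gns_nonneg[of a] gns_nonneg[of "star A a \<otimes> a"] that
      by (metis m_closed power_mono real_sqrt_pow2 star_closed)
  qed
  have star_le: "gns_norm a \<le> gns_norm (star A a)" if "a \<in> carrier A" for a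
  proof (cases "gns_norm a = 0")
    case False
    have "gns_norm a * gns_norm a \<le> gns_norm (star A a) * gns_norm a"
      using square_le[OF that] mult[of "star A a" a] that by (simp add: power2_eq_square)
    then show ?thesis using False gns_nonneg[OF that] by (simp add: mult_le_cancel_right)
  qed (use gns_nonneg[of "star A a"] that in simp)
  have "gns_norm (star A a \<otimes> a) = (gns_norm a)\<^sup>2" if "a \<in> carrier A" for a
  proof (rule antisym[OF _ square_le[OF that]])
    have "gns_norm (star A a) \<le> gns_norm a" using star_le[of "star A a"] that by simp
    then have "gns_norm (star A a) * gns_norm a \<le> gns_norm a * gns_norm a"
      by (intro mult_right_mono gns_nonneg that)
    then show "gns_norm (star A a \<otimes> a) \<le> (gns_norm a)\<^sup>2"
      using mult[of "star A a" a] that by (simp add: power2_eq_square)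
  qed
  then show ?thesis
    unfolding cstar_seminorm_def using gns_nonneg triangle scale mult by simp
qed

end

subsection \<open>Completion\<close>

context cstar_seminormed
begin

abbreviation Seqs where "Seqs \<equiv> cauchy_seqs A p"
abbreviation Rel where "Rel \<equiv> cauchy_rel A p"
abbreviation C where "C \<equiv> completion A p"
abbreviation cls where "cls x \<equiv> cauchy_rel A p `` {x}"

lemma seqs_closed: "x \<in> Seqs \<Longrightarrow> x m \<in> carrier A"
  by (simp add: cauchy_seqs_def)

lemma rel_iff: "(x, y) \<in> Rel \<longleftrightarrow> x \<in> Seqs \<and> y \<in> Seqs \<and> (\<lambda>m. p (x m \<ominus> y m)) \<longlonglongrightarrow> 0"
  by (simp add: cauchy_rel_def)

lemma const_seqs [simp]: "a \<in> carrier A \<Longrightarrow> (\<lambda>_. a) \<in> Seqs"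
  by (simp add: cauchy_seqs_def r_neg minus_eq)

lemma seqs_bounded:
  assumes "x \<in> Seqs"
  obtains B where "B > 0" "\<And>m. p (x m) \<le> B"
proof -
  obtain N where N: "\<And>m l. m \<ge> N \<Longrightarrow> l \<ge> N \<Longrightarrow> p (x m \<ominus> x l) < 1"
  proof -
    have "\<forall>e>0. \<exists>N. \<forall>m\<ge>N. \<forall>l\<ge>N. p (x m \<ominus> x l) < e"
      using assms by (simp add: cauchy_seqs_def)
    from this[rule_format, of 1] that show thesis by auto
  qed
  define K where "K = Max ((\<lambda>m. p (x m)) ` {..N})"
  have K: "p (x m) \<le> K" if "m \<le> N" for m
    unfolding K_def using that by (intro Max_ge) auto
  have "p (x m) \<le> K + 1" for m
  proof (cases "m \<le> N")
    case True
    then show ?thesis using K[of m] by linarith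
  next
    case False
    then have "p (x m \<ominus> x N) < 1" by (intro N) auto
    then show ?thesis
      using p_abs_diff[of "x m" "x N"] K[of N] assms by (simp add: seqs_closed)
  qed
  moreover have "0 \<le> p (x 0)" using assms by (simp add: seqs_closed)
  then have "K + 1 > 0" using K[of 0] by linarith
  ultimately show thesis using that by blast
qed

text \<open>One Lipschitz criterion for all operations. For products \<open>K\<close> bounds both
  sequences; for scalar multiples it is the modulus plus 1, so as to stay positive.\<close>

lemma seqsI:
  assumes "x \<in> Seqs" "y \<in> Seqs" "\<And>m. z m \<in> carrier A"
    and "\<And>m l. p (z m \<ominus> z l) \<le> K * (p (x m \<ominus> x l) + p (y m \<ominus> y l))" "K > 0"
  shows "z \<in> Seqs"
  unfolding cauchy_seqs_def
proof (intro CollectI conjI allI impI assms(3))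
  fix e :: real assume e: "e > 0"
  then have e2: "e / (2 * K) > 0" using assms(5) by simp
  obtain N1 where N1: "\<And>m l. m \<ge> N1 \<Longrightarrow> l \<ge> N1 \<Longrightarrow> p (x m \<ominus> x l) < e / (2 * K)"
    using assms(1) e2 unfolding cauchy_seqs_def by blast
  obtain N2 where N2: "\<And>m l. m \<ge> N2 \<Longrightarrow> l \<ge> N2 \<Longrightarrow> p (y m \<ominus> y l) < e / (2 * K)"
    using assms(2) e2 unfolding cauchy_seqs_def by blast
  have "p (z m \<ominus> z l) < e" if "m \<ge> max N1 N2" "l \<ge> max N1 N2" for m l
  proof -
    have "p (x m \<ominus> x l) + p (y m \<ominus> y l) < e / K" using N1[of m l] N2[of m l] that by simp
    then have "K * (p (x m \<ominus> x l) + p (y m \<ominus> y l)) < e" using assms(5) by (simp add: field_simps)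
    then show ?thesis using assms(4)[of m l] by linarith
  qed
  then show "\<exists>N. \<forall>m\<ge>N. \<forall>l\<ge>N. p (z m \<ominus> z l) < e" by blast
qed

lemma relI:
  assumes "(x, x') \<in> Rel" "(y, y') \<in> Rel" "z \<in> Seqs" "z' \<in> Seqs"
    and "\<And>m. p (z m \<ominus> z' m) \<le> K * (p (x m \<ominus> x' m) + p (y m \<ominus> y' m))"
  shows "(z, z') \<in> Rel"
proof -
  have "(\<lambda>m. K * (p (x m \<ominus> x' m) + p (y m \<ominus> y' m))) \<longlonglongrightarrow> K * (0 + 0)"
    using assms(1,2) unfolding rel_iff by (intro tendsto_intros) auto
  then have "(\<lambda>m. K * (p (x m \<ominus> x' m) + p (y m \<ominus> y' m))) \<longlonglongrightarrow> 0" by simp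
  then have "(\<lambda>m. p (z m \<ominus> z' m)) \<longlonglongrightarrow> 0"
  proof (rule tendsto_0_le[where K = 1], intro always_eventually allI)
    fix m
    have "\<bar>p (z m \<ominus> z' m)\<bar> = p (z m \<ominus> z' m)" using assms(3,4) by (simp add: seqs_closed)
    then show "norm (p (z m \<ominus> z' m)) \<le> norm (K * (p (x m \<ominus> x' m) + p (y m \<ominus> y' m))) * 1"
      using assms(5)[of m] by simp
  qed
  then show ?thesis using assms(3,4) by (simp add: rel_iff)
qed

lemma mult_diff_le:
  assumes "a \<in> carrier A" "b \<in> carrier A" "a' \<in> carrier A" "b' \<in> carrier A" "p a \<le> K" "p b' \<le> K"
  shows "p (a \<otimes> b \<ominus> a' \<otimes> b') \<le> K * (p (a \<ominus> a') + p (b \<ominus> b'))"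
proof -
  have "a \<otimes> b \<ominus> a' \<otimes> b' = a \<otimes> (b \<ominus> b') \<oplus> (a \<ominus> a') \<otimes> b'"
    using assms(1-4) by algebra
  then have "p (a \<otimes> b \<ominus> a' \<otimes> b') \<le> p (a \<otimes> (b \<ominus> b')) + p ((a \<ominus> a') \<otimes> b')"
    using assms(1-4) by (simp add: p_triangle)
  also have "\<dots> \<le> p a * p (b \<ominus> b') + p (a \<ominus> a') * p b'"
    using assms(1-4) by (intro add_mono p_mult) auto
  also have "\<dots> \<le> K * p (b \<ominus> b') + p (a \<ominus> a') * K"
    using assms by (intro add_mono mult_right_mono mult_left_mono) auto
  finally show ?thesis by (simp add: algebra_simps)
qed

lemma rel_refl: "x \<in> Seqs \<Longrightarrow> (x, x) \<in> Rel"
  by (simp add: rel_iff seqs_closed r_neg minus_eq)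

lemma rel_sym: "(x, y) \<in> Rel \<Longrightarrow> (y, x) \<in> Rel"
  by (simp add: rel_iff seqs_closed p_minus_commute)

lemma rel_trans:
  assumes "(x, y) \<in> Rel" "(y, z) \<in> Rel"
  shows "(x, z) \<in> Rel"
  by (rule relI[OF assms, of _ _ 1])
    (use assms in \<open>auto simp: rel_iff seqs_closed intro!: p_minus_triangle\<close>)

lemma equiv_rel: "equiv Seqs Rel"
proof (rule equivI)
  show "Rel \<subseteq> Seqs \<times> Seqs" by (auto simp: rel_iff)
  show "refl_on Seqs Rel" using rel_refl by (simp add: refl_on_def)
  show "sym Rel" using rel_sym by (rule symI)
  show "trans Rel" using rel_trans by (rule transI)
qed

lemma cls_eq_iff: "x \<in> Seqs \<Longrightarrow> y \<in> Seqs \<Longrightarrow> cls x = cls y \<longleftrightarrow> (x, y) \<in> Rel"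
  using eq_equiv_class_iff[OF equiv_rel] by blast

lemma cls_eqI: "(x, y) \<in> Rel \<Longrightarrow> cls x = cls y"
  by (rule equiv_class_eq[OF equiv_rel])

lemma carrier_C: "carrier C = Seqs // Rel"
  by (simp add: completion_def)

lemma cls_in_C [simp]: "x \<in> Seqs \<Longrightarrow> cls x \<in> carrier C"
  by (simp add: carrier_C quotientI)

lemma C_cases:
  assumes "X \<in> carrier C"
  obtains x where "x \<in> Seqs" "X = cls x"
  using assms by (auto simp: carrier_C elim: quotientE)

lemma
  assumes "x \<in> Seqs" "y \<in> Seqs"
  shows add_seqs [simp]: "(\<lambda>m. x m \<oplus> y m) \<in> Seqs"
    and mult_seqs [simp]: "(\<lambda>m. x m \<otimes> y m) \<in> Seqs"
proof -
  note closed = seqs_closed[OF assms(1)] seqs_closed[OF assms(2)]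
  show "(\<lambda>m. x m \<oplus> y m) \<in> Seqs"
  proof (rule seqsI[OF assms, of _ 1])
    fix m l
    have "(x m \<oplus> y m) \<ominus> (x l \<oplus> y l) = (x m \<ominus> x l) \<oplus> (y m \<ominus> y l)"
      using closed(1)[of m] closed(1)[of l] closed(2)[of m] closed(2)[of l] by algebra
    then show "p ((x m \<oplus> y m) \<ominus> (x l \<oplus> y l)) \<le> 1 * (p (x m \<ominus> x l) + p (y m \<ominus> y l))"
      using p_triangle[of "x m \<ominus> x l" "y m \<ominus> y l"] closed by simp
  qed (use closed in auto)
  obtain B where B: "B > 0" "\<And>m. p (x m) \<le> B" using seqs_bounded[OF assms(1)] by blast
  obtain B' where B': "B' > 0" "\<And>m. p (y m) \<le> B'" using seqs_bounded[OF assms(2)] by blast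
  show "(\<lambda>m. x m \<otimes> y m) \<in> Seqs"
  proof (rule seqsI[OF assms, of _ "max B B'"])
    fix m l
    show "p (x m \<otimes> y m \<ominus> x l \<otimes> y l) \<le> max B B' * (p (x m \<ominus> x l) + p (y m \<ominus> y l))"
      using B(2)[of m] B'(2)[of l] closed by (intro mult_diff_le) auto
  qed (use closed B in auto)
qed

lemma
  assumes "x \<in> Seqs"
  shows smult_seqs [simp]: "(\<lambda>m. c \<odot> x m) \<in> Seqs"
    and star_seqs [simp]: "(\<lambda>m. star A (x m)) \<in> Seqs"
proof -
  note closed = seqs_closed[OF assms]
  show "(\<lambda>m. c \<odot> x m) \<in> Seqs"
  proof (rule seqsI[OF assms(1,1), of _ "cmod c + 1"])
    fix m l
    show "p (c \<odot> x m \<ominus> c \<odot> x l) \<le> (cmod c + 1) * (p (x m \<ominus> x l) + p (x m \<ominus> x l))"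
      unfolding smult_minus[OF closed(1) closed(1), symmetric] p_smult[OF minus_closed[OF closed(1) closed(1)]]
      using closed by (intro mult_mono) auto
  qed (use closed in \<open>auto intro: add_nonneg_pos\<close>)
  show "(\<lambda>m. star A (x m)) \<in> Seqs"
  proof (rule seqsI[OF assms(1,1), of _ 1])
    fix m l
    show "p (star A (x m) \<ominus> star A (x l)) \<le> 1 * (p (x m \<ominus> x l) + p (x m \<ominus> x l))"
      unfolding star_minus[OF closed(1) closed(1), symmetric] using closed by simp
  qed (use closed in auto)
qed

lemma add_rel:
  assumes "(x, x') \<in> Rel" "(y, y') \<in> Rel"
  shows "(\<lambda>m. x m \<oplus> y m, \<lambda>m. x' m \<oplus> y' m) \<in> Rel"
proof -
  have seqs: "x \<in> Seqs" "x' \<in> Seqs" "y \<in> Seqs" "y' \<in> Seqs" using assms by (auto simp: rel_iff)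
  note closed = seqs[THEN seqs_closed]
  show ?thesis
  proof (rule relI[OF assms, of _ _ 1])
    fix m
    have "(x m \<oplus> y m) \<ominus> (x' m \<oplus> y' m) = (x m \<ominus> x' m) \<oplus> (y m \<ominus> y' m)"
      using closed[of m] by algebra
    then show "p ((x m \<oplus> y m) \<ominus> (x' m \<oplus> y' m)) \<le> 1 * (p (x m \<ominus> x' m) + p (y m \<ominus> y' m))"
      using p_triangle[of "x m \<ominus> x' m" "y m \<ominus> y' m"] closed by simp
  qed (use seqs in auto)
qed

lemma mult_rel:
  assumes "(x, x') \<in> Rel" "(y, y') \<in> Rel"
  shows "(\<lambda>m. x m \<otimes> y m, \<lambda>m. x' m \<otimes> y' m) \<in> Rel"
proof -
  have seqs: "x \<in> Seqs" "x' \<in> Seqs" "y \<in> Seqs" "y' \<in> Seqs" using assms by (auto simp: rel_iff)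
  note closed = seqs[THEN seqs_closed]
  obtain B where B: "B > 0" "\<And>m. p (x m) \<le> B" using seqs_bounded[OF seqs(1)] by blast
  obtain B' where B': "B' > 0" "\<And>m. p (y' m) \<le> B'" using seqs_bounded[OF seqs(4)] by blast
  show ?thesis
  proof (rule relI[OF assms, of _ _ "max B B'"])
    fix m
    show "p (x m \<otimes> y m \<ominus> x' m \<otimes> y' m) \<le> max B B' * (p (x m \<ominus> x' m) + p (y m \<ominus> y' m))"
      using B(2)[of m] B'(2)[of m] closed by (intro mult_diff_le) auto
  qed (use seqs in auto)
qed

lemma smult_rel:
  assumes "(x, x') \<in> Rel"
  shows "(\<lambda>m. c \<odot> x m, \<lambda>m. c \<odot> x' m) \<in> Rel"
proof -
  have seqs: "x \<in> Seqs" "x' \<in> Seqs" using assms by (auto simp: rel_iff)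
  note closed = seqs[THEN seqs_closed]
  show ?thesis
  proof (rule relI[OF assms assms, of _ _ "cmod c"])
    fix m
    show "p (c \<odot> x m \<ominus> c \<odot> x' m) \<le> cmod c * (p (x m \<ominus> x' m) + p (x m \<ominus> x' m))"
      unfolding smult_minus[OF closed, symmetric] p_smult[OF minus_closed[OF closed]]
      using closed by (intro mult_left_mono) auto
  qed (use seqs in auto)
qed

lemma star_rel:
  assumes "(x, x') \<in> Rel"
  shows "(\<lambda>m. star A (x m), \<lambda>m. star A (x' m)) \<in> Rel"
proof -
  have seqs: "x \<in> Seqs" "x' \<in> Seqs" using assms by (auto simp: rel_iff)
  note closed = seqs[THEN seqs_closed]
  show ?thesis
  proof (rule relI[OF assms assms, of _ _ 1])
    fix m
    show "p (star A (x m) \<ominus> star A (x' m)) \<le> 1 * (p (x m \<ominus> x' m) + p (x m \<ominus> x' m))"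
      unfolding star_minus[OF closed, symmetric] using closed by simp
  qed (use seqs in auto)
qed

lemma
  assumes "x \<in> Seqs" "y \<in> Seqs"
  shows C_add: "cls x \<oplus>\<^bsub>C\<^esub> cls y = cls (\<lambda>m. x m \<oplus> y m)"
    and C_mult: "cls x \<otimes>\<^bsub>C\<^esub> cls y = cls (\<lambda>m. x m \<otimes> y m)"
proof -
  have "(\<lambda>x y. cls (\<lambda>m. x m \<oplus> y m)) respects2 Rel"
    by (rule congruent2I') (intro cls_eqI add_rel)
  from UN_equiv_class2[OF equiv_rel equiv_rel this assms]
  show "cls x \<oplus>\<^bsub>C\<^esub> cls y = cls (\<lambda>m. x m \<oplus> y m)" by (simp add: completion_def)
  have "(\<lambda>x y. cls (\<lambda>m. x m \<otimes> y m)) respects2 Rel"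
    by (rule congruent2I') (intro cls_eqI mult_rel)
  from UN_equiv_class2[OF equiv_rel equiv_rel this assms]
  show "cls x \<otimes>\<^bsub>C\<^esub> cls y = cls (\<lambda>m. x m \<otimes> y m)" by (simp add: completion_def)
qed

lemma
  assumes "x \<in> Seqs"
  shows C_smult: "c \<odot>\<^bsub>C\<^esub> cls x = cls (\<lambda>m. c \<odot> x m)"
    and C_star: "star C (cls x) = cls (\<lambda>m. star A (x m))"
proof -
  have "(\<lambda>x. cls (\<lambda>m. c \<odot> x m)) respects Rel"
    by (rule congruentI) (intro cls_eqI smult_rel)
  from UN_equiv_class[OF equiv_rel this assms]
  show "c \<odot>\<^bsub>C\<^esub> cls x = cls (\<lambda>m. c \<odot> x m)" by (simp add: completion_def)
  have "(\<lambda>x. cls (\<lambda>m. star A (x m))) respects Rel"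
    by (rule congruentI) (intro cls_eqI star_rel)
  from UN_equiv_class[OF equiv_rel this assms]
  show "star C (cls x) = cls (\<lambda>m. star A (x m))" by (simp add: completion_def)
qed

lemma C_zero: "\<zero>\<^bsub>C\<^esub> = cls (\<lambda>_. \<zero>)" and C_one: "\<one>\<^bsub>C\<^esub> = cls (\<lambda>_. \<one>)"
  by (simp_all add: completion_def embed_def)

lemma star_alg_C: "star_alg C"
proof -
  note ops = C_add C_mult C_smult C_star C_zero C_one
  note closed = seqs_closed
  have "ring C"
  proof (intro ringI abelian_groupI monoidI)
    fix X assume "X \<in> carrier C"
    then obtain x where x: "x \<in> Seqs" "X = cls x" by (rule C_cases)
    show "\<exists>Y\<in>carrier C. Y \<oplus>\<^bsub>C\<^esub> X = \<zero>\<^bsub>C\<^esub>"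
    proof (rule bexI[of _ "cls (\<lambda>m. (-1) \<odot> x m)"])
      have "(-1) \<odot> x m \<oplus> x m = \<zero>" for m
        using closed[OF x(1), of m] by (simp add: a_inv_eq_smult[symmetric] l_neg)
      then show "cls (\<lambda>m. (-1) \<odot> x m) \<oplus>\<^bsub>C\<^esub> X = \<zero>\<^bsub>C\<^esub>" using x by (simp add: ops)
    qed (use x in simp)
  qed (auto elim!: C_cases simp: ops closed a_ac m_assoc l_distr r_distr)
  then interpret C: ring C .
  show ?thesis
    by unfold_locales
      (auto elim!: C_cases simp: ops closed smult_l_distr smult_r_distr smult_smult smult_mult_left
        smult_mult_right star_add star_smult star_mult)
qed

text \<open>The seminorms along a Cauchy sequence converge and equivalent sequences share the limit,
  so the definite description in \<open>completion\<close> denotes.\<close>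

lemma cnorm_C:
  assumes x: "x \<in> Seqs"
  shows "(\<lambda>m. p (x m)) \<longlonglongrightarrow> cnorm C (cls x)"
proof -
  have "Cauchy (\<lambda>m. p (x m))"
    unfolding Cauchy_def
  proof (intro allI impI)
    fix e :: real assume "e > 0"
    then obtain N where N: "\<And>m l. m \<ge> N \<Longrightarrow> l \<ge> N \<Longrightarrow> p (x m \<ominus> x l) < e"
      using x unfolding cauchy_seqs_def by blast
    have "dist (p (x m)) (p (x l)) < e" if "m \<ge> N" "l \<ge> N" for m l
      using N[OF that] p_abs_diff[of "x m" "x l"] x by (simp add: dist_real_def seqs_closed)
    then show "\<exists>N. \<forall>m\<ge>N. \<forall>n\<ge>N. dist (p (x m)) (p (x n)) < e" by blast
  qed
  then obtain r where r: "(\<lambda>m. p (x m)) \<longlonglongrightarrow> r"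
    using Cauchy_convergent convergent_def by blast
  have same: "(\<lambda>m. p (y m)) \<longlonglongrightarrow> r" if "y \<in> cls x" for y
  proof -
    have xy: "(x, y) \<in> Rel" using that by simp
    have "(\<lambda>m. p (y m) - p (x m)) \<longlonglongrightarrow> 0"
    proof (rule tendsto_0_le[where K = 1])
      show "(\<lambda>m. p (x m \<ominus> y m)) \<longlonglongrightarrow> 0" using xy by (simp add: rel_iff)
      show "\<forall>\<^sub>F m in sequentially. norm (p (y m) - p (x m)) \<le> norm (p (x m \<ominus> y m)) * 1"
        using xy p_abs_diff by (simp add: rel_iff seqs_closed abs_minus_commute)
    qed
    from tendsto_add[OF this r] show ?thesis by simp
  qed
  have "(THE r. \<exists>y\<in>cls x. (\<lambda>m. p (y m)) \<longlonglongrightarrow> r) = r"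
  proof (rule the_equality)
    show "\<exists>y\<in>cls x. (\<lambda>m. p (y m)) \<longlonglongrightarrow> r" using r rel_refl[OF x] by blast
    show "r' = r" if "\<exists>y\<in>cls x. (\<lambda>m. p (y m)) \<longlonglongrightarrow> r'" for r'
      using that same LIMSEQ_unique by blast
  qed
  then show ?thesis using r by (simp add: completion_def)
qed

lemma cstar_seminorm_C: "cstar_seminorm C (cnorm C)"
proof -
  note closed = seqs_closed
  have nonneg: "cnorm C (cls x) \<ge> 0" if "x \<in> Seqs" for x
    by (rule LIMSEQ_le_const[OF cnorm_C[OF that]]) (use that closed in auto)
  have triangle: "cnorm C (cls x \<oplus>\<^bsub>C\<^esub> cls y) \<le> cnorm C (cls x) + cnorm C (cls y)"
    if "x \<in> Seqs" "y \<in> Seqs" for x y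
    unfolding C_add[OF that]
    by (rule LIMSEQ_le[OF cnorm_C tendsto_add[OF cnorm_C cnorm_C]])
      (use that closed p_triangle in auto)
  have scale: "cnorm C (c \<odot>\<^bsub>C\<^esub> cls x) = cmod c * cnorm C (cls x)" if "x \<in> Seqs" for c x
  proof -
    have "(\<lambda>m. p (c \<odot> x m)) \<longlonglongrightarrow> cmod c * cnorm C (cls x)"
      using tendsto_mult[OF tendsto_const cnorm_C[OF that], of "cmod c"] that
      by (simp add: p_smult closed)
    then show ?thesis
      using cnorm_C[OF smult_seqs[OF that]] LIMSEQ_unique C_smult[OF that] by metis
  qed
  have mult: "cnorm C (cls x \<otimes>\<^bsub>C\<^esub> cls y) \<le> cnorm C (cls x) * cnorm C (cls y)"
    if "x \<in> Seqs" "y \<in> Seqs" for x y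
    unfolding C_mult[OF that]
    by (rule LIMSEQ_le[OF cnorm_C tendsto_mult[OF cnorm_C cnorm_C]])
      (use that closed p_mult in auto)
  have square: "cnorm C (star C (cls x) \<otimes>\<^bsub>C\<^esub> cls x) = (cnorm C (cls x))\<^sup>2" if "x \<in> Seqs" for x
  proof -
    have "(\<lambda>m. p (star A (x m) \<otimes> x m)) \<longlonglongrightarrow> (cnorm C (cls x))\<^sup>2"
      using tendsto_power[OF cnorm_C[OF that], of 2] that by (simp add: p_cstar closed)
    moreover have "star C (cls x) \<otimes>\<^bsub>C\<^esub> cls x = cls (\<lambda>m. star A (x m) \<otimes> x m)"
      using that by (simp add: C_star C_mult)
    moreover have "(\<lambda>m. star A (x m) \<otimes> x m) \<in> Seqs" using that by simp
    ultimately show ?thesis using cnorm_C LIMSEQ_unique by metis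
  qed
  show ?thesis
    unfolding cstar_seminorm_def using nonneg triangle scale mult square by (auto elim!: C_cases)
qed

lemma cstar_seminormed_C: "cstar_seminormed C (cnorm C)"
  using star_alg_C cstar_seminorm_C by (simp add: cstar_seminormed_def cstar_seminormed_axioms_def)

lemma embed_eq_cls: "embed A p a = cls (\<lambda>_. a)"
  by (simp add: embed_def)

lemma
  assumes "a \<in> carrier A"
  shows embed_closed [simp]: "embed A p a \<in> carrier C"
    and embed_smult: "embed A p (c \<odot> a) = c \<odot>\<^bsub>C\<^esub> embed A p a"
    and embed_star: "embed A p (star A a) = star C (embed A p a)"
    and cnorm_embed: "cnorm C (embed A p a) = p a"
proof -
  have "(\<lambda>_. p a) \<longlonglongrightarrow> cnorm C (embed A p a)"
    using cnorm_C[of "\<lambda>_. a"] assms by (simp add: embed_eq_cls)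
  then show "cnorm C (embed A p a) = p a" using LIMSEQ_unique tendsto_const by blast
qed (use assms in \<open>simp_all add: embed_eq_cls C_smult C_star\<close>)

lemma
  assumes "a \<in> carrier A" "b \<in> carrier A"
  shows embed_add: "embed A p (a \<oplus> b) = embed A p a \<oplus>\<^bsub>C\<^esub> embed A p b"
    and embed_mult: "embed A p (a \<otimes> b) = embed A p a \<otimes>\<^bsub>C\<^esub> embed A p b"
    and embed_eq_iff: "embed A p a = embed A p b \<longleftrightarrow> p (a \<ominus> b) = 0"
  using assms by (simp_all add: embed_eq_cls C_add C_mult cls_eq_iff rel_iff LIMSEQ_const_iff)

lemma embed_zero: "embed A p \<zero> = \<zero>\<^bsub>C\<^esub>" and embed_one: "embed A p \<one> = \<one>\<^bsub>C\<^esub>"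
  by (simp_all add: embed_eq_cls C_zero C_one)

end

subsection \<open>Sums of squares of self-adjoint elements\<close>

text \<open>The seminorm induced on polynomials by evaluation at a self-adjoint element. The last axiom is what
  remains of the C*-identity for \<open>f + \<i> g\<close>.\<close>

locale real_poly_seminorm =
  fixes Q :: "real poly \<Rightarrow> real"
  assumes Q_nonneg: "0 \<le> Q f"
    and Q_add: "Q (f + g) \<le> Q f + Q g"
    and Q_smult: "Q (smult c f) = \<bar>c\<bar> * Q f"
    and Q_mult: "Q (f * g) \<le> Q f * Q g"
    and Q_one: "Q 1 \<le> 1"
    and Q_square: "(Q f)\<^sup>2 \<le> Q (f * f + g * g)"
begin

lemma Q_zero: "Q 0 = 0"
  using Q_smult[of 0 0] by simp

lemma Q_uminus: "Q (- f) = Q f"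
  using Q_smult[of "-1" f] by simp

fun sqrt_iter :: "real poly \<Rightarrow> nat \<Rightarrow> real poly" where
  "sqrt_iter f 0 = 0"
| "sqrt_iter f (Suc m) = smult (1 / 2) (f + sqrt_iter f m * sqrt_iter f m)"

text \<open>The iteration \<open>y := (f + y\<^sup>2) / 2\<close> converges to \<open>1 - sqrt (1 - f)\<close>; since it only involves
  nonnegative coefficients it is dominated by the same iteration for the number \<open>f = 1\<close>.\<close>

lemma approx_sqrt:
  assumes "Q f \<le> 1" "e > 0"
  shows "\<exists>q. Q (1 - f - q * q) < e"
proof -
  \<comment> \<open>This scalar sequence increases and is bounded by 1, so its increments tend to 0;
    this is the whole source of convergence.\<close>
  define r where "r = rec_nat (0::real) (\<lambda>_ r. (1 + r\<^sup>2) / 2)"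
  have r: "r 0 = 0" "r (Suc m) = (1 + (r m)\<^sup>2) / 2" for m by (simp_all add: r_def)
  have r01: "0 \<le> r m \<and> r m \<le> 1" for m
    by (induction m) (auto simp: r power_le_one)
  have mono: "r m \<le> r (Suc m)" for m
    using zero_le_power2[of "r m - 1"] by (simp add: r power2_diff)
  let ?y = "sqrt_iter f"
  have y: "Q (?y m) \<le> r m" for m
  proof (induction m)
    case (Suc m)
    have "Q (f + ?y m * ?y m) \<le> Q f + Q (?y m) * Q (?y m)"
      using Q_add[of f "?y m * ?y m"] Q_mult[of "?y m" "?y m"] by linarith
    also have "\<dots> \<le> 1 + r m * r m"
      by (intro add_mono assms(1) mult_mono Suc Q_nonneg) (use r01 in auto)
    finally show ?case by (simp add: Q_smult r power2_eq_square)
  qed (simp add: r Q_zero)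
  have dy: "Q (?y (Suc m) - ?y m) \<le> r (Suc m) - r m" for m
  proof (induction m)
    case 0
    show ?case using assms(1) by (simp add: Q_smult r)
  next
    case (Suc m)
    \<comment> \<open>A difference of squares factors, and for \<open>r\<close> the corresponding
      factorization is an equality.\<close>
    have "?y (Suc (Suc m)) - ?y (Suc m) = smult (1 / 2) ((?y (Suc m) - ?y m) * (?y (Suc m) + ?y m))"
      by (simp only: sqrt_iter.simps(2)[of f "Suc m"] sqrt_iter.simps(2)[of f m, symmetric] flip: smult_diff_right)
        (simp add: algebra_simps smult_diff_right smult_add_right)
    then have "Q (?y (Suc (Suc m)) - ?y (Suc m)) \<le> (Q (?y (Suc m) - ?y m) * Q (?y (Suc m) + ?y m)) / 2"
      using Q_mult[of "?y (Suc m) - ?y m" "?y (Suc m) + ?y m"] by (simp add: Q_smult del: sqrt_iter.simps)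
    also have "\<dots> \<le> ((r (Suc m) - r m) * (r (Suc m) + r m)) / 2"
    proof (intro divide_right_mono mult_mono Suc)
      show "Q (?y (Suc m) + ?y m) \<le> r (Suc m) + r m"
        using Q_add[of "?y (Suc m)" "?y m"] y[of "Suc m"] y[of m] by linarith
    qed (use mono Q_nonneg in auto)
    also have "\<dots> = r (Suc (Suc m)) - r (Suc m)"
      unfolding r(2)[of "Suc m"] r(2)[of m] by (simp add: field_simps power2_eq_square)
    finally show ?case .
  qed
  have "convergent r"
    by (rule Bseq_mono_convergent[OF BseqI'[of _ 1]])
      (use r01 mono in \<open>auto intro: lift_Suc_mono_le\<close>)
  then obtain L where L: "r \<longlonglongrightarrow> L" by (auto simp: convergent_def)
  have "(\<lambda>m. 2 * (r (Suc m) - r m)) \<longlonglongrightarrow> 2 * (L - L)"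
    using L LIMSEQ_Suc[OF L] by (intro tendsto_intros)
  then have "eventually (\<lambda>m. 2 * (r (Suc m) - r m) < e) sequentially"
    using assms(2) by (intro order_tendstoD) auto
  then obtain m where m: "2 * (r (Suc m) - r m) < e" by (auto simp: eventually_sequentially)
  have "smult 2 (?y (Suc m)) = f + ?y m * ?y m" by simp
  moreover have "smult 2 (?y m) = ?y m + ?y m" by (metis one_add_one smult_1_left smult_add_left)
  ultimately have "smult 2 (?y m - ?y (Suc m)) = ?y m + ?y m - (f + ?y m * ?y m)"
    unfolding smult_diff_right by simp
  \<comment> \<open>The defect of \<open>1 - ?y m\<close> as a square root of \<open>1 - f\<close>
    is exactly twice an increment of the iteration, up to sign.\<close>
  then have "1 - f - (1 - ?y m) * (1 - ?y m) = smult 2 (?y m - ?y (Suc m))"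
    by (simp add: algebra_simps del: sqrt_iter.simps)
  then have "Q (1 - f - (1 - ?y m) * (1 - ?y m)) = 2 * Q (?y (Suc m) - ?y m)"
    using Q_uminus[of "?y (Suc m) - ?y m"] by (simp add: Q_smult del: sqrt_iter.simps)
  also have "\<dots> \<le> 2 * (r (Suc m) - r m)" by (intro mult_left_mono dy) simp
  finally show ?thesis using m by (meson le_less_trans)
qed

text \<open>Take \<open>q\<close> with q^2 close to 1 - f^2. Then f^2 + q^2 is close to 1, so
  \<open>Q_square\<close> bounds \<open>Q q\<close> by almost 1 and thereby q^2. This replaces the
  spectral fact that 1 - f^2 lies between 0 and 1.\<close>

lemma Q_one_minus_square:
  assumes "Q f \<le> 1"
  shows "Q (1 - f * f) \<le> 1"
proof (rule field_le_epsilon)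
  fix e :: real assume e: "e > 0"
  have "Q (f * f) \<le> 1" using Q_mult[of f f] assms Q_nonneg[of f] mult_le_one[of "Q f" "Q f"] by linarith
  then obtain q where q: "Q (1 - f * f - q * q) < e / 2" using approx_sqrt e by (meson half_gt_zero)
  have "Q (q * q + f * f) \<le> Q 1 + Q (- (1 - f * f - q * q))"
    using Q_add[of 1 "- (1 - f * f - q * q)"] by (simp add: algebra_simps)
  then have "(Q q)\<^sup>2 \<le> 1 + e / 2"
    using Q_square[of q f] Q_one q by (simp add: Q_uminus del: minus_diff_eq)
  moreover have "Q (1 - f * f) \<le> Q (1 - f * f - q * q) + Q q * Q q"
    using Q_add[of "1 - f * f - q * q" "q * q"] Q_mult[of q q] by simp
  ultimately show "Q (1 - f * f) \<le> 1 + e" using q by (simp add: power2_eq_square)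
qed

text \<open>The hypothesis expresses positivity of 1 - f^2 by norms. It provides an approximate
  square root \<open>q'\<close> of 1 - f^2, so f^2 + q'^2 is close to 1 and \<open>Q_square\<close>
  applies.\<close>

lemma Q_le_one:
  assumes "c > 0" "Q ([:c:] - (1 - f * f)) \<le> c"
  shows "Q f \<le> 1"
proof -
  have "(Q f)\<^sup>2 \<le> 1"
  proof (rule field_le_epsilon)
    fix e :: real assume e: "e > 0"
    \<comment> \<open>Chosen so that 1 - g is 1 - f^2 divided by \<open>c\<close>, to which
      \<open>approx_sqrt\<close> applies.\<close>
    define g where "g = smult (1 / c) ([:c:] - (1 - f * f))"
    have "Q g \<le> 1" using assms by (simp add: g_def Q_smult)
    then obtain q where q: "Q (1 - g - q * q) < e / c" using approx_sqrt e assms(1) by (meson divide_pos_pos)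
    define q' where "q' = smult (sqrt c) q"
    have s: "smult c g = [:c:] - (1 - f * f)" "smult c (q * q) = q' * q'" "smult c 1 = [:c:]"
      using assms(1) by (simp_all add: g_def q'_def one_pCons)
    have "smult (- c) (1 - g - q * q) = - (smult c 1 - smult c g - smult c (q * q))"
      by (simp only: smult_minus_left smult_diff_right)
    also have "\<dots> = f * f + q' * q' - 1" unfolding s by simp
    finally have eq: "f * f + q' * q' = 1 + smult (- c) (1 - g - q * q)" by (simp only: add_diff_eq diff_add_cancel add_diff_cancel_left')
    have "Q (f * f + q' * q') \<le> Q 1 + Q (smult (- c) (1 - g - q * q))"
      unfolding eq by (rule Q_add)
    also have "\<dots> \<le> 1 + e"
    proof -
      have "c * Q (1 - g - q * q) < e"
        using q assms(1) by (simp only: pos_less_divide_eq mult.commute)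
      then show ?thesis using assms(1) Q_one unfolding Q_smult by simp
    qed
    finally show "(Q f)\<^sup>2 \<le> 1 + e" using Q_square[of f q'] by linarith
  qed
  then show ?thesis using abs_le_square_iff[of "Q f" 1] by simp
qed

end

section \<open>Evaluation of real polynomials at an element\<close>

context star_alg
begin

definition ev :: "'a \<Rightarrow> real poly \<Rightarrow> 'a" where
  "ev x f = fold_coeffs (\<lambda>c r. complex_of_real c \<odot> \<one> \<oplus> x \<otimes> r) f \<zero>"

lemma ev_0 [simp]: "ev x 0 = \<zero>"
  by (simp add: ev_def)

context
  fixes x assumes x [simp]: "x \<in> carrier A"
begin

lemma ev_pCons: "ev x (pCons c f) = complex_of_real c \<odot> \<one> \<oplus> x \<otimes> ev x f"
  by (cases "c = 0 \<and> f = 0") (auto simp: ev_def)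

lemma ev_closed [simp]: "ev x f \<in> carrier A"
  by (induction f) (simp_all add: ev_pCons)

lemma ev_add: "ev x (f + g) = ev x f \<oplus> ev x g"
proof (induction f g rule: poly_induct2)
  case (pCons a f b g)
  then show ?case by (simp add: ev_pCons smult_l_distr r_distr a_ac)
qed simp

lemma ev_smult: "ev x (smult c f) = complex_of_real c \<odot> ev x f"
  by (induction f) (simp_all add: ev_pCons smult_r_distr smult_smult smult_mult_right)

lemma ev_mult: "ev x (f * g) = ev x f \<otimes> ev x g"
  by (induction f) (simp_all add: ev_pCons ev_add ev_smult l_distr smult_mult_left m_assoc)

lemma ev_one: "ev x 1 = \<one>"
  by (simp add: one_pCons ev_pCons)

lemma ev_const: "ev x [:c:] = complex_of_real c \<odot> \<one>"
  by (simp add: ev_pCons)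

lemma ev_X: "ev x [:0, 1:] = x"
  by (simp add: ev_pCons)

lemma ev_diff: "ev x (f - g) = ev x f \<ominus> ev x g"
  using ev_add[of f "smult (-1) g"] ev_smult[of "-1" g] by (simp add: minus_eq_smult)

lemma ev_commutes: "x \<otimes> ev x f = ev x f \<otimes> x"
  using ev_mult[of "[:0, 1:]" f] ev_mult[of f "[:0, 1:]"] by (simp add: ev_X mult.commute)

lemma star_ev: "star A x = x \<Longrightarrow> star A (ev x f) = ev x f"
  by (induction f) (simp_all add: ev_pCons star_add star_smult star_mult ev_commutes)

end

end

context cstar_seminormed
begin

text \<open>The C*-identity for w = x + \<i> y, whose mixed terms cancel by commutativity, combined
  with the fact that 2 x is the sum of w and its adjoint.\<close>

lemma p_square_le:
  assumes "x \<in> carrier A" "y \<in> carrier A" "star A x = x" "star A y = y" "x \<otimes> y = y \<otimes> x"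
  shows "(p x)\<^sup>2 \<le> p (x \<otimes> x \<oplus> y \<otimes> y)"
proof -
  define w where "w = x \<oplus> \<i> \<odot> y"
  have w: "w \<in> carrier A" using assms by (simp add: w_def)
  have sw: "star A w = x \<oplus> (- \<i>) \<odot> y" using assms by (simp add: w_def star_add star_smult)
  have "star A w \<otimes> w = (x \<otimes> x \<oplus> y \<otimes> y) \<oplus> (\<i> \<odot> (y \<otimes> x) \<oplus> (- \<i>) \<odot> (y \<otimes> x))"
    using assms unfolding sw
    by (simp add: w_def l_distr r_distr smult_mult_left smult_mult_right smult_smult smult_r_distr a_ac)
  also have "\<i> \<odot> (y \<otimes> x) \<oplus> (- \<i>) \<odot> (y \<otimes> x) = \<zero>"
    using assms smult_l_distr[of "y \<otimes> x" \<i> "- \<i>"] by simp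
  finally have "(p w)\<^sup>2 = p (x \<otimes> x \<oplus> y \<otimes> y)"
    using p_cstar[OF w] assms by simp
  moreover have "w \<oplus> star A w = 2 \<odot> x \<oplus> (\<i> \<odot> y \<oplus> (- \<i>) \<odot> y)"
    using assms smult_l_distr[of x 1 1] unfolding sw by (simp add: w_def a_ac)
  then have "2 \<odot> x = w \<oplus> star A w"
    using assms smult_l_distr[of y \<i> "- \<i>"] by simp
  then have "2 * p x \<le> p w + p w"
    using p_triangle[of w "star A w"] w assms p_smult[of x 2] by simp
  ultimately show ?thesis using assms power_mono[of "p x" "p w" 2] by simp
qed

lemma real_poly_seminorm_ev:
  assumes "x \<in> carrier A" "star A x = x"
  shows "real_poly_seminorm (\<lambda>f. p (ev x f))"
proof
  show "(p (ev x f))\<^sup>2 \<le> p (ev x (f * f + g * g))" for f g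
    unfolding ev_add[OF assms(1)] ev_mult[OF assms(1)]
    using assms by (intro p_square_le) (simp_all add: star_ev ev_mult[symmetric] mult.commute)
qed (use assms p_one_le in \<open>simp_all add: ev_add ev_mult ev_smult ev_one p_triangle p_mult p_smult\<close>)

text \<open>\<open>Q_one_minus_square\<close> after rescaling. Being within distance
  \<open>T\<close> of the scalar \<open>T\<close> is what replaces positivity of the square in the
  next lemma.\<close>

lemma p_diff_square_le:
  assumes "x \<in> carrier A" "star A x = x" "(p x)\<^sup>2 \<le> T" "T > 0"
  shows "p (complex_of_real T \<odot> \<one> \<ominus> x \<otimes> x) \<le> T"
proof -
  interpret real_poly_seminorm "\<lambda>f. p (ev x f)" by (rule real_poly_seminorm_ev[OF assms(1,2)])
  define f where "f = smult (1 / sqrt T) [:0, 1 :: real:]"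
  have "p x \<le> sqrt T" using assms(1,3) by (simp add: real_le_rsqrt)
  then have "p (ev x f) \<le> 1"
    unfolding f_def ev_smult[OF assms(1)] ev_X[OF assms(1)] p_smult[OF assms(1)] norm_of_real
    using assms by (simp add: field_simps)
  then have "p (ev x (1 - f * f)) \<le> 1" by (rule Q_one_minus_square)
  then have "p (ev x (smult T (1 - f * f))) \<le> T"
    using assms by (simp add: ev_smult p_smult)
  moreover have "smult T (1 - f * f) = [:T:] - [:0, 1:] * [:0, 1:]"
    using assms(4) by (simp add: f_def smult_diff_right one_pCons)
  ultimately show ?thesis
    using assms(1) by (simp add: ev_diff ev_mult ev_const ev_X del: mult_pCons_left mult_pCons_right)
qed

text \<open>Without a functional calculus, \<open>a\<close> is treated as positive if its distance
  from some scalar c > 0 is at most c. Squares have this property, and adding the scalars extends it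
  to sums. Up to a null element, 1 - x_k^2 is the sum of the other squares, so
  \<open>Q_le_one\<close> applies.\<close>

lemma p_le_one_if_sum_squares:
  fixes x :: "'i \<Rightarrow> 'a"
  assumes fin: "finite I" and x: "\<And>i. i \<in> I \<Longrightarrow> x i \<in> carrier A" "\<And>i. i \<in> I \<Longrightarrow> star A (x i) = x i"
    and sum: "p ((\<Oplus>i\<in>I. x i \<otimes> x i) \<ominus> \<one>) = 0" and k: "k \<in> I"
  shows "p (x k) \<le> 1"
proof -
  define T where "T = 1 + (\<Sum>i\<in>I. (p (x i))\<^sup>2)"
  have T: "T > 0" "(p (x i))\<^sup>2 \<le> T" if "i \<in> I" for i
    using member_le_sum[OF that, of "\<lambda>i. (p (x i))\<^sup>2"] fin sum_nonneg[of I "\<lambda>i. (p (x i))\<^sup>2"]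
    by (simp_all add: T_def)
  define S where "S = (\<lambda>J :: 'i set. \<Oplus>i\<in>J. x i \<otimes> x i)"
  \<comment> \<open>One \<open>T\<close> for each square; the additional one keeps the scalar
    positive for the empty set, as \<open>Q_le_one\<close> requires.\<close>
  define c where "c = (\<lambda>J :: 'i set. (real (card J) + 1) * T)"
  have S: "S J \<in> carrier A" if "J \<subseteq> I" for J
    unfolding S_def using x that by (intro finsum_closed) auto
  have bound: "p (complex_of_real (c J) \<odot> \<one> \<ominus> S J) \<le> c J" if "finite J" "J \<subseteq> I" for J
    using that
  proof (induction J rule: finite_induct)
    case empty
    have "T * p \<one> \<le> T" using p_one_le T[OF k] mult_left_le[of "p \<one>" T] by simp
    then show ?case using T[OF k] by (simp add: S_def c_def p_smult minus_eq)
  next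
    case (insert i J)
    have i: "x i \<in> carrier A" "i \<in> I" using insert x by auto
    have SJ: "S J \<in> carrier A" using S insert by simp
    have "S (insert i J) = x i \<otimes> x i \<oplus> S J"
      unfolding S_def using insert x by (intro finsum_insert) auto
    moreover have "c (insert i J) = T + c J" using insert by (simp add: c_def algebra_simps)
    moreover have "complex_of_real (T + c J) \<odot> \<one> = complex_of_real T \<odot> \<one> \<oplus> complex_of_real (c J) \<odot> \<one>"
      by (simp add: smult_l_distr)
    ultimately have "complex_of_real (c (insert i J)) \<odot> \<one> \<ominus> S (insert i J) =
        (complex_of_real T \<odot> \<one> \<oplus> complex_of_real (c J) \<odot> \<one>) \<ominus> (x i \<otimes> x i \<oplus> S J)" by simp
    also have "\<dots> = (complex_of_real T \<odot> \<one> \<ominus> x i \<otimes> x i) \<oplus> (complex_of_real (c J) \<odot> \<one> \<ominus> S J)"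
    proof -
      have "complex_of_real T \<odot> \<one> \<in> carrier A" "complex_of_real (c J) \<odot> \<one> \<in> carrier A" by simp_all
      with i(1) SJ show ?thesis by algebra
    qed
    finally show ?case
      using p_triangle[of "complex_of_real T \<odot> \<one> \<ominus> x i \<otimes> x i" "complex_of_real (c J) \<odot> \<one> \<ominus> S J"]
        p_diff_square_le[of "x i" T] T[OF i(2)] x[OF i(2)] SJ insert \<open>c (insert i J) = T + c J\<close> by simp
  qed
  let ?J = "I - {k}"
  have xk: "x k \<in> carrier A" "star A (x k) = x k" using x k by auto
  have SJ: "S ?J \<in> carrier A" by (rule S) auto
  have "S I = x k \<otimes> x k \<oplus> S ?J"
  proof -
    have "S (insert k ?J) = x k \<otimes> x k \<oplus> S ?J"
      unfolding S_def using x k fin by (intro finsum_insert) auto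
    then show ?thesis using k by (simp add: insert_absorb)
  qed
  then have null: "p ((x k \<otimes> x k \<oplus> S ?J) \<ominus> \<one>) = 0" using sum by (simp add: S_def)
  have c: "c ?J > 0" using T[OF k] by (simp add: c_def)
  interpret real_poly_seminorm "\<lambda>f. p (ev (x k) f)" by (rule real_poly_seminorm_ev[OF xk])
  have "p (ev (x k) ([:c ?J:] - (1 - [:0, 1:] * [:0, 1:]))) =
      p (complex_of_real (c ?J) \<odot> \<one> \<ominus> (\<one> \<ominus> x k \<otimes> x k))"
    using xk(1) by (simp add: ev_diff ev_mult ev_const ev_X ev_one del: mult_pCons_left mult_pCons_right)
  also have "complex_of_real (c ?J) \<odot> \<one> \<ominus> (\<one> \<ominus> x k \<otimes> x k) =
      (complex_of_real (c ?J) \<odot> \<one> \<ominus> S ?J) \<oplus> ((x k \<otimes> x k \<oplus> S ?J) \<ominus> \<one>)"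
  proof -
    have "complex_of_real (c ?J) \<odot> \<one> \<in> carrier A" by simp
    with xk(1) SJ show ?thesis by algebra
  qed
  also have "p \<dots> \<le> c ?J"
    using p_triangle[of "complex_of_real (c ?J) \<odot> \<one> \<ominus> S ?J" "(x k \<otimes> x k \<oplus> S ?J) \<ominus> \<one>"] null bound[of ?J] fin xk SJ
    by simp
  finally have "p (ev (x k) ([:c ?J:] - (1 - [:0, 1:] * [:0, 1:]))) \<le> c ?J" .
  from Q_le_one[OF c this] show ?thesis using xk(1) by (simp add: ev_X)
qed

end

subsection \<open>Weighted l1-norms and suprema of C*-seminorms\<close>

definition weighted_l1 :: "('m \<Rightarrow> real) \<Rightarrow> ('m \<Rightarrow> complex) \<Rightarrow> real" where
  "weighted_l1 \<omega> f = (\<Sum>w | f w \<noteq> 0. cmod (f w) * \<omega> w)"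

context star_monoid
begin

lemma cmod_pairing_le:
  assumes "f \<in> carrier F" "\<And>w. w \<in> carrier M \<Longrightarrow> cmod (\<phi> w) \<le> \<omega> w"
  shows "cmod (pairing f \<phi>) \<le> weighted_l1 \<omega> f"
  unfolding pairing_def weighted_l1_def
  by (rule order_trans[OF norm_sum])
    (use assms supp_closed in \<open>auto simp: norm_mult intro!: sum_mono mult_left_mono\<close>)

lemma weighted_l1_mult:
  assumes "f \<in> carrier F" "g \<in> carrier F"
    and nonneg: "\<And>w. w \<in> carrier M \<Longrightarrow> 0 \<le> \<omega> w"
    and submult: "\<And>v w. v \<in> carrier M \<Longrightarrow> w \<in> carrier M \<Longrightarrow> \<omega> (v \<otimes> w) \<le> \<omega> v * \<omega> w"
  shows "weighted_l1 \<omega> (f \<otimes>\<^bsub>F\<^esub> g) \<le> weighted_l1 \<omega> f * weighted_l1 \<omega> g"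
proof -
  let ?S = "{w. f w \<noteq> 0} \<times> {w. g w \<noteq> 0}" and ?m = "\<lambda>(a, b). a \<otimes> b"
  have fin: "finite ?S" using assms by simp
  have closed: "a \<in> carrier M" "b \<in> carrier M" if "(a, b) \<in> ?S" for a b
    using that assms(1,2) supp_closed by auto
  have "weighted_l1 \<omega> (f \<otimes>\<^bsub>F\<^esub> g) \<le> (\<Sum>w\<in>?m ` ?S. cmod ((f \<otimes>\<^bsub>F\<^esub> g) w) * \<omega> w)"
    unfolding weighted_l1_def
    by (rule sum_mono2) (use fin supp_mult[of f g] closed nonneg in auto)
  also have "\<dots> \<le> (\<Sum>w\<in>?m ` ?S. \<Sum>p | p \<in> ?S \<and> ?m p = w. cmod (f (fst p)) * cmod (g (snd p)) * \<omega> (?m p))"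
  proof (rule sum_mono)
    fix w assume "w \<in> ?m ` ?S"
    then have w: "0 \<le> \<omega> w" using closed nonneg by auto
    have "{(a, b). f a \<noteq> 0 \<and> g b \<noteq> 0 \<and> a \<otimes> b = w} = {p. p \<in> ?S \<and> ?m p = w}" by auto
    then have "cmod ((f \<otimes>\<^bsub>F\<^esub> g) w) \<le> (\<Sum>p | p \<in> ?S \<and> ?m p = w. cmod (f (fst p)) * cmod (g (snd p)))"
      unfolding F_mult using norm_sum[of "\<lambda>p. f (fst p) * g (snd p)" "{p. p \<in> ?S \<and> ?m p = w}"]
      by (simp add: case_prod_unfold norm_mult)
    then have "cmod ((f \<otimes>\<^bsub>F\<^esub> g) w) * \<omega> w \<le>
        (\<Sum>p | p \<in> ?S \<and> ?m p = w. cmod (f (fst p)) * cmod (g (snd p))) * \<omega> w"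
      using w by (rule mult_right_mono)
    then show "cmod ((f \<otimes>\<^bsub>F\<^esub> g) w) * \<omega> w \<le>
        (\<Sum>p | p \<in> ?S \<and> ?m p = w. cmod (f (fst p)) * cmod (g (snd p)) * \<omega> (?m p))"
      by (simp add: sum_distrib_right)
  qed
  also have "\<dots> = (\<Sum>p\<in>?S. cmod (f (fst p)) * cmod (g (snd p)) * \<omega> (?m p))"
    by (rule sum.group[OF fin]) (use fin in auto)
  also have "\<dots> \<le> (\<Sum>p\<in>?S. cmod (f (fst p)) * cmod (g (snd p)) * (\<omega> (fst p) * \<omega> (snd p)))"
    using closed submult by (intro sum_mono mult_left_mono) auto
  also have "\<dots> = weighted_l1 \<omega> f * weighted_l1 \<omega> g"
    by (simp add: weighted_l1_def sum_product sum.cartesian_product case_prod_unfold mult_ac)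
  finally show ?thesis .
qed

lemma weighted_l1_star:
  assumes "f \<in> carrier F" "\<And>w. w \<in> carrier M \<Longrightarrow> \<omega> (mstar M w) = \<omega> w"
  shows "weighted_l1 \<omega> (star F f) = weighted_l1 \<omega> f"
proof -
  have inj: "inj_on (mstar M) {w. f w \<noteq> 0}"
    by (rule inj_on_inverseI[of _ "mstar M"]) (use assms supp_closed in auto)
  have "weighted_l1 \<omega> (star F f) = (\<Sum>w | f w \<noteq> 0. cmod (star F f (mstar M w)) * \<omega> (mstar M w))"
    unfolding weighted_l1_def supp_star[OF assms(1)] by (simp add: sum.reindex[OF inj])
  also have "\<dots> = weighted_l1 \<omega> f"
    unfolding weighted_l1_def
    by (rule sum.cong) (use assms supp_closed in \<open>auto simp: F_star\<close>)
  finally show ?thesis .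
qed

text \<open>Triangle inequality along the basis. The bound depends only on \<open>f\<close>, so
  suprema of such seminorms are finite.\<close>

lemma seminorm_le_weighted_l1:
  assumes p: "cstar_seminorm F p" and f: "f \<in> carrier F"
    and basis: "\<And>w. w \<in> carrier M \<Longrightarrow> p (basis_elem w) \<le> 1"
  shows "p f \<le> weighted_l1 (\<lambda>_. 1) f"
proof -
  interpret cstar_seminormed F p
    using star_alg_F p by (simp add: cstar_seminormed_def cstar_seminormed_axioms_def)
  have main: "p (\<lambda>w. \<Sum>i\<in>I. c i * basis_elem i w) \<le> (\<Sum>i\<in>I. cmod (c i))"
    if "finite I" "I \<subseteq> carrier M" for I c
    using that
  proof (induction I rule: finite_induct)
    case (insert i I)
    let ?s = "\<lambda>w. \<Sum>i\<in>I. c i * basis_elem i w"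
    have s: "?s \<in> carrier F" by (rule sum_closed_F) (use insert in auto)
    have "(\<lambda>w. \<Sum>j\<in>insert i I. c j * basis_elem j w) = (c i \<odot>\<^bsub>F\<^esub> basis_elem i) \<oplus>\<^bsub>F\<^esub> ?s"
      using insert by (simp add: F_add F_smult)
    moreover have "p ((c i \<odot>\<^bsub>F\<^esub> basis_elem i) \<oplus>\<^bsub>F\<^esub> ?s) \<le> cmod (c i) * p (basis_elem i) + p ?s"
      using p_triangle[of "c i \<odot>\<^bsub>F\<^esub> basis_elem i" ?s] s insert by (simp add: p_smult)
    moreover have "cmod (c i) * p (basis_elem i) \<le> cmod (c i)"
      using basis[of i] insert mult_left_mono[of "p (basis_elem i)" 1 "cmod (c i)"] by simp
    ultimately show ?case using insert by simp
  qed (use p_zero in \<open>simp add: F_zero\<close>)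
  have "(\<lambda>w. \<Sum>i | f i \<noteq> 0. f i * basis_elem i w) = f"
    using f by (intro ext) (simp add: basis_elem_def if_distrib cong: if_cong)
  then show ?thesis
    using main[of "{w. f w \<noteq> 0}" f] f supp_closed[OF f] by (simp add: weighted_l1_def subset_eq)
qed

end

text \<open>Every clause passes to pointwise suprema; for the C*-identity the reason is that
  squaring is monotone on nonnegative numbers.\<close>

lemma (in star_alg) cstar_seminorm_SUP:
  assumes "P \<noteq> {}" and P: "\<And>p. p \<in> P \<Longrightarrow> cstar_seminorm A p"
    and bdd: "\<And>x. x \<in> carrier A \<Longrightarrow> bdd_above ((\<lambda>p. p x) ` P)"
  shows "cstar_seminorm A (\<lambda>x. SUP p\<in>P. p x)"
proof -
  define U where "U = (\<lambda>x. SUP p\<in>P. p x)"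
  have sem: "cstar_seminormed A p" if "p \<in> P" for p
    using P[OF that] star_alg_axioms by (simp add: cstar_seminormed_def cstar_seminormed_axioms_def)
  note sp = cstar_seminormed.p_nonneg[OF sem] cstar_seminormed.p_triangle[OF sem]
    cstar_seminormed.p_smult[OF sem] cstar_seminormed.p_mult[OF sem] cstar_seminormed.p_cstar[OF sem]
  have upper: "p x \<le> U x" if "p \<in> P" "x \<in> carrier A" for p x
    unfolding U_def by (rule cSUP_upper[OF that(1) bdd[OF that(2)]])
  have least: "U x \<le> c" if "\<And>p. p \<in> P \<Longrightarrow> p x \<le> c" for x c
    unfolding U_def by (rule cSUP_least[OF assms(1)]) (rule that)
  have nonneg: "0 \<le> U x" if "x \<in> carrier A" for x
    using assms(1) upper sp(1) that order_trans by (metis all_not_in_conv)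
  have scale_le: "U (c \<odot> a) \<le> cmod c * U a" if "a \<in> carrier A" for c a
    by (rule least) (use that upper in \<open>auto simp: sp(3) intro: mult_left_mono\<close>)
  have "U (c \<odot> a) = cmod c * U a" if a: "a \<in> carrier A" for c a
  proof (cases "c = 0")
    case True
    then show ?thesis using scale_le[OF a, of 0] nonneg[of "0 \<odot> a"] a by simp
  next
    case False
    have "U a \<le> cmod (inverse c) * U (c \<odot> a)"
      using scale_le[of "c \<odot> a" "inverse c"] a False by (simp add: smult_smult)
    then have "cmod c * U a \<le> U (c \<odot> a)"
      using False by (simp add: norm_inverse norm_divide field_simps)
    then show ?thesis using scale_le[OF a] by (simp add: antisym)
  qed
  moreover have "U (a \<oplus> b) \<le> U a + U b" if "a \<in> carrier A" "b \<in> carrier A" for a b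
  proof (rule least)
    fix p assume "p \<in> P"
    then show "p (a \<oplus> b) \<le> U a + U b"
      using sp(2)[of p a b] upper[of p a] upper[of p b] that by linarith
  qed
  moreover have "U (a \<otimes> b) \<le> U a * U b" if "a \<in> carrier A" "b \<in> carrier A" for a b
  proof (rule least)
    fix p assume p: "p \<in> P"
    have "p a * p b \<le> U a * U b" by (intro mult_mono upper nonneg sp(1) p that)
    then show "p (a \<otimes> b) \<le> U a * U b" using sp(4)[OF p that] by linarith
  qed
  moreover have "U (star A a \<otimes> a) = (U a)\<^sup>2" if a: "a \<in> carrier A" for a
  proof (rule antisym)
    show "U (star A a \<otimes> a) \<le> (U a)\<^sup>2"
    proof (rule least)
      fix p assume "p \<in> P"
      then show "p (star A a \<otimes> a) \<le> (U a)\<^sup>2"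
        using a upper sp(1) by (simp add: sp(5) power_mono)
    qed
    have "U a \<le> sqrt (U (star A a \<otimes> a))"
    proof (rule least)
      fix p assume p: "p \<in> P"
      then have "(p a)\<^sup>2 \<le> U (star A a \<otimes> a)" using upper[of p "star A a \<otimes> a"] a by (simp add: sp(5))
      then show "p a \<le> sqrt (U (star A a \<otimes> a))" by (rule real_le_rsqrt)
    qed
    then show "(U a)\<^sup>2 \<le> U (star A a \<otimes> a)"
      using nonneg[of a] nonneg[of "star A a \<otimes> a"] a
      by (metis m_closed power_mono real_sqrt_pow2 star_closed)
  qed
  ultimately have "cstar_seminorm A U" unfolding cstar_seminorm_def using nonneg by simp
  then show ?thesis by (simp add: U_def)
qed

lemma (in cstar_seminormed) embed_finsum:
  assumes "finite I" "\<And>i. i \<in> I \<Longrightarrow> f i \<in> carrier A"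
  shows "embed A p (\<Oplus>i\<in>I. f i) = (\<Oplus>\<^bsub>C\<^esub>i\<in>I. embed A p (f i))"
proof -
  interpret C: star_alg C by (rule star_alg_C)
  from assms show ?thesis
  proof (induction I rule: finite_induct)
    case (insert i I)
    have "embed A p (finsum A f (insert i I)) = embed A p (f i \<oplus> finsum A f I)"
      using insert by (subst finsum_insert) auto
    also have "\<dots> = embed A p (f i) \<oplus>\<^bsub>C\<^esub> embed A p (finsum A f I)"
      using insert by (intro embed_add finsum_closed) auto
    also have "\<dots> = (\<Oplus>\<^bsub>C\<^esub>i\<in>insert i I. embed A p (f i))"
      using insert by (subst C.finsum_insert) auto
    finally show ?case .
  qed (simp add: embed_zero)
qed

section \<open>The universal C*-algebra of the orthogonality relations\<close>

lemma star_monoid_free: "star_monoid (free_star_monoid G)"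
proof (unfold_locales)
  let ?inv = "\<lambda>w. rev (map (\<lambda>(g, b). (g, \<not> b)) w)"
  have inv: "?inv w \<in> lists (G \<times> UNIV)" if "w \<in> lists (G \<times> UNIV)" for w
    using that by (induction w) auto
  then show "mstar (free_star_monoid G) a \<in> carrier (free_star_monoid G)"
    if "a \<in> carrier (free_star_monoid G)" for a
    using that by (simp add: free_star_monoid_def del: in_lists_conv_set)
qed (auto simp: free_star_monoid_def rev_map o_def case_prod_unfold)

locale Ao_algebra =
  fixes n :: nat
begin

definition M where "M = free_star_monoid (Ao_index n)"

sublocale M: star_monoid M
  unfolding M_def by (rule star_monoid_free)

abbreviation "FA \<equiv> star_monoid_algebra M"

lemma FA_eq: "free_star_algebra (Ao_index n) = FA"
  by (simp add: free_star_algebra_def M_def)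

sublocale FA: star_alg FA
  by (rule M.star_alg_F)

lemma carrier_M: "carrier M = lists (Ao_index n \<times> UNIV)"
  and mult_M: "v \<otimes>\<^bsub>M\<^esub> w = v @ w"
  and one_M: "\<one>\<^bsub>M\<^esub> = []"
  by (simp_all add: M_def free_star_monoid_def)

definition killing :: "((((nat \<times> nat) \<times> bool) list \<Rightarrow> complex) \<Rightarrow> real) set" where
  "killing = {p. cstar_seminorm FA p \<and> (\<forall>r\<in>Ao_relations n. p r = 0)}"

definition U where "U = universal_seminorm (Ao_index n) (Ao_relations n)"

lemma U_eq: "U x = (SUP p\<in>killing. p x)"
  by (simp add: U_def universal_seminorm_def killing_def FA_eq)

lemma gen_closed: "i \<in> {1..n} \<Longrightarrow> j \<in> {1..n} \<Longrightarrow> free_gen (i, j) \<in> carrier FA"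
  unfolding free_gen_def by (rule M.basis_elem_closed) (simp add: carrier_M Ao_index_def)

lemma relations:
  assumes "i \<in> {1..n}" "j \<in> {1..n}"
  shows "free_gen (i, j) \<ominus>\<^bsub>FA\<^esub> star FA (free_gen (i, j)) \<in> Ao_relations n"
    and "(\<Oplus>\<^bsub>FA\<^esub>k\<in>{1..n}. free_gen (k, i) \<otimes>\<^bsub>FA\<^esub> free_gen (k, j)) \<ominus>\<^bsub>FA\<^esub>
      (if i = j then \<one>\<^bsub>FA\<^esub> else \<zero>\<^bsub>FA\<^esub>) \<in> Ao_relations n"
  using assms unfolding Ao_relations_def FA_eq Let_def by blast+

text \<open>In the completion for \<open>p\<close> the killed relations become equations: the
  generators of a column are self-adjoint there and their squares add up to 1.\<close>

lemma gen_le_one: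
  assumes p: "p \<in> killing" and ij: "i \<in> {1..n}" "j \<in> {1..n}"
  shows "p (free_gen (i, j)) \<le> 1"
proof -
  interpret cstar_seminormed FA p
    using p FA.star_alg_axioms by (simp add: killing_def cstar_seminormed_def cstar_seminormed_axioms_def)
  interpret C: cstar_seminormed C "cnorm C" by (rule cstar_seminormed_C)
  let ?x = "\<lambda>k. embed FA p (free_gen (k, j))"
  have "cnorm C (?x i) \<le> 1"
  proof (rule C.p_le_one_if_sum_squares[where x = ?x and k = i and I = "{1..n}"])
    fix k assume k: "k \<in> {1..n}"
    show "?x k \<in> carrier C" using gen_closed[OF k ij(2)] by simp
    have "p (free_gen (k, j) \<ominus>\<^bsub>FA\<^esub> star FA (free_gen (k, j))) = 0"
      using p relations(1)[OF k ij(2)] by (simp add: killing_def)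
    then show "star C (?x k) = ?x k"
      using gen_closed[OF k ij(2)] by (metis FA.star_closed embed_eq_iff embed_star)
  next
    have closed: "free_gen (k, j) \<in> carrier FA" if "k \<in> {1..n}" for k using gen_closed[OF that ij(2)] .
    let ?s = "\<Oplus>\<^bsub>FA\<^esub>k\<in>{1..n}. free_gen (k, j) \<otimes>\<^bsub>FA\<^esub> free_gen (k, j)"
    have s: "?s \<in> carrier FA" by (rule FA.finsum_closed) (use closed in auto)
    have "p (?s \<ominus>\<^bsub>FA\<^esub> \<one>\<^bsub>FA\<^esub>) = 0"
      using p relations(2)[OF ij(2) ij(2)] by (simp add: killing_def)
    then have "embed FA p ?s = \<one>\<^bsub>C\<^esub>"
      using embed_eq_iff[OF s FA.one_closed] embed_one by simp
    moreover have "embed FA p ?s = (\<Oplus>\<^bsub>C\<^esub>k\<in>{1..n}. ?x k \<otimes>\<^bsub>C\<^esub> ?x k)"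
    proof -
      have "embed FA p ?s = (\<Oplus>\<^bsub>C\<^esub>k\<in>{1..n}. embed FA p (free_gen (k, j) \<otimes>\<^bsub>FA\<^esub> free_gen (k, j)))"
        by (rule embed_finsum) (use closed in auto)
      also have "\<dots> = (\<Oplus>\<^bsub>C\<^esub>k\<in>{1..n}. ?x k \<otimes>\<^bsub>C\<^esub> ?x k)"
        by (rule C.finsum_cong') (use closed embed_mult in auto)
      finally show ?thesis .
    qed
    ultimately have eq: "(\<Oplus>\<^bsub>C\<^esub>k\<in>{1..n}. ?x k \<otimes>\<^bsub>C\<^esub> ?x k) = \<one>\<^bsub>C\<^esub>" by simp
    show "cnorm C ((\<Oplus>\<^bsub>C\<^esub>k\<in>{1..n}. ?x k \<otimes>\<^bsub>C\<^esub> ?x k) \<ominus>\<^bsub>C\<^esub> \<one>\<^bsub>C\<^esub>) = 0"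
      unfolding eq by (simp add: C.minus_eq C.r_neg)
  qed (use ij in auto)
  then show ?thesis using gen_closed[OF ij] by (simp add: cnorm_embed)
qed

lemma word_le_one:
  assumes p: "p \<in> killing" and w: "w \<in> carrier M"
  shows "p (basis_elem w) \<le> 1"
proof -
  interpret cstar_seminormed FA p
    using p FA.star_alg_axioms by (simp add: killing_def cstar_seminormed_def cstar_seminormed_axioms_def)
  show ?thesis using w
  proof (induction w)
    case Nil
    show ?case using p_one_le by (simp add: M.F_one one_M)
  next
    case (Cons x w)
    obtain i j b where x: "x = ((i, j), b)" by (metis surj_pair)
    have ij: "i \<in> {1..n}" "j \<in> {1..n}" and w: "w \<in> carrier M"
      using Cons.prems by (auto simp: carrier_M Ao_index_def x)
    have letter: "[x] \<in> carrier M" using Cons.prems by (simp add: carrier_M)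
    have "p (basis_elem [x]) \<le> 1"
    proof (cases b)
      case True
      have "[((i, j), False)] \<in> carrier M" using ij by (simp add: carrier_M Ao_index_def)
      then have "star FA (free_gen (i, j)) = basis_elem [x]"
        unfolding free_gen_def by (subst M.star_basis_elem) (simp_all add: M_def free_star_monoid_def x True)
      then show ?thesis using gen_le_one[OF p ij] gen_closed[OF ij] p_star by metis
    next
      case False
      then show ?thesis using gen_le_one[OF p ij] by (simp add: x free_gen_def)
    qed
    moreover have "p (basis_elem (x # w)) \<le> p (basis_elem [x]) * p (basis_elem w)"
      using p_mult[of "basis_elem [x]" "basis_elem w"] letter w M.mult_basis_elem[OF letter w] by (simp add: mult_M)
    ultimately show ?case
      using Cons.IH[OF w] p_nonneg[of "basis_elem w"] p_nonneg[of "basis_elem [x]"] letter w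
        mult_mono[of "p (basis_elem [x])" 1 "p (basis_elem w)" 1] by simp
  qed
qed

lemma killing_nonempty: "killing \<noteq> {}"
proof -
  have "(\<lambda>_. 0) \<in> killing" by (simp add: killing_def cstar_seminorm_def)
  then show ?thesis by blast
qed

lemma killing_bdd: "x \<in> carrier FA \<Longrightarrow> bdd_above ((\<lambda>p. p x) ` killing)"
  by (rule bdd_aboveI2[where M = "weighted_l1 (\<lambda>_. 1) x"])
    (auto intro!: M.seminorm_le_weighted_l1 word_le_one simp: killing_def)

lemma cstar_seminorm_U: "cstar_seminorm FA U"
proof -
  have "cstar_seminorm FA (\<lambda>x. SUP p\<in>killing. p x)"
    by (rule FA.cstar_seminorm_SUP[OF killing_nonempty _ killing_bdd]) (simp_all add: killing_def)
  then show ?thesis by (simp add: U_eq[abs_def])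
qed

sublocale U: cstar_seminormed FA U
  by unfold_locales (rule cstar_seminorm_U)

lemma U_upper: "p \<in> killing \<Longrightarrow> x \<in> carrier FA \<Longrightarrow> p x \<le> U x"
  unfolding U_eq by (rule cSUP_upper[OF _ killing_bdd])

lemma U_relations: "r \<in> Ao_relations n \<Longrightarrow> U r = 0"
  unfolding U_eq using killing_nonempty by (simp add: killing_def)

text \<open>Representations of the relations, given by a vector state \<open>\<phi>\<close> on words, bound the universal seminorm
  from below.\<close>

lemma U_lower:
  assumes \<phi>: "positive_form FA (\<lambda>f. pairing f \<phi>)" "\<And>w. w \<in> carrier M \<Longrightarrow> cmod (\<phi> w) \<le> 1" "\<phi> [] = 1"
    and kill: "\<And>r y. r \<in> Ao_relations n \<Longrightarrow> y \<in> carrier FA \<Longrightarrow>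
      pairing (star FA (r \<otimes>\<^bsub>FA\<^esub> y) \<otimes>\<^bsub>FA\<^esub> (r \<otimes>\<^bsub>FA\<^esub> y)) \<phi> = 0"
    and x: "x \<in> carrier FA"
  shows "Re (pairing (star FA x \<otimes>\<^bsub>FA\<^esub> x) \<phi>) \<le> (U x)\<^sup>2"
proof -
  interpret gns FA "{\<lambda>f. pairing f \<phi>}" "weighted_l1 (\<lambda>_. 1)"
  proof
    show "\<exists>\<phi>'\<in>{\<lambda>f. pairing f \<phi>}. \<phi>' \<one>\<^bsub>FA\<^esub> = 1"
      by (simp add: M.F_one one_M \<phi>(3))
  qed (use \<phi> M.cmod_pairing_le M.weighted_l1_mult M.weighted_l1_star in auto)
  \<comment> \<open>Every vector obtained by applying a relation is null in this representation, so
    its operator seminorm takes part in the supremum defining \<open>U\<close>.\<close>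
  have "gns_norm \<in> killing"
  proof -
    have "gns_norm r = 0" if r: "r \<in> Ao_relations n" for r
    proof -
      have "gns_norm r = (SUP (\<phi>, y)\<in>unit_vectors. 0)"
        unfolding gns_norm_def by (rule SUP_cong) (auto simp: unit_vectors_def kill[OF r])
      then show ?thesis using unit_vectors_nonempty by (simp add: case_prod_unfold)
    qed
    then show ?thesis using cstar_seminorm_gns by (simp add: killing_def)
  qed
  then have "gns_norm x \<le> U x" using x by (rule U_upper)
  moreover have "sqrt (Re (pairing (star FA x \<otimes>\<^bsub>FA\<^esub> x) \<phi>)) \<le> gns_norm x"
  proof -
    have "pairing \<one>\<^bsub>FA\<^esub> \<phi> = 1" by (simp add: M.F_one one_M \<phi>(3))
    then show ?thesis using gns_ineq[of "\<lambda>f. pairing f \<phi>" x "\<one>\<^bsub>FA\<^esub>"] x by simp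
  qed
  moreover have "0 \<le> Re (pairing (star FA x \<otimes>\<^bsub>FA\<^esub> x) \<phi>)"
    using FA.form_nonneg[OF \<phi>(1) x] .
  ultimately show ?thesis
    using power_mono[of "sqrt (Re (pairing (star FA x \<otimes>\<^bsub>FA\<^esub> x) \<phi>))" "U x" 2] by simp
qed

abbreviation "AO \<equiv> completion FA U"

lemma Ao_eq: "Ao n = AO"
  by (simp add: Ao_def universal_cstar_def FA_eq U_def)

lemma Ao_gen_eq: "Ao_gen n i j = embed FA U (free_gen (i, j))"
  by (simp add: Ao_gen_def FA_eq U_def)

sublocale AO: cstar_seminormed AO "cnorm AO"
  by (rule U.cstar_seminormed_C)

end

section \<open>The minimal tensor product\<close>

definition psd :: "'i set \<Rightarrow> ('i \<Rightarrow> 'i \<Rightarrow> complex) \<Rightarrow> bool" where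
  "psd S K \<longleftrightarrow> (\<forall>c. (\<Sum>v\<in>S. \<Sum>w\<in>S. cnj (c v) * c w * K v w) \<in> \<real>\<^sub>\<ge>\<^sub>0)"

lemma nonneg_Reals_sum: "(\<And>i. i \<in> I \<Longrightarrow> f i \<in> \<real>\<^sub>\<ge>\<^sub>0) \<Longrightarrow> (\<Sum>i\<in>I. f i :: complex) \<in> \<real>\<^sub>\<ge>\<^sub>0"
  by (induction I rule: infinite_finite_induct) (auto intro: nonneg_Reals_add_I)

lemma psd_insert_expand:
  assumes "finite S" "s \<notin> S"
  shows "(\<Sum>v\<in>insert s S. \<Sum>w\<in>insert s S. cnj ((c(s := t)) v) * (c(s := t)) w * K v w) =
    (\<Sum>v\<in>S. \<Sum>w\<in>S. cnj (c v) * c w * K v w) + t * (\<Sum>v\<in>S. cnj (c v) * K v s) +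
    cnj t * (\<Sum>w\<in>S. c w * K s w) + cnj t * t * K s s"
proof -
  have "(\<Sum>w\<in>insert s S. cnj a * (c(s := t)) w * K v w) =
      cnj a * t * K v s + (\<Sum>w\<in>S. cnj a * c w * K v w)" for a v
    using assms by (subst sum.insert) (auto intro!: sum.cong)
  then have "(\<Sum>v\<in>insert s S. \<Sum>w\<in>insert s S. cnj ((c(s := t)) v) * (c(s := t)) w * K v w) =
      (\<Sum>v\<in>insert s S. cnj ((c(s := t)) v) * t * K v s + (\<Sum>w\<in>S. cnj ((c(s := t)) v) * c w * K v w))"
    by simp
  also have "\<dots> = cnj t * t * K s s + (\<Sum>w\<in>S. cnj t * c w * K s w) +
      (\<Sum>v\<in>S. cnj (c v) * t * K v s + (\<Sum>w\<in>S. cnj (c v) * c w * K v w))"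
    using assms by (subst sum.insert) (auto intro!: sum.cong)
  finally show ?thesis by (simp add: sum.distrib sum_distrib_left mult_ac add_ac)
qed

text \<open>Cholesky's algorithm: the row of \<open>s\<close> splits off a kernel of rank one, and
  the Schur complement \<open>K'\<close> is positive semidefinite on the smaller set.\<close>

lemma psd_decomposition:
  assumes "finite S" "psd S K"
  shows "\<exists>N g. \<forall>v\<in>S. \<forall>w\<in>S. K v w = (\<Sum>r<(N::nat). cnj (g r v) * g r w)"
  using assms
proof (induction S arbitrary: K rule: finite_induct)
  case (insert s S)
  define P where "P = (\<lambda>c. \<Sum>v\<in>S. \<Sum>w\<in>S. cnj (c v) * c w * K v w)"
  define col where "col = (\<lambda>c. \<Sum>v\<in>S. cnj (c v) * K v s)"
  define row where "row = (\<lambda>c. \<Sum>w\<in>S. c w * K s w)"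
  have quad: "P c + t * col c + cnj t * row c + cnj t * t * K s s \<in> \<real>\<^sub>\<ge>\<^sub>0" for c t
    using insert.prems[unfolded psd_def, rule_format, of "c(s := t)"]
    unfolding psd_insert_expand[OF insert(1,2)] P_def col_def row_def .
  have P: "P c \<in> \<real>\<^sub>\<ge>\<^sub>0" for c using quad[of c 0] by simp
  have Kss: "K s s \<in> \<real>\<^sub>\<ge>\<^sub>0" using quad[of "\<lambda>_. 0" 1] by (simp add: P_def col_def row_def)
  define d where "d = Re (K s s)"
  have d: "d \<ge> 0" "K s s = complex_of_real d"
    using Kss by (auto simp: d_def complex_nonneg_Reals_iff complex_eq_iff)
  have row_col: "row c = cnj (col c)" and bound: "(cmod (col c))\<^sup>2 \<le> Re (P c) * d" for c
    using nonneg_quadratic_complex[OF quad P Kss] by (simp_all add: d_def)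
  have Ksw: "K w s = cnj (K s w)" if "w \<in> S" for w
    using row_col[of "\<lambda>v. if v = w then 1 else 0"] insert(1) that
    by (simp add: row_def col_def if_distrib if_distribR cong: if_cong)
  \<comment> \<open>For d = 0 division by zero makes \<open>k\<close> zero. This is consistent with
    \<open>K\<close>, because a zero diagonal entry forces a zero row.\<close>
  define k where "k = (\<lambda>w. K s w / complex_of_real (sqrt d))"
  define K' where "K' = (\<lambda>v w. K v w - cnj (k v) * k w)"
  have sq: "complex_of_real (sqrt d) * complex_of_real (sqrt d) = complex_of_real d"
    using d by (simp flip: of_real_mult)
  have zero: "K s w = 0" if "d = 0" "w \<in> insert s S" for w
  proof (cases "w = s")
    case False
    then have "w \<in> S" using that by simp
    moreover have "cmod (col (\<lambda>v. if v = w then 1 else 0)) = 0"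
      using bound[of "\<lambda>v. if v = w then 1 else 0"] that(1) by simp
    ultimately have "K w s = 0" using insert(1) by (simp add: col_def if_distrib if_distribR cong: if_cong)
    then show ?thesis using Ksw[OF \<open>w \<in> S\<close>] by (metis complex_cnj_zero_iff)
  qed (use that d in simp)
  have ks: "cnj (k s) * k w = K s w" if "w \<in> insert s S" for w
    using zero[OF _ that] d(1) sq by (cases "d = 0") (auto simp: k_def d(2) field_simps)
  have ks': "cnj (k v) * k s = K v s" if "v \<in> S" for v
    using zero[of v] Ksw[OF that] that d(1) sq by (cases "d = 0") (auto simp: k_def d(2) field_simps)
  have "psd S K'"
    unfolding psd_def
  proof
    fix c
    have kk: "cnj (k v) * k w = cnj (K s v) * K s w / complex_of_real d" for v w
      using sq d(1) by (simp add: k_def)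
    have "(\<Sum>v\<in>S. \<Sum>w\<in>S. cnj (c v) * c w * K' v w) =
        P c - (\<Sum>v\<in>S. \<Sum>w\<in>S. cnj (c v * K s v) * (c w * K s w)) / complex_of_real d"
      unfolding K'_def kk P_def
      by (simp add: algebra_simps sum_subtractf sum_divide_distrib)
    also have "(\<Sum>v\<in>S. \<Sum>w\<in>S. cnj (c v * K s v) * (c w * K s w)) = cnj (row c) * row c"
      unfolding row_def cnj_sum sum_product ..
    also have "cnj (row c) * row c = complex_of_real ((cmod (col c))\<^sup>2)"
      using complex_norm_square[of "col c"] row_col[of c] by (simp add: mult.commute)
    also have "P c - complex_of_real ((cmod (col c))\<^sup>2) / complex_of_real d =
        complex_of_real (Re (P c) - (cmod (col c))\<^sup>2 / d)"
      using P[of c] by (simp add: complex_nonneg_Reals_iff complex_eq_iff)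
    also have "\<dots> \<in> \<real>\<^sub>\<ge>\<^sub>0"
      using bound[of c] d(1) P[of c]
      by (cases "d = 0") (auto simp: complex_nonneg_Reals_iff field_simps simp del: of_real_diff of_real_divide)
    finally show "(\<Sum>v\<in>S. \<Sum>w\<in>S. cnj (c v) * c w * K' v w) \<in> \<real>\<^sub>\<ge>\<^sub>0" .
  qed
  from insert.IH[OF this] obtain N :: nat and g where
    g: "\<And>v w. v \<in> S \<Longrightarrow> w \<in> S \<Longrightarrow> K' v w = (\<Sum>r<N. cnj (g r v) * g r w)" by blast
  define g' where "g' = (\<lambda>r v. if r = N then k v else if v = s then 0 else g r v)"
  have "K v w = (\<Sum>r<Suc N. cnj (g' r v) * g' r w)" if vw: "v \<in> insert s S" "w \<in> insert s S" for v w
  proof -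
    have "(\<Sum>r<N. cnj (g' r v) * g' r w) = (if v = s \<or> w = s then 0 else K' v w)"
    proof (cases "v = s \<or> w = s")
      case True
      then show ?thesis by (auto intro!: sum.neutral simp: g'_def)
    next
      case False
      then show ?thesis using g[of v w] vw by (auto intro!: sum.cong simp: g'_def)
    qed
    then show ?thesis using ks[of w] ks'[of v] vw by (auto simp: g'_def K'_def)
  qed
  then show ?case by blast
qed auto

text \<open>Once \<open>K\<close> is decomposed, the form of the product at \<open>c\<close> is the
  sum over \<open>r\<close> of the form of \<open>L\<close> at the vectors
  \<open>\<lambda>v. c v * g r v\<close>.\<close>

lemma schur_product:
  assumes "finite S" "psd S K" "psd S L"
  shows "psd S (\<lambda>v w. K v w * L v w)"
proof -
  obtain N :: nat and g where g: "\<And>v w. v \<in> S \<Longrightarrow> w \<in> S \<Longrightarrow> K v w = (\<Sum>r<N. cnj (g r v) * g r w)"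
    using psd_decomposition[OF assms(1,2)] by blast
  show ?thesis unfolding psd_def
  proof
    fix c
    have "(\<Sum>v\<in>S. \<Sum>w\<in>S. cnj (c v) * c w * (K v w * L v w)) =
        (\<Sum>v\<in>S. \<Sum>w\<in>S. \<Sum>r<N. cnj (c v * g r v) * (c w * g r w) * L v w)"
      by (intro sum.cong) (simp_all add: g sum_distrib_left sum_distrib_right mult_ac)
    also have "\<dots> = (\<Sum>v\<in>S. \<Sum>r<N. \<Sum>w\<in>S. cnj (c v * g r v) * (c w * g r w) * L v w)"
      by (rule sum.cong[OF HOL.refl], rule sum.swap)
    also have "\<dots> = (\<Sum>r<N. \<Sum>v\<in>S. \<Sum>w\<in>S. cnj (c v * g r v) * (c w * g r w) * L v w)"
      by (rule sum.swap)
    also have "\<dots> \<in> \<real>\<^sub>\<ge>\<^sub>0"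
      by (rule nonneg_Reals_sum)
        (use assms(3)[unfolded psd_def, rule_format, of "\<lambda>v. c v * g _ v"] in simp)
    finally show "(\<Sum>v\<in>S. \<Sum>w\<in>S. cnj (c v) * c w * (K v w * L v w)) \<in> \<real>\<^sub>\<ge>\<^sub>0" .
  qed
qed

text \<open>The double sum is the value of \<open>\<phi>\<close> at the adjoint of a vector times
  this vector, the combination of the \<open>a v\<close> with coefficients
  \<open>c v\<close>.\<close>

lemma (in star_alg) psd_form:
  assumes \<phi>: "positive_form A \<phi>" and "finite S" "\<And>v. v \<in> S \<Longrightarrow> a v \<in> carrier A"
  shows "psd S (\<lambda>v w. \<phi> (star A (a v) \<otimes> a w))"
  unfolding psd_def
proof
  fix c
  note add = positive_formD(1)[OF \<phi>] and scale = positive_formD(2)[OF \<phi>]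
  have "\<exists>s\<in>carrier A. (\<forall>b\<in>carrier A. \<phi> (star A s \<otimes> b) = (\<Sum>v\<in>S. cnj (c v) * \<phi> (star A (a v) \<otimes> b))) \<and>
      (\<forall>b\<in>carrier A. \<phi> (b \<otimes> s) = (\<Sum>v\<in>S. c v * \<phi> (b \<otimes> a v)))"
    using assms(2,3)
  proof (induction S rule: finite_induct)
    case empty
    have "\<phi> \<zero> = 0" using scale[of \<zero> 0] by simp
    then show ?case by (intro bexI[of _ \<zero>]) auto
  next
    case (insert v S)
    then obtain s where s: "s \<in> carrier A"
      "\<And>b. b \<in> carrier A \<Longrightarrow> \<phi> (star A s \<otimes> b) = (\<Sum>v\<in>S. cnj (c v) * \<phi> (star A (a v) \<otimes> b))"
      "\<And>b. b \<in> carrier A \<Longrightarrow> \<phi> (b \<otimes> s) = (\<Sum>v\<in>S. c v * \<phi> (b \<otimes> a v))" by auto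
    show ?case
      by (rule bexI[of _ "c v \<odot> a v \<oplus> s"])
        (use insert s in \<open>auto simp: star_add star_smult l_distr r_distr smult_mult_left smult_mult_right add scale\<close>)
  qed
  then obtain s where s: "s \<in> carrier A"
    "\<And>b. b \<in> carrier A \<Longrightarrow> \<phi> (star A s \<otimes> b) = (\<Sum>v\<in>S. cnj (c v) * \<phi> (star A (a v) \<otimes> b))"
    "\<And>b. b \<in> carrier A \<Longrightarrow> \<phi> (b \<otimes> s) = (\<Sum>v\<in>S. c v * \<phi> (b \<otimes> a v))" by auto
  have "\<phi> (star A s \<otimes> s) = (\<Sum>v\<in>S. cnj (c v) * (\<Sum>w\<in>S. c w * \<phi> (star A (a v) \<otimes> a w)))"
    unfolding s(2)[OF s(1)] using s(3) assms(3) by (intro sum.cong) auto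
  then show "(\<Sum>v\<in>S. \<Sum>w\<in>S. cnj (c v) * c w * \<phi> (star A (a v) \<otimes> a w)) \<in> \<real>\<^sub>\<ge>\<^sub>0"
    using positive_formD(3)[OF \<phi> s(1)] by (simp add: sum_distrib_left mult_ac)
qed

lemma (in star_monoid) pairing_star_mult:
  assumes "f \<in> carrier F" "g \<in> carrier F"
  shows "pairing (star F f \<otimes>\<^bsub>F\<^esub> g) \<chi> =
    (\<Sum>v | f v \<noteq> 0. \<Sum>w | g w \<noteq> 0. cnj (f v) * g w * \<chi> (mstar M v \<otimes> w))"
  using assms
  by (simp add: pairing_mult star_closed_F pairing_star) (simp add: pairing_def sum_distrib_left mult_ac)

lemma star_monoid_prod:
  assumes "star_alg A" "star_alg B"
  shows "star_monoid (prod_star_monoid A B)"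
proof -
  interpret A: star_alg A by fact
  interpret B: star_alg B by fact
  show ?thesis
    by unfold_locales (auto simp: prod_star_monoid_def A.m_assoc B.m_assoc A.star_mult B.star_mult)
qed

text \<open>The two states make the supremum in \<open>min_seminorm\<close> range over a nonempty
  set.\<close>

locale min_tensor_product =
  A: cstar_seminormed A "cnorm A" + B: cstar_seminormed B "cnorm B"
  for A :: "'a normed_star_algebra" and B :: "'b normed_star_algebra" +
  assumes state_A: "\<exists>\<phi>. state A \<phi>" and state_B: "\<exists>\<psi>. state B \<psi>"
begin

sublocale AB: star_monoid "prod_star_monoid A B"
  by (rule star_monoid_prod) (rule A.star_alg_axioms B.star_alg_axioms)+

abbreviation "FT \<equiv> star_monoid_algebra (prod_star_monoid A B)"

sublocale FT: star_alg FT
  by (rule AB.star_alg_F)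

lemma FT_eq: "formal_tensor A B = FT"
  by (simp add: formal_tensor_def)

lemma tensor_form_eq: "tensor_form \<phi> \<psi> = (\<lambda>x. pairing x (\<lambda>(a, b). \<phi> a * \<psi> b))"
  unfolding tensor_form_def pairing_def by (intro ext sum.cong) (auto simp: mult_ac)

lemma carrier_AB: "carrier (prod_star_monoid A B) = carrier A \<times> carrier B"
  by (simp add: prod_star_monoid_def)

lemma positive_tensor_form:
  assumes "positive_form A \<phi>" "positive_form B \<psi>"
  shows "positive_form FT (tensor_form \<phi> \<psi>)"
  unfolding positive_form_def
proof (intro conjI ballI allI)
  fix x assume x: "x \<in> carrier FT"
  let ?S = "{w. x w \<noteq> 0}"
  have S: "finite ?S" "fst v \<in> carrier A" "snd v \<in> carrier B" if "v \<in> ?S" for v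
    using AB.finite_supp[OF x] AB.supp_closed[OF x, of v] that by (auto simp: carrier_AB)
  have fin: "finite ?S" using AB.finite_supp[OF x] .
  have "psd ?S (\<lambda>v w. \<phi> (star A (fst v) \<otimes>\<^bsub>A\<^esub> fst w) * \<psi> (star B (snd v) \<otimes>\<^bsub>B\<^esub> snd w))"
    by (intro schur_product A.psd_form B.psd_form assms fin S)
  then have "(\<Sum>v\<in>?S. \<Sum>w\<in>?S. cnj (x v) * x w *
      (\<phi> (star A (fst v) \<otimes>\<^bsub>A\<^esub> fst w) * \<psi> (star B (snd v) \<otimes>\<^bsub>B\<^esub> snd w))) \<in> \<real>\<^sub>\<ge>\<^sub>0"
    unfolding psd_def by blast
  then show "tensor_form \<phi> \<psi> (star FT x \<otimes>\<^bsub>FT\<^esub> x) \<in> \<real>\<^sub>\<ge>\<^sub>0"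
    unfolding tensor_form_eq AB.pairing_star_mult[OF x x]
    by (simp add: prod_star_monoid_def case_prod_unfold)
qed (simp_all add: tensor_form_eq AB.pairing_add AB.pairing_smult)

definition tensor_states where "tensor_states = {tensor_form \<phi> \<psi> | \<phi> \<psi>. state A \<phi> \<and> state B \<psi>}"

sublocale gns FT tensor_states "weighted_l1 (\<lambda>(a, b). cnorm A a * cnorm B b)"
proof
  let ?\<omega> = "\<lambda>(a, b). cnorm A a * cnorm B b"
  fix f assume f: "f \<in> carrier FT"
  show "weighted_l1 ?\<omega> (star FT f) = weighted_l1 ?\<omega> f"
    by (rule AB.weighted_l1_star[OF f]) (auto simp: prod_star_monoid_def)
  show "cmod (\<chi> f) \<le> weighted_l1 ?\<omega> f" if state: "\<chi> \<in> tensor_states" for \<chi>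
  proof -
    obtain \<phi> \<psi> where \<chi>: "\<chi> = tensor_form \<phi> \<psi>" "state A \<phi>" "state B \<psi>"
      using state unfolding tensor_states_def by blast
    show ?thesis unfolding \<chi>(1) tensor_form_eq
      by (rule AB.cmod_pairing_le[OF f])
        (use \<chi> in \<open>auto simp: carrier_AB state_def norm_mult intro!: mult_mono\<close>)
  qed
next
  let ?\<omega> = "\<lambda>(a, b). cnorm A a * cnorm B b"
  fix f g assume fg: "f \<in> carrier FT" "g \<in> carrier FT"
  show "weighted_l1 ?\<omega> (f \<otimes>\<^bsub>FT\<^esub> g) \<le> weighted_l1 ?\<omega> f * weighted_l1 ?\<omega> g"
  proof (rule AB.weighted_l1_mult[OF fg])
    fix v w assume vw: "v \<in> carrier (prod_star_monoid A B)" "w \<in> carrier (prod_star_monoid A B)"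
    then obtain a b c d where *: "v = (a, b)" "w = (c, d)" "a \<in> carrier A" "b \<in> carrier B"
      "c \<in> carrier A" "d \<in> carrier B" by (auto simp: carrier_AB)
    have "cnorm A (a \<otimes>\<^bsub>A\<^esub> c) * cnorm B (b \<otimes>\<^bsub>B\<^esub> d) \<le> (cnorm A a * cnorm A c) * (cnorm B b * cnorm B d)"
      using * by (intro mult_mono A.p_mult B.p_mult) auto
    then show "?\<omega> (v \<otimes>\<^bsub>prod_star_monoid A B\<^esub> w) \<le> ?\<omega> v * ?\<omega> w"
      using * by (simp add: prod_star_monoid_def mult_ac)
  qed (auto simp: carrier_AB)
next
  show "\<exists>\<chi>\<in>tensor_states. \<chi> \<one>\<^bsub>FT\<^esub> = 1"
  proof -
    obtain \<phi> \<psi> where "state A \<phi>" "state B \<psi>" using state_A state_B by blast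
    moreover from this have "tensor_form \<phi> \<psi> \<one>\<^bsub>FT\<^esub> = 1"
      unfolding tensor_form_eq AB.F_one AB.pairing_basis_elem
      by (simp add: prod_star_monoid_def state_def)
    ultimately show ?thesis unfolding tensor_states_def by blast
  qed
qed (auto simp: tensor_states_def state_def intro!: positive_tensor_form)

text \<open>Reindexing by product states identifies the defining formula with the operator seminorm
  of \<open>gns\<close>, from which the C*-property is inherited.\<close>

lemma min_seminorm_eq: "min_seminorm A B = gns_norm"
proof
  fix x
  define f where "f = (\<lambda>\<chi> y. sqrt (Re (\<chi> (star FT (x \<otimes>\<^bsub>FT\<^esub> y) \<otimes>\<^bsub>FT\<^esub> (x \<otimes>\<^bsub>FT\<^esub> y)))))"
  define I where "I = {(\<phi>, \<psi>, y). state A \<phi> \<and> state B \<psi> \<and> y \<in> carrier FT \<and>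
    tensor_form \<phi> \<psi> (star FT y \<otimes>\<^bsub>FT\<^esub> y) = 1}"
  have "unit_vectors = (\<lambda>(\<phi>, \<psi>, y). (tensor_form \<phi> \<psi>, y)) ` I"
    unfolding unit_vectors_def I_def unfolding tensor_states_def by (auto simp: image_iff) blast
  then have "(\<lambda>(\<chi>, y). f \<chi> y) ` unit_vectors = (\<lambda>(\<phi>, \<psi>, y). f (tensor_form \<phi> \<psi>) y) ` I"
    by (simp add: image_image case_prod_unfold)
  then have "(SUP (\<phi>, \<psi>, y)\<in>I. f (tensor_form \<phi> \<psi>) y) = (SUP (\<chi>, y)\<in>unit_vectors. f \<chi> y)" by simp
  then show "min_seminorm A B x = gns_norm x"
    by (simp add: min_seminorm_def FT_eq Let_def gns_norm_def f_def I_def)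
qed

sublocale MS: cstar_seminormed FT "min_seminorm A B"
  by unfold_locales (simp add: min_seminorm_eq cstar_seminorm_gns)

lemma min_tensor_eq: "min_tensor A B = completion FT (min_seminorm A B)"
  by (simp add: min_tensor_def FT_eq)

lemma elem_tensor_eq: "elem_tensor A B a b = embed FT (min_seminorm A B) (basis_elem (a, b))"
  by (simp add: elem_tensor_def FT_eq)

end

section \<open>Representations of the orthogonality relations\<close>

lemma pairing_sum_right: "pairing f (\<lambda>w. \<Sum>k\<in>I. g k w) = (\<Sum>k\<in>I. pairing f (g k))"
  unfolding pairing_def sum_distrib_left by (rule sum.swap)

lemma (in star_monoid) finsum_F:
  assumes "finite I" "\<And>i. i \<in> I \<Longrightarrow> f i \<in> carrier F"
  shows "(\<Oplus>\<^bsub>F\<^esub>i\<in>I. f i) = (\<lambda>w. \<Sum>i\<in>I. f i w)"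
proof -
  interpret star_alg F by (rule star_alg_F)
  from assms show ?thesis
  proof (induction I rule: finite_induct)
    case (insert i I)
    have "finsum F f (insert i I) = f i \<oplus>\<^bsub>F\<^esub> finsum F f I"
      using insert by (intro finsum_insert) auto
    then show ?case using insert by (simp add: F_add)
  qed (simp add: F_zero)
qed

context Ao_algebra
begin

lemma M_Nil [simp]: "[] \<in> carrier M"
  by (simp add: carrier_M)

lemma M_Cons [simp]: "((i, j), b) # w \<in> carrier M \<longleftrightarrow> i \<in> {1..n} \<and> j \<in> {1..n} \<and> w \<in> carrier M"
  by (auto simp: carrier_M Ao_index_def)

lemma M_append [simp]: "v @ w \<in> carrier M \<longleftrightarrow> v \<in> carrier M \<and> w \<in> carrier M"
  by (simp add: carrier_M)

lemma pairing_one: "pairing \<one>\<^bsub>FA\<^esub> g = g []"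
  by (simp add: M.F_one one_M)

lemma pairing_minus:
  "f \<in> carrier FA \<Longrightarrow> g \<in> carrier FA \<Longrightarrow> pairing (f \<ominus>\<^bsub>FA\<^esub> g) \<phi> = pairing f \<phi> - pairing g \<phi>"
  by (simp add: FA.minus_eq_smult M.pairing_add M.pairing_smult)

lemma gen_mult:
  assumes "i \<in> {1..n}" "j \<in> {1..n}" "k \<in> {1..n}" "l \<in> {1..n}"
  shows "free_gen (i, j) \<otimes>\<^bsub>FA\<^esub> free_gen (k, l) = basis_elem [((i, j), False), ((k, l), False)]"
  unfolding free_gen_def using assms by (subst M.mult_basis_elem) (simp_all add: mult_M)

lemma pairing_finsum_gen:
  assumes "\<And>k. k \<in> {1..n} \<Longrightarrow> a k \<in> {1..n} \<and> b k \<in> {1..n} \<and> c k \<in> {1..n} \<and> d k \<in> {1..n}"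
  shows "(\<Oplus>\<^bsub>FA\<^esub>k\<in>{1..n}. free_gen (a k, b k) \<otimes>\<^bsub>FA\<^esub> free_gen (c k, d k)) \<in> carrier FA"
    and "pairing (\<Oplus>\<^bsub>FA\<^esub>k\<in>{1..n}. free_gen (a k, b k) \<otimes>\<^bsub>FA\<^esub> free_gen (c k, d k)) g =
      (\<Sum>k\<in>{1..n}. g [((a k, b k), False), ((c k, d k), False)])"
proof -
  have closed: "free_gen (a k, b k) \<otimes>\<^bsub>FA\<^esub> free_gen (c k, d k) \<in> carrier FA" if "k \<in> {1..n}" for k
    using assms[OF that] gen_closed by blast
  show "(\<Oplus>\<^bsub>FA\<^esub>k\<in>{1..n}. free_gen (a k, b k) \<otimes>\<^bsub>FA\<^esub> free_gen (c k, d k)) \<in> carrier FA"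
    by (rule FA.finsum_closed) (use closed in blast)
  have "(\<Oplus>\<^bsub>FA\<^esub>k\<in>{1..n}. free_gen (a k, b k) \<otimes>\<^bsub>FA\<^esub> free_gen (c k, d k)) =
      (\<lambda>w. \<Sum>k\<in>{1..n}. 1 * (free_gen (a k, b k) \<otimes>\<^bsub>FA\<^esub> free_gen (c k, d k)) w)"
    using M.finsum_F[of "{1..n}" "\<lambda>k. free_gen (a k, b k) \<otimes>\<^bsub>FA\<^esub> free_gen (c k, d k)"] closed by simp
  then show "pairing (\<Oplus>\<^bsub>FA\<^esub>k\<in>{1..n}. free_gen (a k, b k) \<otimes>\<^bsub>FA\<^esub> free_gen (c k, d k)) g =
      (\<Sum>k\<in>{1..n}. g [((a k, b k), False), ((c k, d k), False)])"
    using M.pairing_sum[of "{1..n}" "\<lambda>k. free_gen (a k, b k) \<otimes>\<^bsub>FA\<^esub> free_gen (c k, d k)" "\<lambda>_. 1" g] closed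
      gen_mult assms by simp
qed

lemma relations_closed: "r \<in> Ao_relations n \<Longrightarrow> r \<in> carrier FA"
  unfolding Ao_relations_def FA_eq Let_def
  by (elim UnE CollectE exE conjE)
    (use gen_closed pairing_finsum_gen(1) in \<open>auto intro!: FA.minus_closed simp del: atLeastAtMost_iff\<close>)

text \<open>Each relation is a combination of words of length at most two, so only such words have
  to be checked; this is the form in which a representation is given by its action on
  generators.\<close>

lemma pairing_relation:
  assumes "r \<in> Ao_relations n"
    and "\<And>i j. i \<in> {1..n} \<Longrightarrow> j \<in> {1..n} \<Longrightarrow> g [((i, j), False)] = g [((i, j), True)]"
    and "\<And>i j. i \<in> {1..n} \<Longrightarrow> j \<in> {1..n} \<Longrightarrow>
      (\<Sum>k\<in>{1..n}. g [((i, k), False), ((j, k), False)]) = of_bool (i = j) * g []"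
    and "\<And>i j. i \<in> {1..n} \<Longrightarrow> j \<in> {1..n} \<Longrightarrow>
      (\<Sum>k\<in>{1..n}. g [((k, i), False), ((k, j), False)]) = of_bool (i = j) * g []"
  shows "pairing r g = 0"
proof -
  have \<delta>: "(if i = j then \<one>\<^bsub>FA\<^esub> else \<zero>\<^bsub>FA\<^esub>) \<in> carrier FA"
    "pairing (if i = j then \<one>\<^bsub>FA\<^esub> else \<zero>\<^bsub>FA\<^esub>) g = of_bool (i = j) * g []" for i j :: nat
    by (simp_all add: pairing_one) (simp add: M.F_zero)
  from assms(1) consider
    (sa) i j where "i \<in> {1..n}" "j \<in> {1..n}" "r = free_gen (i, j) \<ominus>\<^bsub>FA\<^esub> star FA (free_gen (i, j))"
  | (row) i j where "i \<in> {1..n}" "j \<in> {1..n}"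
      "r = (\<Oplus>\<^bsub>FA\<^esub>k\<in>{1..n}. free_gen (i, k) \<otimes>\<^bsub>FA\<^esub> free_gen (j, k)) \<ominus>\<^bsub>FA\<^esub> (if i = j then \<one>\<^bsub>FA\<^esub> else \<zero>\<^bsub>FA\<^esub>)"
  | (col) i j where "i \<in> {1..n}" "j \<in> {1..n}"
      "r = (\<Oplus>\<^bsub>FA\<^esub>k\<in>{1..n}. free_gen (k, i) \<otimes>\<^bsub>FA\<^esub> free_gen (k, j)) \<ominus>\<^bsub>FA\<^esub> (if i = j then \<one>\<^bsub>FA\<^esub> else \<zero>\<^bsub>FA\<^esub>)"
    unfolding Ao_relations_def FA_eq Let_def by blast
  then show ?thesis
  proof cases
    case sa
    have "star FA (free_gen (i, j)) = basis_elem [((i, j), True)]"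
      unfolding free_gen_def using sa
      by (subst M.star_basis_elem) (simp_all, simp add: M_def free_star_monoid_def)
    then have "pairing r g = g [((i, j), False)] - g [((i, j), True)]"
      using sa gen_closed[OF sa(1,2)] by (simp add: pairing_minus) (simp add: free_gen_def)
    then show ?thesis using assms(2)[OF sa(1,2)] by simp
  next
    case row
    then show ?thesis
      using pairing_finsum_gen[of "\<lambda>_. i" "\<lambda>k. k" "\<lambda>_. j" "\<lambda>k. k"] \<delta>[of i j] assms(3)[of i j]
      by (simp add: pairing_minus)
  next
    case col
    then show ?thesis
      using pairing_finsum_gen[of "\<lambda>k. k" "\<lambda>_. i" "\<lambda>k. k" "\<lambda>_. j"] \<delta>[of i j] assms(4)[of i j]
      by (simp add: pairing_minus)
  qed
qed

text \<open>A representation is given by its matrix coefficients \<open>\<psi> c w\<close>, the component along the basis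
  vector \<open>c\<close> of the image of a fixed unit vector under the word \<open>w\<close>; \<open>\<phi>\<close> is the vector state.\<close>

lemma
  fixes \<psi> :: "'c \<Rightarrow> ((nat \<times> nat) \<times> bool) list \<Rightarrow> complex"
  assumes gram: "\<And>W. finite W \<Longrightarrow> W \<subseteq> carrier M \<Longrightarrow> \<exists>T. finite T \<and>
      (\<forall>v\<in>W. \<forall>w\<in>W. \<phi> (mstar M v @ w) = (\<Sum>c\<in>T. cnj (\<psi> c v) * \<psi> c w)) \<and>
      (\<forall>c. c \<notin> T \<longrightarrow> (\<forall>v\<in>W. \<psi> c v = 0))"
    and bound: "\<And>w. w \<in> carrier M \<Longrightarrow> cmod (\<phi> w) \<le> 1" and one: "\<phi> [] = 1"
    and rel: "\<And>c i j w. i \<in> {1..n} \<Longrightarrow> j \<in> {1..n} \<Longrightarrow> w \<in> carrier M \<Longrightarrow>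
      \<psi> c (((i, j), False) # w) = \<psi> c (((i, j), True) # w)"
      "\<And>c i j w. i \<in> {1..n} \<Longrightarrow> j \<in> {1..n} \<Longrightarrow> w \<in> carrier M \<Longrightarrow>
        (\<Sum>k\<in>{1..n}. \<psi> c (((i, k), False) # ((j, k), False) # w)) = of_bool (i = j) * \<psi> c w"
      "\<And>c i j w. i \<in> {1..n} \<Longrightarrow> j \<in> {1..n} \<Longrightarrow> w \<in> carrier M \<Longrightarrow>
        (\<Sum>k\<in>{1..n}. \<psi> c (((k, i), False) # ((k, j), False) # w)) = of_bool (i = j) * \<psi> c w"
    and x: "x \<in> carrier FA"
  shows vector_state_le: "Re (pairing (star FA x \<otimes>\<^bsub>FA\<^esub> x) \<phi>) \<le> (U x)\<^sup>2"
    and U_zero_imp: "U x = 0 \<Longrightarrow> pairing x (\<psi> c) = 0"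
proof -
  \<comment> \<open>Applying \<open>f\<close> to the fixed vector gives a vector with components
    \<open>pairing f (\<psi> c)\<close>, and the vector state of
    \<open>star FA f \<otimes> f\<close> is its squared length. The hypothesis \<open>gram\<close>
    on the finite support of \<open>f\<close> supplies a finite index set \<open>T\<close>.\<close>
  have square: "\<exists>T. finite T \<and> pairing (star FA f \<otimes>\<^bsub>FA\<^esub> f) \<phi> =
      complex_of_real (\<Sum>c\<in>T. (cmod (pairing f (\<psi> c)))\<^sup>2) \<and> (\<forall>c. c \<notin> T \<longrightarrow> pairing f (\<psi> c) = 0)"
    if f: "f \<in> carrier FA" for f
  proof -
    let ?W = "{w. f w \<noteq> 0}"
    have "finite ?W" "?W \<subseteq> carrier M" using f M.supp_closed by auto
    from gram[OF this] obtain T where T: "finite T"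
      "\<And>v w. v \<in> ?W \<Longrightarrow> w \<in> ?W \<Longrightarrow> \<phi> (mstar M v @ w) = (\<Sum>c\<in>T. cnj (\<psi> c v) * \<psi> c w)"
      "\<And>c v. c \<notin> T \<Longrightarrow> v \<in> ?W \<Longrightarrow> \<psi> c v = 0" by blast
    have "pairing (star FA f \<otimes>\<^bsub>FA\<^esub> f) \<phi> =
        (\<Sum>v\<in>?W. \<Sum>w\<in>?W. cnj (f v) * f w * (\<Sum>c\<in>T. cnj (\<psi> c v) * \<psi> c w))"
      unfolding M.pairing_star_mult[OF f f] mult_M by (intro sum.cong) (simp_all add: T(2))
    also have "\<dots> = (\<Sum>v\<in>?W. \<Sum>w\<in>?W. \<Sum>c\<in>T. cnj (f v * \<psi> c v) * (f w * \<psi> c w))"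
      by (simp add: sum_distrib_left mult_ac)
    also have "\<dots> = (\<Sum>v\<in>?W. \<Sum>c\<in>T. \<Sum>w\<in>?W. cnj (f v * \<psi> c v) * (f w * \<psi> c w))"
      by (rule sum.cong[OF HOL.refl], rule sum.swap)
    also have "\<dots> = (\<Sum>c\<in>T. \<Sum>v\<in>?W. \<Sum>w\<in>?W. cnj (f v * \<psi> c v) * (f w * \<psi> c w))"
      by (rule sum.swap)
    also have "\<dots> = (\<Sum>c\<in>T. cnj (pairing f (\<psi> c)) * pairing f (\<psi> c))"
      unfolding pairing_def cnj_sum sum_product ..
    also have "\<dots> = complex_of_real (\<Sum>c\<in>T. (cmod (pairing f (\<psi> c)))\<^sup>2)"
      unfolding of_real_sum complex_norm_square by (simp add: mult.commute)
    finally have "pairing (star FA f \<otimes>\<^bsub>FA\<^esub> f) \<phi> =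
        complex_of_real (\<Sum>c\<in>T. (cmod (pairing f (\<psi> c)))\<^sup>2)" .
    moreover have "pairing f (\<psi> c) = 0" if "c \<notin> T" for c
      unfolding pairing_def using T(3)[OF that] by (intro sum.neutral) auto
    ultimately show ?thesis using T(1) by blast
  qed
  have pos: "positive_form FA (\<lambda>f. pairing f \<phi>)"
    unfolding positive_form_def
  proof (intro conjI ballI allI)
    fix f assume "f \<in> carrier FA"
    from square[OF this] show "pairing (star FA f \<otimes>\<^bsub>FA\<^esub> f) \<phi> \<in> \<real>\<^sub>\<ge>\<^sub>0"
      by (auto simp del: of_real_sum intro!: sum_nonneg)
  qed (simp_all add: M.pairing_add M.pairing_smult)
  show le: "Re (pairing (star FA x \<otimes>\<^bsub>FA\<^esub> x) \<phi>) \<le> (U x)\<^sup>2"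
  proof (rule U_lower[OF pos bound one _ x])
    fix r y assume r: "r \<in> Ao_relations n" and y: "y \<in> carrier FA"
    have "pairing (r \<otimes>\<^bsub>FA\<^esub> y) (\<psi> c) = 0" for c
      unfolding M.pairing_mult[OF relations_closed[OF r] y] mult_M
    proof (rule pairing_relation[OF r])
      fix i j assume ij: "i \<in> {1..n}" "j \<in> {1..n}"
      show "pairing y (\<lambda>b. \<psi> c ([((i, j), False)] @ b)) = pairing y (\<lambda>b. \<psi> c ([((i, j), True)] @ b))"
        using rel(1)[OF ij] M.supp_closed[OF y] by (intro pairing_cong) simp
      show "(\<Sum>k\<in>{1..n}. pairing y (\<lambda>b. \<psi> c ([((i, k), False), ((j, k), False)] @ b))) =
          of_bool (i = j) * pairing y (\<lambda>b. \<psi> c ([] @ b))"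
        unfolding pairing_sum_right[symmetric] pairing_cmult_right[symmetric]
        using rel(2)[OF ij] M.supp_closed[OF y] by (intro pairing_cong) simp
      show "(\<Sum>k\<in>{1..n}. pairing y (\<lambda>b. \<psi> c ([((k, i), False), ((k, j), False)] @ b))) =
          of_bool (i = j) * pairing y (\<lambda>b. \<psi> c ([] @ b))"
        unfolding pairing_sum_right[symmetric] pairing_cmult_right[symmetric]
        using rel(3)[OF ij] M.supp_closed[OF y] by (intro pairing_cong) simp
    qed
    then show "pairing (star FA (r \<otimes>\<^bsub>FA\<^esub> y) \<otimes>\<^bsub>FA\<^esub> (r \<otimes>\<^bsub>FA\<^esub> y)) \<phi> = 0"
      using square[of "r \<otimes>\<^bsub>FA\<^esub> y"] relations_closed[OF r] y by auto
  qed
  show "pairing x (\<psi> c) = 0" if "U x = 0"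
  proof -
    obtain T where T: "finite T" "pairing (star FA x \<otimes>\<^bsub>FA\<^esub> x) \<phi> =
        complex_of_real (\<Sum>c\<in>T. (cmod (pairing x (\<psi> c)))\<^sup>2)" "c \<notin> T \<longrightarrow> pairing x (\<psi> c) = 0"
      using square[OF x] by blast
    have "(\<Sum>c\<in>T. (cmod (pairing x (\<psi> c)))\<^sup>2) \<le> 0" using le that T(2) by (simp del: of_real_sum)
    then have "(\<Sum>c\<in>T. (cmod (pairing x (\<psi> c)))\<^sup>2) = 0" by (simp add: sum_nonneg antisym)
    then show ?thesis using T(1,3) by (cases "c \<in> T") (auto simp: sum_nonneg_eq_0_iff)
  qed
qed

section \<open>Characters given by orthogonal matrices\<close>

definition orthogonal :: "(nat \<Rightarrow> nat \<Rightarrow> real) \<Rightarrow> bool" where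
  "orthogonal V \<longleftrightarrow> (\<forall>i\<in>{1..n}. \<forall>j\<in>{1..n}.
    (\<Sum>k\<in>{1..n}. V i k * V j k) = of_bool (i = j) \<and> (\<Sum>k\<in>{1..n}. V k i * V k j) = of_bool (i = j))"

definition char_word :: "(nat \<Rightarrow> nat \<Rightarrow> real) \<Rightarrow> ((nat \<times> nat) \<times> bool) list \<Rightarrow> complex" where
  "char_word V w = (\<Prod>((i, j), b)\<leftarrow>w. complex_of_real (V i j))"

lemma char_word_simps [simp]:
  "char_word V [] = 1"
  "char_word V (((i, j), b) # w) = complex_of_real (V i j) * char_word V w"
  "char_word V (v @ w) = char_word V v * char_word V w"
  by (simp_all add: char_word_def)

lemma cnj_char_word [simp]: "cnj (char_word V w) = char_word V w"
  by (induction w) (auto simp: char_word_def)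

lemma char_word_mstar [simp]: "char_word V (mstar M w) = char_word V w"
  by (induction w) (auto simp: M_def free_star_monoid_def char_word_def)

lemma char_word_le_one:
  assumes "orthogonal V" "w \<in> carrier M"
  shows "cmod (char_word V w) \<le> 1"
  using assms(2)
proof (induction w)
  case (Cons x w)
  obtain i j b where x: "x = ((i, j), b)" by (metis surj_pair)
  have ij: "i \<in> {1..n}" "j \<in> {1..n}" using Cons.prems by (auto simp: x)
  have "V i j * V i j \<le> (\<Sum>k\<in>{1..n}. V i k * V i k)"
    by (rule member_le_sum) (use ij in auto)
  then have "(V i j)\<^sup>2 \<le> 1" using assms(1) ij by (simp add: orthogonal_def power2_eq_square)
  then have "\<bar>V i j\<bar> \<le> 1" by (simp add: abs_square_le_1)
  then show ?case using Cons x by (auto simp: norm_mult intro: mult_le_one)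
qed simp

lemma char_word_square:
  assumes "x \<in> carrier FA"
  shows "pairing (star FA x \<otimes>\<^bsub>FA\<^esub> x) (char_word V) = complex_of_real ((cmod (pairing x (char_word V)))\<^sup>2)"
proof -
  have "pairing (star FA x \<otimes>\<^bsub>FA\<^esub> x) (char_word V) = cnj (pairing x (char_word V)) * pairing x (char_word V)"
    unfolding M.pairing_star_mult[OF assms assms] mult_M pairing_def[of x] cnj_sum sum_product
    by (simp add: mult_ac)
  then show ?thesis by (simp only: complex_norm_square mult.commute)
qed

text \<open>A character is a one-dimensional representation: the index type is \<open>unit\<close>,
  and the vector state and the coefficient are both the character.\<close>

lemma character:
  assumes "orthogonal V" "x \<in> carrier FA"
  shows "cmod (pairing x (char_word V)) \<le> U x"
proof -
  have sum: "(\<Sum>k\<in>{1..n}. complex_of_real (V i k) * (complex_of_real (V j k) * c)) = of_bool (i = j) * c"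
    "(\<Sum>k\<in>{1..n}. complex_of_real (V k i) * (complex_of_real (V k j) * c)) = of_bool (i = j) * c"
    if "i \<in> {1..n}" "j \<in> {1..n}" for i j c
  proof -
    have "(\<Sum>k\<in>{1..n}. complex_of_real (V i k) * (complex_of_real (V j k) * c)) =
        complex_of_real (\<Sum>k\<in>{1..n}. V i k * V j k) * c"
      by (simp add: sum_distrib_right mult.assoc)
    then show "(\<Sum>k\<in>{1..n}. complex_of_real (V i k) * (complex_of_real (V j k) * c)) = of_bool (i = j) * c"
      using assms(1) that by (simp add: orthogonal_def del: of_real_sum)
    have "(\<Sum>k\<in>{1..n}. complex_of_real (V k i) * (complex_of_real (V k j) * c)) =
        complex_of_real (\<Sum>k\<in>{1..n}. V k i * V k j) * c"
      by (simp add: sum_distrib_right mult.assoc)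
    then show "(\<Sum>k\<in>{1..n}. complex_of_real (V k i) * (complex_of_real (V k j) * c)) = of_bool (i = j) * c"
      using assms(1) that by (simp add: orthogonal_def del: of_real_sum)
  qed
  have "Re (pairing (star FA x \<otimes>\<^bsub>FA\<^esub> x) (char_word V)) \<le> (U x)\<^sup>2"
  proof (rule vector_state_le[where \<psi> = "\<lambda>_ :: unit. char_word V"])
    show "\<exists>T. finite T \<and>
        (\<forall>v\<in>W. \<forall>w\<in>W. char_word V (mstar M v @ w) = (\<Sum>c :: unit\<in>T. cnj (char_word V v) * char_word V w)) \<and>
        (\<forall>c. c \<notin> T \<longrightarrow> (\<forall>v\<in>W. char_word V v = 0))" for W
      by (rule exI[of _ UNIV]) simp
  qed (use assms sum char_word_le_one in simp_all)
  then have "(cmod (pairing x (char_word V)))\<^sup>2 \<le> (U x)\<^sup>2"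
    unfolding char_word_square[OF assms(2)] by simp
  then show ?thesis using assms(2) by (simp add: power2_le_iff_abs_le)
qed

section \<open>Diagonal matrices over the free product of groups of order two\<close>

definition diag_word :: "((nat \<times> nat) \<times> bool) list \<Rightarrow> bool" where
  "diag_word w \<longleftrightarrow> (\<forall>x\<in>set w. fst (fst x) = snd (fst x))"

definition word_form :: "((nat \<times> nat) \<times> bool) list \<Rightarrow> nat list" where
  "word_form w = reduced_form (map (\<lambda>x. fst (fst x)) w)"

text \<open>Let u_ij act as 0 for i different from j and u_ii as the i-th generator, on the space
  spanned by reduced words. This is the component along \<open>c\<close> of the image of the empty
  word under \<open>w\<close>.\<close>

definition free_coeff :: "nat list \<Rightarrow> ((nat \<times> nat) \<times> bool) list \<Rightarrow> complex" where
  "free_coeff c w = of_bool (diag_word w \<and> word_form w = c)"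

lemma word_form_adj: "distinct_adj (word_form w)"
  unfolding word_form_def reduced_form_def by (rule distinct_adj_foldr_act) simp

lemma free_group_coeff:
  assumes "x \<in> carrier FA" "U x = 0"
  shows "pairing x (free_coeff c) = 0"
proof (rule U_zero_imp[where \<phi> = "free_coeff []"])
  \<comment> \<open>The adjoint of a diagonal \<open>v\<close> acts as its inverse, so the vector
    state detects whether \<open>v\<close> and \<open>w\<close> carry the empty word to the same
    basis vector.\<close>
  have split: "free_coeff [] (mstar M v @ w) =
      of_bool (diag_word v \<and> diag_word w \<and> word_form v = word_form w)" for v w
  proof -
    have "diag_word (mstar M v @ w) \<longleftrightarrow> diag_word v \<and> diag_word w"
      by (force simp: diag_word_def M_def free_star_monoid_def)
    moreover have "word_form (mstar M v @ w) = [] \<longleftrightarrow> word_form v = word_form w"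
    proof -
      let ?v = "map (\<lambda>x. fst (fst x)) v"
      have "map (\<lambda>x. fst (fst x)) (mstar M v) = rev ?v"
        by (simp add: M_def free_star_monoid_def rev_map o_def case_prod_unfold)
      then have "word_form (mstar M v @ w) = foldr act (rev ?v) (word_form w)"
        by (simp add: word_form_def reduced_form_def)
      moreover have "foldr act (rev ?v) (word_form v) = []"
        using foldr_act_rev[of "[]" ?v] by (simp add: word_form_def reduced_form_def)
      moreover have "foldr act ?v (foldr act (rev ?v) (word_form w)) = word_form w"
        using foldr_act_rev[OF word_form_adj, of "rev ?v" w] by simp
      ultimately show ?thesis by (metis word_form_def reduced_form_def)
    qed
    ultimately show ?thesis by (simp add: free_coeff_def)
  qed
  show "\<exists>T. finite T \<and>
      (\<forall>v\<in>W. \<forall>w\<in>W. free_coeff [] (mstar M v @ w) = (\<Sum>c\<in>T. cnj (free_coeff c v) * free_coeff c w)) \<and>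
      (\<forall>c. c \<notin> T \<longrightarrow> (\<forall>v\<in>W. free_coeff c v = 0))" if "finite W" for W
  proof (intro exI[of _ "word_form ` W"] conjI ballI allI impI)
    fix v w assume "v \<in> W" "w \<in> W"
    have "(\<Sum>c\<in>word_form ` W. cnj (free_coeff c v) * free_coeff c w) =
        (\<Sum>c\<in>word_form ` W. if c = word_form v then free_coeff [] (mstar M v @ w) else 0)"
      unfolding split by (rule sum.cong) (auto simp: free_coeff_def)
    then show "free_coeff [] (mstar M v @ w) = (\<Sum>c\<in>word_form ` W. cnj (free_coeff c v) * free_coeff c w)"
      using \<open>v \<in> W\<close> that by simp
  qed (use that in \<open>auto simp: free_coeff_def\<close>)
  show "cmod (free_coeff [] w) \<le> 1" for w by (simp add: free_coeff_def)
  show "free_coeff [] [] = 1" by (simp add: free_coeff_def diag_word_def word_form_def reduced_form_def)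
  show "free_coeff c (((i, j), False) # w) = free_coeff c (((i, j), True) # w)" for c i j w
    by (simp add: free_coeff_def diag_word_def word_form_def)
  \<comment> \<open>Letters off the diagonal act as 0 and a repeated generator as the identity, so
    an orthogonality sum has at most one nonzero term.\<close>
  have two: "free_coeff c (((i, j), False) # ((k, l), False) # w) =
      of_bool (i = j \<and> k = l) * (if i = k then free_coeff c w else free_coeff c (((i, j), False) # ((k, l), False) # w))"
    for c i j k l w
  proof (cases "i = j \<and> k = l \<and> i = k")
    case True
    then have eq: "j = i" "k = i" "l = i" by auto
    have "act i (act i (word_form w)) = word_form w" by (rule act_act[OF word_form_adj])
    then show ?thesis unfolding eq by (simp add: free_coeff_def diag_word_def word_form_def reduced_form_def)
  qed (auto simp: free_coeff_def diag_word_def)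
  show "(\<Sum>k\<in>{1..n}. free_coeff c (((i, k), False) # ((j, k), False) # w)) = of_bool (i = j) * free_coeff c w"
    if "i \<in> {1..n}" for c i j w
  proof -
    have "(\<Sum>k\<in>{1..n}. free_coeff c (((i, k), False) # ((j, k), False) # w)) =
        (\<Sum>k\<in>{1..n}. if k = i then of_bool (i = j) * free_coeff c w else 0)"
      by (rule sum.cong[OF HOL.refl], subst two) auto
    then show ?thesis using that by simp
  qed
  show "(\<Sum>k\<in>{1..n}. free_coeff c (((k, i), False) # ((k, j), False) # w)) = of_bool (i = j) * free_coeff c w"
    if "i \<in> {1..n}" for c i j w
  proof -
    have "(\<Sum>k\<in>{1..n}. free_coeff c (((k, i), False) # ((k, j), False) # w)) =
        (\<Sum>k\<in>{1..n}. if k = i then of_bool (i = j) * free_coeff c w else 0)"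
      by (rule sum.cong[OF HOL.refl], subst two) auto
    then show ?thesis using that by simp
  qed
qed (use assms in auto)

end

section \<open>Haar moments of the first column\<close>

context Ao_algebra
begin

lemma orthogonal_permutation:
  assumes \<pi>: "\<pi> permutes {1..n}"
  shows "orthogonal (\<lambda>i j. of_bool (j = \<pi> i))"
  unfolding orthogonal_def
proof (intro ballI conjI)
  fix i j assume ij: "i \<in> {1..n}" "j \<in> {1..n}"
  have inj: "\<pi> x = \<pi> y \<longleftrightarrow> x = y" for x y using permutes_inj[OF \<pi>] by (simp add: inj_eq)
  have "(\<Sum>k\<in>{1..n}. of_bool (k = \<pi> i) * of_bool (k = \<pi> j) :: real) =
      (\<Sum>k\<in>{1..n}. if k = \<pi> i then of_bool (i = j) else 0)"
    by (rule sum.cong) (simp_all add: inj)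
  then show "(\<Sum>k\<in>{1..n}. of_bool (k = \<pi> i) * of_bool (k = \<pi> j) :: real) = of_bool (i = j)"
    using ij(1) permutes_in_image[OF \<pi>, of i] by simp
  have "(\<Sum>k\<in>{1..n}. of_bool (i = \<pi> k) * of_bool (j = \<pi> k) :: real) =
      (\<Sum>k\<in>{1..n}. of_bool (i = k) * of_bool (j = k))"
    using sum.permute[OF \<pi>, of "\<lambda>k. of_bool (i = k) * of_bool (j = k) :: real"] by (simp add: o_def)
  also have "\<dots> = (\<Sum>k\<in>{1..n}. if k = i then of_bool (i = j) else 0)"
    by (rule sum.cong) auto
  finally show "(\<Sum>k\<in>{1..n}. of_bool (i = \<pi> k) * of_bool (j = \<pi> k) :: real) = of_bool (i = j)"
    using ij(1) by simp
qed

text \<open>The counit, that is the character at the identity matrix, is bounded by \<open>U\<close>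
  and extends to the completion by continuity. The limit is taken along a chosen representative; the
  fact \<open>e\<close> shows that any other gives the same value.\<close>

lemma ex_state: "\<exists>\<phi>. state AO \<phi>"
proof -
  define V where "V = (\<lambda>i j :: nat. of_bool (j = i) :: real)"
  have V: "orthogonal V"
    using orthogonal_permutation[OF permutes_id] by (simp add: V_def)
  define \<tau> where "\<tau> = (\<lambda>x. pairing x (char_word V))"
  have le: "cmod (\<tau> x) \<le> U x" if "x \<in> carrier FA" for x
    unfolding \<tau>_def by (rule character[OF V that])
  have add: "\<tau> (x \<oplus>\<^bsub>FA\<^esub> y) = \<tau> x + \<tau> y" and minus: "\<tau> (x \<ominus>\<^bsub>FA\<^esub> y) = \<tau> x - \<tau> y"
    if "x \<in> carrier FA" "y \<in> carrier FA" for x y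
    using that by (simp_all add: \<tau>_def M.pairing_add pairing_minus)
  have scale: "\<tau> (c \<odot>\<^bsub>FA\<^esub> x) = c * \<tau> x" if "x \<in> carrier FA" for c x
    using that by (simp add: \<tau>_def M.pairing_smult)
  have square: "\<tau> (star FA x \<otimes>\<^bsub>FA\<^esub> x) = complex_of_real ((cmod (\<tau> x))\<^sup>2)"
    if "x \<in> carrier FA" for x
    unfolding \<tau>_def by (rule char_word_square[OF that])
  define rep where "rep = (\<lambda>X. SOME x. x \<in> U.Seqs \<and> X = U.cls x)"
  define e where "e = (\<lambda>X. lim (\<lambda>m. \<tau> (rep X m)))"
  have conv: "convergent (\<lambda>m. \<tau> (x m))" if x: "x \<in> U.Seqs" for x
  proof (rule Cauchy_convergent)
    show "Cauchy (\<lambda>m. \<tau> (x m))"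
      unfolding Cauchy_def
    proof (intro allI impI)
      fix r :: real assume "r > 0"
      then obtain N where N: "\<And>m l. m \<ge> N \<Longrightarrow> l \<ge> N \<Longrightarrow> U (x m \<ominus>\<^bsub>FA\<^esub> x l) < r"
        using x unfolding cauchy_seqs_def by blast
      have "dist (\<tau> (x m)) (\<tau> (x l)) < r" if "m \<ge> N" "l \<ge> N" for m l
        using N[OF that] le[of "x m \<ominus>\<^bsub>FA\<^esub> x l"] U.seqs_closed[OF x] by (simp add: dist_norm minus)
      then show "\<exists>N. \<forall>m\<ge>N. \<forall>n\<ge>N. dist (\<tau> (x m)) (\<tau> (x n)) < r" by blast
    qed
  qed
  have e: "(\<lambda>m. \<tau> (x m)) \<longlonglongrightarrow> e (U.cls x)" if x: "x \<in> U.Seqs" for x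
  proof -
    define r where "r = rep (U.cls x)"
    have "r \<in> U.Seqs \<and> U.cls x = U.cls r"
      unfolding r_def rep_def by (rule someI[of _ x]) (use x in simp)
    then have r: "r \<in> U.Seqs" "(x, r) \<in> U.Rel" using U.cls_eq_iff[OF x] by auto
    have "(\<lambda>m. \<tau> (x m) - \<tau> (r m)) \<longlonglongrightarrow> 0"
    proof (rule tendsto_0_le[where K = 1, OF _ always_eventually], rule_tac [2] allI)
      show "(\<lambda>m. U (x m \<ominus>\<^bsub>FA\<^esub> r m)) \<longlonglongrightarrow> 0" using r(2) by (simp add: U.rel_iff)
      show "norm (\<tau> (x m) - \<tau> (r m)) \<le> norm (U (x m \<ominus>\<^bsub>FA\<^esub> r m)) * 1" for m
        using le[of "x m \<ominus>\<^bsub>FA\<^esub> r m"] U.seqs_closed[OF x] U.seqs_closed[OF r(1)] by (simp add: minus)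
    qed
    moreover have "(\<lambda>m. \<tau> (r m)) \<longlonglongrightarrow> e (U.cls x)"
      using conv[OF r(1)] unfolding e_def r_def[symmetric] by (simp add: convergent_LIMSEQ_iff)
    ultimately show ?thesis using tendsto_add by fastforce
  qed
  note closed = U.seqs_closed
  have "positive_form AO e"
    unfolding positive_form_def
  proof (intro conjI ballI allI)
    fix X Y c assume X: "X \<in> carrier AO" and Y: "Y \<in> carrier AO"
    obtain x y where x: "x \<in> U.Seqs" "X = U.cls x" and y: "y \<in> U.Seqs" "Y = U.cls y"
      using U.C_cases[OF X] U.C_cases[OF Y] by metis
    have "(\<lambda>m. \<tau> (x m \<oplus>\<^bsub>FA\<^esub> y m)) \<longlonglongrightarrow> e X + e Y"
      using tendsto_add[OF e[OF x(1)] e[OF y(1)]] x y closed by (simp add: add)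
    then show "e (X \<oplus>\<^bsub>AO\<^esub> Y) = e X + e Y"
      using e[OF U.add_seqs[OF x(1) y(1)]] LIMSEQ_unique x y by (simp add: U.C_add) blast
  next
    fix X c assume X: "X \<in> carrier AO"
    obtain x where x: "x \<in> U.Seqs" "X = U.cls x" by (rule U.C_cases[OF X])
    have "(\<lambda>m. \<tau> (c \<odot>\<^bsub>FA\<^esub> x m)) \<longlonglongrightarrow> c * e X"
      using tendsto_mult[OF tendsto_const e[OF x(1)], of c] x closed by (simp add: scale)
    then show "e (c \<odot>\<^bsub>AO\<^esub> X) = c * e X"
      using e[OF U.smult_seqs[OF x(1)]] LIMSEQ_unique x by (simp add: U.C_smult) blast
  next
    fix X assume X: "X \<in> carrier AO"
    obtain x where x: "x \<in> U.Seqs" "X = U.cls x" by (rule U.C_cases[OF X])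
    have "(\<lambda>m. \<tau> (star FA (x m) \<otimes>\<^bsub>FA\<^esub> x m)) \<longlonglongrightarrow> complex_of_real ((cmod (e X))\<^sup>2)"
      using tendsto_of_real[OF tendsto_power[OF tendsto_norm[OF e[OF x(1)]], of 2]] x closed
      by (simp add: square)
    then have "e (star AO X \<otimes>\<^bsub>AO\<^esub> X) = complex_of_real ((cmod (e X))\<^sup>2)"
      using e[OF U.mult_seqs[OF U.star_seqs[OF x(1)] x(1)]] LIMSEQ_unique x
      by (simp add: U.C_star U.C_mult) blast
    then show "e (star AO X \<otimes>\<^bsub>AO\<^esub> X) \<in> \<real>\<^sub>\<ge>\<^sub>0" by (simp del: of_real_power)
  qed
  moreover have "e \<one>\<^bsub>AO\<^esub> = 1"
  proof -
    have "(\<lambda>m::nat. \<tau> \<one>\<^bsub>FA\<^esub>) \<longlonglongrightarrow> e \<one>\<^bsub>AO\<^esub>"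
      using e[of "\<lambda>_. \<one>\<^bsub>FA\<^esub>"] by (simp add: U.C_one)
    moreover have "\<tau> \<one>\<^bsub>FA\<^esub> = 1" by (simp add: \<tau>_def pairing_one)
    ultimately show ?thesis using LIMSEQ_unique tendsto_const by metis
  qed
  moreover have "cmod (e X) \<le> cnorm AO X" if X: "X \<in> carrier AO" for X
  proof -
    obtain x where x: "x \<in> U.Seqs" "X = U.cls x" by (rule U.C_cases[OF X])
    show ?thesis unfolding x(2)
      by (rule LIMSEQ_le[OF tendsto_norm[OF e[OF x(1)]] U.cnorm_C[OF x(1)]])
        (use le closed[OF x(1)] in auto)
  qed
  ultimately show ?thesis unfolding state_def by blast
qed

sublocale T: min_tensor_product AO AO
  by unfold_locales (rule ex_state)+

section \<open>Products of generators\<close>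

definition letters :: "nat list \<Rightarrow> nat list \<Rightarrow> ((nat \<times> nat) \<times> bool) list" where
  "letters i j = map (\<lambda>x. (x, False)) (zip i j)"

definition entry :: "nat list \<Rightarrow> nat list \<Rightarrow> Ao_elem" where
  "entry i j = embed FA U (basis_elem (letters i j))"

lemma letters_simps [simp]:
  "letters [] j = []" "letters (x # i) (y # j) = ((x, y), False) # letters i j"
  by (simp_all add: letters_def)

lemma letters_append [simp]:
  "length i = length j \<Longrightarrow> letters (i @ i') (j @ j') = letters i j @ letters i' j'"
  by (simp add: letters_def)

lemma letters_closed: "set i \<subseteq> {1..n} \<Longrightarrow> set j \<subseteq> {1..n} \<Longrightarrow> letters i j \<in> carrier M"
proof -
  assume *: "set i \<subseteq> {1..n}" "set j \<subseteq> {1..n}"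
  have "set (zip i j) \<subseteq> {1..n} \<times> {1..n}"
  proof (rule subrelI)
    fix a b assume "(a, b) \<in> set (zip i j)"
    then have "a \<in> set i" "b \<in> set j" by (auto dest: set_zip_leftD set_zip_rightD)
    then show "(a, b) \<in> {1..n} \<times> {1..n}" using * by blast
  qed
  then show ?thesis by (auto simp: letters_def carrier_M Ao_index_def)
qed

lemma entry_closed [simp]: "set i \<subseteq> {1..n} \<Longrightarrow> set j \<subseteq> {1..n} \<Longrightarrow> entry i j \<in> carrier AO"
  unfolding entry_def by (intro U.embed_closed M.basis_elem_closed letters_closed)

lemma entry_append:
  assumes "length i = length j" "set (i @ i') \<subseteq> {1..n}" "set (j @ j') \<subseteq> {1..n}"
  shows "entry (i @ i') (j @ j') = entry i j \<otimes>\<^bsub>AO\<^esub> entry i' j'"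
proof -
  have closed: "letters i j \<in> carrier M" "letters i' j' \<in> carrier M"
    using assms by (auto intro!: letters_closed)
  then show ?thesis
    using assms(1) by (simp add: entry_def U.embed_mult[symmetric] M.mult_basis_elem mult_M)
qed

lemma entry_Nil: "entry [] [] = \<one>\<^bsub>AO\<^esub>"
  by (simp add: entry_def U.embed_one[symmetric] M.F_one one_M)

lemma entry_single: "entry [x] [y] = Ao_gen n x y"
  by (simp add: entry_def Ao_gen_eq free_gen_def letters_def)

end

lemma sum_words_1: "sum f (words A 1) = (\<Sum>a\<in>A. f [a])"
  using sum_words_Suc[of f A 0] by simp

section \<open>Coproduct of products of generators and invariance of the Haar functional\<close>

locale Ao_haar = Ao_algebra +
  fixes \<Delta> :: "Ao_elem \<Rightarrow> Ao_tensor_elem" and h :: "Ao_elem \<Rightarrow> complex"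
  assumes comult: "is_comultiplication n \<Delta>" and haar: "is_haar_functional n \<Delta> h"
begin

abbreviation "TT \<equiv> T.MS.C"

lemma min_tensor_Ao: "min_tensor (Ao n) (Ao n) = TT"
  by (simp add: Ao_eq T.min_tensor_eq)

lemma \<Delta>_mult: "a \<in> carrier AO \<Longrightarrow> b \<in> carrier AO \<Longrightarrow> \<Delta> (a \<otimes>\<^bsub>AO\<^esub> b) = \<Delta> a \<otimes>\<^bsub>TT\<^esub> \<Delta> b"
  and \<Delta>_one: "\<Delta> \<one>\<^bsub>AO\<^esub> = \<one>\<^bsub>TT\<^esub>"
  and \<Delta>_gen: "i \<in> {1..n} \<Longrightarrow> j \<in> {1..n} \<Longrightarrow> \<Delta> (Ao_gen n i j) =
    (\<Oplus>\<^bsub>TT\<^esub>k\<in>{1..n}. elem_tensor AO AO (Ao_gen n i k) (Ao_gen n k j))"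
  using comult ring_hom_mult[of \<Delta> AO TT] ring_hom_one[of \<Delta> AO TT]
  unfolding is_comultiplication_def Let_def min_tensor_Ao unital_star_hom_def by (simp_all add: Ao_eq)

lemma h_form: "positive_form AO h" and h_one: "h \<one>\<^bsub>AO\<^esub> = 1"
  using haar unfolding is_haar_functional_def Let_def by (simp_all add: Ao_eq)

lemmas h_add = AO.positive_formD(1)[OF h_form] and h_scale = AO.positive_formD(2)[OF h_form]

text \<open>The formal tensor representing the coproduct of \<open>entry i j\<close>.\<close>

definition coprod :: "nat list set \<Rightarrow> nat list \<Rightarrow> nat list \<Rightarrow> Ao_elem \<times> Ao_elem \<Rightarrow> complex" where
  "coprod L i j = (\<lambda>z. \<Sum>l\<in>L. 1 * basis_elem (entry i l, entry l j) z)"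

lemma basis_pair_closed:
  "set i \<subseteq> {1..n} \<Longrightarrow> set l \<subseteq> {1..n} \<Longrightarrow> set j \<subseteq> {1..n} \<Longrightarrow>
    basis_elem (entry i l, entry l j) \<in> carrier T.FT"
  by (rule T.AB.basis_elem_closed) (simp add: T.carrier_AB)

lemma words_sub: "l \<in> words {1..n} k \<Longrightarrow> set l \<subseteq> {1..n}"
  by (simp add: words_def)

lemma
  assumes L: "L \<subseteq> words {1..n} k" and i: "i \<in> words {1..n} k" and j: "j \<in> words {1..n} k"
  shows coprod_closed: "coprod L i j \<in> carrier T.FT"
    and pairing_coprod: "pairing (coprod L i j) g = (\<Sum>l\<in>L. g (entry i l, entry l j))"
proof -
  have fin: "finite L" using L finite_words[of "{1..n}" k] finite_subset by blast
  have basis: "basis_elem (entry i l, entry l j) \<in> carrier T.FT" if "l \<in> L" for l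
    by (rule basis_pair_closed) (use words_sub L i j that in blast)+
  show "coprod L i j \<in> carrier T.FT"
    unfolding coprod_def by (rule T.AB.sum_closed_F[OF fin basis])
  show "pairing (coprod L i j) g = (\<Sum>l\<in>L. g (entry i l, entry l j))"
    unfolding coprod_def by (subst T.AB.pairing_sum[OF fin basis]) auto
qed

text \<open>Multiplicativity, letter by letter. The product of two such sums has the required form
  already among formal tensors, because symbols multiply componentwise.\<close>

lemma coproduct_entry:
  "i \<in> words {1..n} k \<Longrightarrow> j \<in> words {1..n} k \<Longrightarrow>
    \<Delta> (entry i j) = embed T.FT (min_seminorm AO AO) (coprod (words {1..n} k) i j)"
proof (induction k arbitrary: i j)
  case 0
  have "coprod {[]} [] [] = \<one>\<^bsub>T.FT\<^esub>"
    by (simp add: coprod_def T.AB.F_one entry_Nil) (simp add: prod_star_monoid_def)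
  then show ?case using 0 by (simp add: entry_Nil \<Delta>_one T.MS.embed_one)
next
  case (Suc k)
  from Suc.prems obtain x i' y j' where i: "i = x # i'" "x \<in> {1..n}" "i' \<in> words {1..n} k"
    and j: "j = y # j'" "y \<in> {1..n}" "j' \<in> words {1..n} k"
    by (auto simp: words_Suc)
  note sub = words_sub[OF i(3)] words_sub[OF j(3)]
  have xy: "[x] \<in> words {1..n} 1" "[y] \<in> words {1..n} 1" using i j by (simp_all add: words_def)
  note cl = coprod_closed[OF subset_refl xy] coprod_closed[OF subset_refl i(3) j(3)]
    coprod_closed[OF subset_refl Suc.prems]
  note pairings = pairing_coprod[OF subset_refl xy] pairing_coprod[OF subset_refl i(3) j(3)]
    pairing_coprod[OF subset_refl Suc.prems]
  have "\<Delta> (entry [x] [y]) = embed T.FT (min_seminorm AO AO) (coprod (words {1..n} 1) [x] [y])"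
  proof -
    have bc: "basis_elem (entry [x] [k], entry [k] [y]) \<in> carrier T.FT" if "k \<in> {1..n}" for k
      using that i j by (intro basis_pair_closed) auto
    have "\<Delta> (entry [x] [y]) = (\<Oplus>\<^bsub>TT\<^esub>k\<in>{1..n}. embed T.FT (min_seminorm AO AO) (basis_elem (entry [x] [k], entry [k] [y])))"
      using i j by (simp add: entry_single \<Delta>_gen T.elem_tensor_eq)
    also have "\<dots> = embed T.FT (min_seminorm AO AO) (\<Oplus>\<^bsub>T.FT\<^esub>k\<in>{1..n}. basis_elem (entry [x] [k], entry [k] [y]))"
      by (rule T.MS.embed_finsum[symmetric]) (use bc in auto)
    also have "(\<Oplus>\<^bsub>T.FT\<^esub>k\<in>{1..n}. basis_elem (entry [x] [k], entry [k] [y])) = coprod (words {1..n} 1) [x] [y]"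
      using T.AB.finsum_F[of "{1..n}" "\<lambda>k. basis_elem (entry [x] [k], entry [k] [y])"] bc
      by (simp add: coprod_def sum_words_Suc)
    finally show ?thesis .
  qed
  then have "\<Delta> (entry [x] [y] \<otimes>\<^bsub>AO\<^esub> entry i' j') = embed T.FT (min_seminorm AO AO)
      (coprod (words {1..n} 1) [x] [y] \<otimes>\<^bsub>T.FT\<^esub> coprod (words {1..n} k) i' j')"
    using Suc.IH[OF i(3) j(3)] i j sub cl by (simp add: \<Delta>_mult T.MS.embed_mult)
  also have "coprod (words {1..n} 1) [x] [y] \<otimes>\<^bsub>T.FT\<^esub> coprod (words {1..n} k) i' j' = coprod (words {1..n} (Suc k)) i j"
  proof (rule T.AB.pairing_ext)
    fix g
    have mult: "(entry [x] [a], entry [a] [y]) \<otimes>\<^bsub>prod_star_monoid AO AO\<^esub> (entry i' l, entry l j') =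
        (entry i (a # l), entry (a # l) j)" if "a \<in> {1..n}" "l \<in> words {1..n} k" for a l
      using entry_append[of "[x]" "[a]" i' l] entry_append[of "[a]" "[y]" l j'] that i j sub words_sub[OF that(2)]
      by (simp add: prod_star_monoid_def)
    have "pairing (coprod (words {1..n} 1) [x] [y] \<otimes>\<^bsub>T.FT\<^esub> coprod (words {1..n} k) i' j') g =
        (\<Sum>a\<in>{1..n}. \<Sum>l\<in>words {1..n} k. g (entry i (a # l), entry (a # l) j))"
      unfolding T.AB.pairing_mult[OF cl(1,2)] pairings sum_words_1
      by (intro sum.cong HOL.refl arg_cong[of _ _ g] mult)
    also have "\<dots> = pairing (coprod (words {1..n} (Suc k)) i j) g"
      unfolding pairings by (simp add: sum_words_Suc)
    finally show "pairing (coprod (words {1..n} 1) [x] [y] \<otimes>\<^bsub>T.FT\<^esub> coprod (words {1..n} k) i' j') g =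
        pairing (coprod (words {1..n} (Suc k)) i j) g" .
  qed (rule T.FT.m_closed[OF cl(1,2)], rule cl(3))
  finally show ?case
    using entry_append[of "[x]" "[y]" i' j'] i j sub by simp
qed

text \<open>Slicing the coproduct of an entry gives a combination of entries with Haar integrals as
  coefficients, and invariance makes it a scalar. This equation in the completion says that its
  preimage in the free algebra is null for \<open>U\<close>.\<close>

lemma haar_invariance:
  assumes i: "i \<in> words {1..n} k" and j: "j \<in> words {1..n} k"
  defines "x \<equiv> (\<lambda>w. \<Sum>l\<in>words {1..n} k. h (entry l j) * basis_elem (letters i l) w)"
  shows "x \<in> carrier FA" "U (x \<ominus>\<^bsub>FA\<^esub> h (entry i j) \<odot>\<^bsub>FA\<^esub> \<one>\<^bsub>FA\<^esub>) = 0"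
proof -
  note sub = words_sub[OF i] words_sub[OF j]
  obtain S where S: "is_slice_right AO AO h S" "\<And>a. a \<in> carrier AO \<Longrightarrow> S (\<Delta> a) = h a \<odot>\<^bsub>AO\<^esub> \<one>\<^bsub>AO\<^esub>"
    using haar unfolding is_haar_functional_def Let_def Ao_eq by blast
  have S_lin: "linear_on_carrier TT AO S"
    and S_elem: "\<And>a b. a \<in> carrier AO \<Longrightarrow> b \<in> carrier AO \<Longrightarrow> S (elem_tensor AO AO a b) = h b \<odot>\<^bsub>AO\<^esub> a"
    using S(1) unfolding is_slice_right_def bounded_linear_on_carrier_def T.min_tensor_eq by auto
  have basis: "basis_elem (letters i l) \<in> carrier FA" if "l \<in> words {1..n} k" for l
    using sub words_sub[OF that] by (intro M.basis_elem_closed letters_closed)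
  have closed: "(\<lambda>w. \<Sum>l\<in>L. h (entry l j) * basis_elem (letters i l) w) \<in> carrier FA"
    if "finite L" "L \<subseteq> words {1..n} k" for L
    by (rule M.sum_closed_F) (use that basis in auto)
  \<comment> \<open>The slice map is known on sums and elementary tensors, so the sum over
    intermediate words is built up one word at a time, through partial index sets
    \<open>L\<close>.\<close>
  have "S (embed T.FT (min_seminorm AO AO) (coprod L i j)) =
      embed FA U (\<lambda>w. \<Sum>l\<in>L. h (entry l j) * basis_elem (letters i l) w)"
    if "finite L" "L \<subseteq> words {1..n} k" for L
    using that
  proof (induction L rule: finite_induct)
    case empty
    have "embed T.FT (min_seminorm AO AO) (coprod {} i j) = 0 \<odot>\<^bsub>TT\<^esub> \<zero>\<^bsub>TT\<^esub>"
      by (simp add: coprod_def T.AB.F_zero[symmetric] T.MS.embed_zero star_alg.smult_zero_right[OF T.MS.star_alg_C])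
    moreover have "S (0 \<odot>\<^bsub>TT\<^esub> \<zero>\<^bsub>TT\<^esub>) = 0 \<odot>\<^bsub>AO\<^esub> S \<zero>\<^bsub>TT\<^esub>"
      using S_lin ring.ring_simprules(2)[OF star_alg.axioms(1)[OF T.MS.star_alg_C]] by (simp add: linear_on_carrier_def)
    moreover have "S \<zero>\<^bsub>TT\<^esub> \<in> carrier AO"
      using S_lin ring.ring_simprules(2)[OF star_alg.axioms(1)[OF T.MS.star_alg_C]] by (auto simp: linear_on_carrier_def)
    ultimately have "S (embed T.FT (min_seminorm AO AO) (coprod {} i j)) = \<zero>\<^bsub>AO\<^esub>" by simp
    also have "\<dots> = embed FA U (\<lambda>w. \<Sum>l\<in>{}. h (entry l j) * basis_elem (letters i l) w)"
      by (simp add: U.embed_zero[symmetric] M.F_zero)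
    finally show ?case .
  next
    case (insert l L)
    have l: "l \<in> words {1..n} k" and L: "L \<subseteq> words {1..n} k" using insert by auto
    note lsub = words_sub[OF l]
    have cl: "coprod L i j \<in> carrier T.FT" "basis_elem (entry i l, entry l j) \<in> carrier T.FT"
      using coprod_closed[OF L i j] basis_pair_closed[OF sub(1) lsub sub(2)] by auto
    have "coprod (insert l L) i j = basis_elem (entry i l, entry l j) \<oplus>\<^bsub>T.FT\<^esub> coprod L i j"
      using insert by (simp add: coprod_def T.AB.F_add)
    then have "S (embed T.FT (min_seminorm AO AO) (coprod (insert l L) i j)) =
        S (elem_tensor AO AO (entry i l) (entry l j)) \<oplus>\<^bsub>AO\<^esub> S (embed T.FT (min_seminorm AO AO) (coprod L i j))"
      using S_lin cl by (simp add: T.MS.embed_add T.elem_tensor_eq linear_on_carrier_def)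
    also have "\<dots> = h (entry l j) \<odot>\<^bsub>AO\<^esub> entry i l \<oplus>\<^bsub>AO\<^esub>
        embed FA U (\<lambda>w. \<Sum>l\<in>L. h (entry l j) * basis_elem (letters i l) w)"
      using insert.IH[OF L] sub lsub by (simp add: S_elem)
    also have "\<dots> = embed FA U (h (entry l j) \<odot>\<^bsub>FA\<^esub> basis_elem (letters i l) \<oplus>\<^bsub>FA\<^esub>
        (\<lambda>w. \<Sum>l\<in>L. h (entry l j) * basis_elem (letters i l) w))"
      using basis[OF l] closed[OF insert(1) L] by (simp add: U.embed_add U.embed_smult entry_def)
    also have "h (entry l j) \<odot>\<^bsub>FA\<^esub> basis_elem (letters i l) \<oplus>\<^bsub>FA\<^esub>
        (\<lambda>w. \<Sum>l\<in>L. h (entry l j) * basis_elem (letters i l) w) =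
        (\<lambda>w. \<Sum>l\<in>insert l L. h (entry l j) * basis_elem (letters i l) w)"
      using insert by (simp add: M.F_add M.F_smult)
    finally show ?case .
  qed
  then have "S (\<Delta> (entry i j)) = embed FA U x"
    unfolding coproduct_entry[OF i j] x_def by simp
  moreover have "S (\<Delta> (entry i j)) = embed FA U (h (entry i j) \<odot>\<^bsub>FA\<^esub> \<one>\<^bsub>FA\<^esub>)"
    using S(2)[of "entry i j"] sub by (simp add: U.embed_smult U.embed_one)
  moreover show "x \<in> carrier FA" unfolding x_def by (rule closed) auto
  ultimately show "U (x \<ominus>\<^bsub>FA\<^esub> h (entry i j) \<odot>\<^bsub>FA\<^esub> \<one>\<^bsub>FA\<^esub>) = 0"
    using U.embed_eq_iff[of x "h (entry i j) \<odot>\<^bsub>FA\<^esub> \<one>\<^bsub>FA\<^esub>"] by simp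
qed

text \<open>Applying \<open>g\<close> to the null element of \<open>haar_invariance\<close> gives
  linear equations between Haar integrals. Suitable \<open>g\<close> are \<open>char_word V\<close>
  for orthogonal \<open>V\<close> and the coefficients \<open>free_coeff c\<close>.\<close>

lemma invariance_pairing:
  assumes i: "i \<in> words {1..n} k" and j: "j \<in> words {1..n} k"
    and g: "\<And>x. x \<in> carrier FA \<Longrightarrow> U x = 0 \<Longrightarrow> pairing x g = 0"
  shows "(\<Sum>l\<in>words {1..n} k. h (entry l j) * g (letters i l)) = h (entry i j) * g []"
proof -
  let ?x = "\<lambda>w. \<Sum>l\<in>words {1..n} k. h (entry l j) * basis_elem (letters i l) w"
  have basis: "basis_elem (letters i l) \<in> carrier FA" if "l \<in> words {1..n} k" for l
    using words_sub[OF i] words_sub[OF that] by (intro M.basis_elem_closed letters_closed)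
  have x: "?x \<in> carrier FA" using haar_invariance(1)[OF i j] .
  have "pairing (?x \<ominus>\<^bsub>FA\<^esub> h (entry i j) \<odot>\<^bsub>FA\<^esub> \<one>\<^bsub>FA\<^esub>) g = 0"
    by (rule g) (use x haar_invariance(2)[OF i j] in auto)
  then have "pairing ?x g = h (entry i j) * g []"
    using x by (simp add: pairing_minus M.pairing_smult pairing_one)
  moreover have "pairing ?x g = (\<Sum>l\<in>words {1..n} k. h (entry l j) * g (letters i l))"
    using M.pairing_sum[of "words {1..n} k" "\<lambda>l. basis_elem (letters i l)" "\<lambda>l. h (entry l j)" g] basis by simp
  ultimately show ?thesis by simp
qed

lemma orthogonal_invariance:
  assumes "i \<in> words {1..n} k" "j \<in> words {1..n} k" "orthogonal V"
  shows "(\<Sum>l\<in>words {1..n} k. h (entry l j) * char_word V (letters i l)) = h (entry i j)"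
proof -
  have "pairing x (char_word V) = 0" if "x \<in> carrier FA" "U x = 0" for x
    using character[OF assms(3) that(1)] that(2) by simp
  from invariance_pairing[OF assms(1,2) this] show ?thesis by simp
qed

section \<open>The first column satisfies \<open>column_moments\<close>\<close>

definition moment :: "nat list \<Rightarrow> complex" where
  "moment w = h (entry w (replicate (length w) 1))"

context
  assumes n: "n \<ge> 1"
begin

lemma ones_words: "replicate k 1 \<in> words {1..n} k"
  using n by (auto simp: words_def)

lemma moment_orthogonal_invariance:
  assumes "w \<in> words {1..n} k" "orthogonal V"
  shows "(\<Sum>l\<in>words {1..n} k. moment l * char_word V (letters w l)) = moment w"
proof -
  have len: "length l = k" if "l \<in> words {1..n} k" for l using that by (simp add: words_def)
  have "(\<Sum>l\<in>words {1..n} k. moment l * char_word V (letters w l)) =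
      (\<Sum>l\<in>words {1..n} k. h (entry l (replicate k 1)) * char_word V (letters w l))"
    by (rule sum.cong) (simp_all add: moment_def len)
  then show ?thesis
    using orthogonal_invariance[OF assms(1) ones_words assms(2)] len[OF assms(1)] by (simp add: moment_def)
qed

lemma moment_perm:
  assumes "\<pi> permutes {1..n}" "set w \<subseteq> {1..n}"
  shows "moment (map \<pi> w) = moment w"
proof -
  let ?V = "\<lambda>i j. of_bool (j = \<pi> i)" and ?W = "words {1..n} (length w)"
  have char: "char_word ?V (letters w l) = of_bool (l = map \<pi> w)" if "length l = length w" for l
    using that[symmetric] by (induction w l rule: list_induct2) auto
  have w: "w \<in> ?W" using assms(2) by (simp add: words_def)
  have "map \<pi> w \<in> ?W"
    using assms(2) permutes_in_image[OF assms(1)] by (auto simp: words_def)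
  then have "moment (map \<pi> w) = (\<Sum>l\<in>?W. if l = map \<pi> w then moment l else 0)" by simp
  also have "\<dots> = (\<Sum>l\<in>?W. moment l * char_word ?V (letters w l))"
    by (rule sum.cong) (auto simp: char words_def)
  also have "\<dots> = moment w"
    by (rule moment_orthogonal_invariance[OF w orthogonal_permutation[OF assms(1)]])
  finally show ?thesis .
qed

text \<open>Among the terms of the invariance equation for \<open>free_coeff []\<close> only
  \<open>l = w\<close> is diagonal, and its coefficient is 0 if the reduced form is not empty. The
  other side of the equation is the moment.\<close>

lemma moment_vanishing:
  assumes "set w \<subseteq> {1..n}" "reduced_form w \<noteq> []"
  shows "moment w = 0"
proof -
  let ?W = "words {1..n} (length w)"
  have w: "w \<in> ?W" using assms(1) by (simp add: words_def)
  have "diag_word (letters w l) \<longleftrightarrow> l = w" if "length l = length w" for l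
    using that[symmetric] by (induction w l rule: list_induct2) (auto simp: diag_word_def letters_def)
  moreover have "map (\<lambda>x. fst (fst x)) (letters w w) = w" by (simp add: letters_def o_def zip_same_conv_map)
  ultimately have "free_coeff [] (letters w l) = 0" if "l \<in> ?W" for l
    using that assms(2) by (auto simp: free_coeff_def word_form_def words_def)
  then have "h (entry w (replicate (length w) 1)) * free_coeff [] [] = 0"
    using invariance_pairing[OF w ones_words free_group_coeff, of "[]"] by simp
  moreover have "free_coeff [] [] = 1"
    by (simp add: free_coeff_def diag_word_def word_form_def reduced_form_def)
  ultimately show ?thesis by (simp add: moment_def)
qed

definition rotation :: "nat \<Rightarrow> nat \<Rightarrow> real \<Rightarrow> nat \<Rightarrow> nat \<Rightarrow> real" where
  "rotation a b \<theta> x y = of_bool (x = y) * (if x = a \<or> x = b then cos \<theta> else 1) +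
    sin \<theta> * (of_bool (x = a \<and> y = b) - of_bool (x = b \<and> y = a))"

lemma orthogonal_rotation:
  assumes ab: "a \<in> {1..n}" "b \<in> {1..n}" "a \<noteq> b"
  shows "orthogonal (rotation a b \<theta>)"
proof -
  define p where "p = (\<lambda>\<theta> x. if x = a \<or> x = b then cos \<theta> else (1 :: real))"
  define q where "q = (\<lambda>\<theta> x. if x = a then sin \<theta> else if x = b then - sin \<theta> else (0 :: real))"
  \<comment> \<open>Row \<open>i\<close> of the rotation has \<open>p\<close> on the diagonal and
    \<open>q\<close> in column \<open>s i\<close>; outside the plane \<open>q\<close> is 0, so
    \<open>s i = i\<close> does no harm.\<close>
  define s where "s = (\<lambda>x. if x = a then b else if x = b then a else x)"
  have rows: "(\<Sum>k\<in>{1..n}. rotation a b \<theta> i k * rotation a b \<theta> j k) = of_bool (i = j)"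
    if ij: "i \<in> {1..n}" "j \<in> {1..n}" for i j \<theta>
  proof -
    have si: "s i \<in> {1..n}" using ij ab by (auto simp: s_def)
    have "rotation a b \<theta> i k * rotation a b \<theta> j k =
        (if k = i then p \<theta> i * rotation a b \<theta> j i else 0) + (if k = s i then q \<theta> i * rotation a b \<theta> j (s i) else 0)" for k
      using ab(3) by (auto simp: rotation_def p_def q_def s_def)
    then have "(\<Sum>k\<in>{1..n}. rotation a b \<theta> i k * rotation a b \<theta> j k) =
        p \<theta> i * rotation a b \<theta> j i + q \<theta> i * rotation a b \<theta> j (s i)"
      using ij si by (simp add: sum.distrib)
    also have "\<dots> = of_bool (i = j)"
      using ab(3) sin_cos_squared_add[of \<theta>]
      by (auto simp: rotation_def p_def q_def s_def power2_eq_square add.commute)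
    finally show ?thesis .
  qed
  \<comment> \<open>Transposing reverses the angle, so the column relations are the row relations at
    \<open>- \<theta>\<close>.\<close>
  have "rotation a b \<theta> k i = rotation a b (- \<theta>) i k" for i k
    using ab(3) by (auto simp: rotation_def)
  then show ?thesis using rows[of _ _ \<theta>] rows[of _ _ "- \<theta>"] by (simp add: orthogonal_def)
qed

lemma rotation_0: "rotation a b 0 x y = of_bool (x = y)"
  by (auto simp: rotation_def)

lemma rotation_deriv:
  "((\<lambda>\<theta>. complex_of_real (rotation a b \<theta> x y)) has_vector_derivative
    complex_of_real (of_bool (x = a \<and> y = b) - of_bool (x = b \<and> y = a))) (at 0)"
proof -
  let ?d = "of_bool (x = a \<and> y = b) - of_bool (x = b \<and> y = a) :: real"
  have D: "((\<lambda>\<theta>. c * cos \<theta> + sin \<theta> * d) has_real_derivative d) (at 0)"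
    "((\<lambda>\<theta>. c + sin \<theta> * d) has_real_derivative d) (at 0)" for c d :: real
    by (auto intro!: derivative_eq_intros)
  have "((\<lambda>\<theta>. rotation a b \<theta> x y) has_real_derivative ?d) (at 0)"
  proof (cases "x = a \<or> x = b")
    case True
    then show ?thesis using D(1)[of "of_bool (x = y)" ?d] by (simp add: rotation_def)
  next
    case False
    then show ?thesis using D(2)[of "of_bool (x = y)" ?d] by (simp add: rotation_def)
  qed
  then show ?thesis
    by (intro has_vector_derivative_of_real) (simp only: has_real_derivative_iff_has_vector_derivative)
qed

text \<open>At angle 0 the rotation is the identity matrix and the sum returns \<open>f i\<close>.
  The product rule then differentiates one letter at a time, as in the recursion of
  \<open>rot_deriv\<close>; since it needs values as well, both claims are proved together.\<close>

lemma rotated_sum_deriv: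
  assumes ab: "a \<in> A" "b \<in> A" "a \<noteq> b" and "finite A"
  defines "G \<equiv> (\<lambda>f i \<theta>. \<Sum>l\<in>words A (length i). f l * char_word (rotation a b \<theta>) (letters i l))"
  shows "set i \<subseteq> A \<Longrightarrow> G f i 0 = f i \<and> (G f i has_vector_derivative rot_deriv a b f i) (at 0)"
proof (induction i arbitrary: f)
  case Nil
  show ?case by (simp add: G_def)
next
  case (Cons x i)
  have G: "G f (x # i) = (\<lambda>\<theta>. \<Sum>c\<in>A. complex_of_real (rotation a b \<theta> x c) * G (\<lambda>l. f (c # l)) i \<theta>)" for f
    by (simp add: G_def sum_words_Suc sum_distrib_left mult_ac)
  have IH: "G f i 0 = f i" "(G f i has_vector_derivative rot_deriv a b f i) (at 0)" for f
    using Cons by auto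
  have x: "x \<in> A" using Cons.prems by simp
  have 0: "G f (x # i) 0 = f (x # i)"
    using x assms(4) unfolding G by (simp add: rotation_0 IH(1) of_bool_def if_distrib if_distribR cong: if_cong)
  let ?D = "\<lambda>c. complex_of_real (rotation a b 0 x c) * rot_deriv a b (\<lambda>l. f (c # l)) i +
      complex_of_real (of_bool (x = a \<and> c = b) - of_bool (x = b \<and> c = a)) * G (\<lambda>l. f (c # l)) i 0"
  have "(G f (x # i) has_vector_derivative (\<Sum>c\<in>A. ?D c)) (at 0)"
    unfolding G by (intro has_vector_derivative_sum has_vector_derivative_mult rotation_deriv IH(2))
  moreover have "(\<Sum>c\<in>A. ?D c) = rot_deriv a b f (x # i)"
  proof -
    have "(\<Sum>c\<in>A. ?D c) = (\<Sum>c\<in>A. (if c = x then rot_deriv a b (\<lambda>l. f (x # l)) i else 0) +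
        ((if c = b then of_bool (x = a) * f (b # i) else 0) - (if c = a then of_bool (x = b) * f (a # i) else 0)))"
      by (rule sum.cong) (auto simp: rotation_0 IH(1))
    then show ?thesis using x ab assms(4) by (simp add: sum.distrib sum_subtractf)
  qed
  ultimately show ?case using 0 by simp
qed

text \<open>By invariance under rotations the rotated sum does not depend on the angle, and
  derivatives are unique.\<close>

lemma moment_rot:
  assumes "a \<in> {1..n}" "b \<in> {1..n}" "a \<noteq> b" "set w \<subseteq> {1..n}"
  shows "rot_deriv a b moment w = 0"
proof -
  have w: "w \<in> words {1..n} (length w)" using assms(4) by (simp add: words_def)
  have "((\<lambda>\<theta>. \<Sum>l\<in>words {1..n} (length w). moment l * char_word (rotation a b \<theta>) (letters w l))
      has_vector_derivative rot_deriv a b moment w) (at 0)"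
    using rotated_sum_deriv[OF assms(1-3) _ assms(4)] by simp
  then have "((\<lambda>\<theta>. moment w) has_vector_derivative rot_deriv a b moment w) (at 0)"
    using moment_orthogonal_invariance[OF w orthogonal_rotation[OF assms(1-3)]] by simp
  then have "((\<lambda>\<theta>. moment w) has_derivative (\<lambda>t. t *\<^sub>R rot_deriv a b moment w)) (at 0)"
    by (simp add: has_vector_derivative_def)
  from has_derivative_unique[OF this has_derivative_const]
  show ?thesis by (metis scaleR_one)
qed

text \<open>The relation for the first column, multiplied by words on both sides, stays null for the
  submultiplicative \<open>U\<close>, and \<open>h\<close> is defined on classes modulo null
  elements.\<close>

lemma moment_contraction:
  assumes u: "set u \<subseteq> {1..n}" and v: "set v \<subseteq> {1..n}"
  shows "(\<Sum>a\<in>{1..n}. moment (u @ a # a # v)) = moment (u @ v)"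
proof -
  let ?P = "letters u (replicate (length u) 1)" and ?Q = "letters v (replicate (length v) 1)"
  have P: "?P \<in> carrier M" and Q: "?Q \<in> carrier M"
    using u v n by (auto intro!: letters_closed)
  have split: "letters (u @ x @ v) (replicate (length (u @ x @ v)) 1) =
      ?P @ letters x (replicate (length x) 1) @ ?Q" for x :: "nat list"
    by (simp add: replicate_add)
  define w where "w = (\<lambda>a :: nat. ?P @ [((a, 1), False), ((a, 1), False)] @ ?Q)"
  have w: "w a \<in> carrier M" if "a \<in> {1..n}" for a using that P Q n by (simp add: w_def)
  define H where "H = (\<lambda>f. h (embed FA U f))"
  have H_basis: "moment (u @ a # a # v) = H (basis_elem (w a))" for a
    using split[of "[a, a]"] by (simp add: moment_def H_def w_def entry_def numeral_2_eq_2)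
  have H_uv: "moment (u @ v) = H (basis_elem (?P @ ?Q))"
    using split[of "[]"] by (simp add: moment_def H_def entry_def)
  have H_add: "H (f \<oplus>\<^bsub>FA\<^esub> g) = H f + H g" if "f \<in> carrier FA" "g \<in> carrier FA" for f g
    using that by (simp add: H_def U.embed_add h_add)
  have H_sum: "H (\<lambda>z. \<Sum>a\<in>I. 1 * basis_elem (w a) z) = (\<Sum>a\<in>I. H (basis_elem (w a)))"
    if "finite I" "I \<subseteq> {1..n}" for I
    using that
  proof (induction I rule: finite_induct)
    case empty
    have "H \<zero>\<^bsub>FA\<^esub> = 0" using H_add[of "\<zero>\<^bsub>FA\<^esub>" "\<zero>\<^bsub>FA\<^esub>"] by simp
    then show ?case by (simp add: M.F_zero)
  next
    case (insert a I)
    have "(\<lambda>z. \<Sum>a\<in>insert a I. 1 * basis_elem (w a) z) =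
        basis_elem (w a) \<oplus>\<^bsub>FA\<^esub> (\<lambda>z. \<Sum>a\<in>I. 1 * basis_elem (w a) z)"
      using insert by (simp add: M.F_add)
    moreover have "(\<lambda>z. \<Sum>a\<in>I. 1 * basis_elem (w a) z) \<in> carrier FA"
      by (rule M.sum_closed_F) (use insert w in auto)
    ultimately show ?case using insert H_add[of "basis_elem (w a)"] w by simp
  qed
  let ?r = "(\<Oplus>\<^bsub>FA\<^esub>k\<in>{1..n}. free_gen (k, 1) \<otimes>\<^bsub>FA\<^esub> free_gen (k, 1)) \<ominus>\<^bsub>FA\<^esub> \<one>\<^bsub>FA\<^esub>"
  have "?r \<in> Ao_relations n" using relations(2)[of 1 1] n by simp
  then have r: "?r \<in> carrier FA" "U ?r = 0" by (rule relations_closed, rule U_relations)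
  let ?s = "\<Oplus>\<^bsub>FA\<^esub>k\<in>{1..n}. free_gen (k, 1) \<otimes>\<^bsub>FA\<^esub> free_gen (k, 1)"
  have s: "?s \<in> carrier FA" "\<And>g. pairing ?s g = (\<Sum>k\<in>{1..n}. g [((k, 1), False), ((k, 1), False)])"
    using pairing_finsum_gen[of "\<lambda>k. k" "\<lambda>_. 1" "\<lambda>k. k" "\<lambda>_. 1"] n by auto
  let ?z = "\<lambda>z. \<Sum>a\<in>{1..n}. 1 * basis_elem (w a) z"
  have z: "?z \<in> carrier FA" by (rule M.sum_closed_F) (use w in auto)
  have eq: "?z \<ominus>\<^bsub>FA\<^esub> basis_elem (?P @ ?Q) = basis_elem ?P \<otimes>\<^bsub>FA\<^esub> (?r \<otimes>\<^bsub>FA\<^esub> basis_elem ?Q)"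
  proof (rule M.pairing_ext)
    fix g
    have "pairing ?z g = (\<Sum>a\<in>{1..n}. 1 * g (w a))"
      by (subst M.pairing_sum) (use w in auto)
    then show "pairing (?z \<ominus>\<^bsub>FA\<^esub> basis_elem (?P @ ?Q)) g =
        pairing (basis_elem ?P \<otimes>\<^bsub>FA\<^esub> (?r \<otimes>\<^bsub>FA\<^esub> basis_elem ?Q)) g"
      using z r(1) P Q s
      by (simp add: pairing_minus M.pairing_mult mult_M pairing_one w_def)
  qed (use z r P Q in auto)
  have "U (basis_elem ?P \<otimes>\<^bsub>FA\<^esub> (?r \<otimes>\<^bsub>FA\<^esub> basis_elem ?Q)) \<le> U (basis_elem ?P) * (U ?r * U (basis_elem ?Q))"
    using r(1) P Q by (intro order_trans[OF U.p_mult] mult_left_mono U.p_mult) auto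
  then have "U (?z \<ominus>\<^bsub>FA\<^esub> basis_elem (?P @ ?Q)) \<le> 0" unfolding eq r(2) by simp
  moreover have "basis_elem (?P @ ?Q) \<in> carrier FA" using P Q by simp
  then have "0 \<le> U (?z \<ominus>\<^bsub>FA\<^esub> basis_elem (?P @ ?Q))"
    by (intro U.p_nonneg FA.minus_closed z)
  ultimately have "U (?z \<ominus>\<^bsub>FA\<^esub> basis_elem (?P @ ?Q)) = 0" by linarith
  then have "embed FA U ?z = embed FA U (basis_elem (?P @ ?Q))"
    using z P Q by (subst U.embed_eq_iff) auto
  then have "H ?z = H (basis_elem (?P @ ?Q))" by (simp add: H_def)
  then show ?thesis using H_sum[of "{1..n}"] by (simp add: H_basis H_uv)
qed

lemma column_moments_moment: "column_moments n moment"
proof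
  show "moment [] = 1" by (simp add: moment_def entry_Nil h_one)
qed (use moment_contraction moment_perm moment_rot moment_vanishing in auto)

lemma moment_power:
  "h ((c \<odot>\<^bsub>Ao n\<^esub> Ao_gen n 1 1) [^]\<^bsub>Ao n\<^esub> k) = c ^ k * moment (replicate k 1)"
proof -
  have one: "set (replicate k 1) \<subseteq> {1..n}" for k using n by auto
  have "(c \<odot>\<^bsub>AO\<^esub> entry [1] [1]) [^]\<^bsub>AO\<^esub> k = c ^ k \<odot>\<^bsub>AO\<^esub> entry (replicate k 1) (replicate k 1)"
  proof (induction k)
    case 0
    show ?case by (simp add: entry_Nil)
  next
    case (Suc k)
    have sub: "set (replicate k 1 @ [1]) \<subseteq> {1..n}" using n by auto
    have "entry (replicate (Suc k) 1) (replicate (Suc k) 1) =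
        entry (replicate k 1) (replicate k 1) \<otimes>\<^bsub>AO\<^esub> entry [1] [1]"
      using entry_append[OF _ sub sub] by (simp only: length_replicate replicate_append_same replicate_Suc)
    moreover have "entry (replicate k 1) (replicate k 1) \<in> carrier AO" "entry [1] [1] \<in> carrier AO"
      by (rule entry_closed; use n in auto)+
    ultimately show ?case
      using Suc by (simp add: AO.smult_mult_left AO.smult_mult_right AO.smult_smult mult.commute)
  qed
  then show ?thesis
    unfolding Ao_eq entry_single[symmetric] using one by (simp add: h_scale moment_def)
qed

end

end

theorem theorem7p1:
  fixes \<Delta> :: "nat \<Rightarrow> Ao_elem \<Rightarrow> Ao_tensor_elem"
    and h :: "nat \<Rightarrow> Ao_elem \<Rightarrow> complex"
  assumes comult: "\<And>n. n \<ge> 1 \<Longrightarrow> is_comultiplication n (\<Delta> n)"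
    and haar: "\<And>n. n \<ge> 1 \<Longrightarrow> is_haar_functional n (\<Delta> n) (h n)"
  shows "\<forall>k.
    (\<lambda>n. fps_nth
       (Abs_fps (\<lambda>m. h n ((complex_of_real (sqrt (real n)) \<odot>\<^bsub>Ao n\<^esub> Ao_gen n 1 1) [^]\<^bsub>Ao n\<^esub> m))
        - (2 / (1 + sqrt_series)
           - fps_const (1 / of_nat n)
             * (32 * fps_X ^ 4 / ((1 + sqrt_series) ^ 4 * sqrt_series)))) k)
    \<in> O(\<lambda>n. 1 / of_nat n ^ 2)"
proof
  fix k
  have haar_n: "Ao_haar n (\<Delta> n) (h n)" if "n \<ge> 1" for n
    using comult[OF that] haar[OF that] by (simp add: Ao_haar_def)
  define \<xi> where "\<xi> = (\<lambda>n. Ao_haar.moment n (h n))"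
  have "column_moments n (\<xi> n)" if "n \<ge> 1" for n
    unfolding \<xi>_def by (rule Ao_haar.column_moments_moment[OF haar_n[OF that] that])
  moreover have "h n ((complex_of_real (sqrt (real n)) \<odot>\<^bsub>Ao n\<^esub> Ao_gen n 1 1) [^]\<^bsub>Ao n\<^esub> k) =
      complex_of_real (sqrt (real n)) ^ k * \<xi> n (replicate k 1)" if "n \<ge> 1" for n
    unfolding \<xi>_def by (rule Ao_haar.moment_power[OF haar_n[OF that] that])
  ultimately show "(\<lambda>n. fps_nth
       (Abs_fps (\<lambda>m. h n ((complex_of_real (sqrt (real n)) \<odot>\<^bsub>Ao n\<^esub> Ao_gen n 1 1) [^]\<^bsub>Ao n\<^esub> m))
        - (2 / (1 + sqrt_series)
           - fps_const (1 / of_nat n)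
             * (32 * fps_X ^ 4 / ((1 + sqrt_series) ^ 4 * sqrt_series)))) k)
    \<in> O(\<lambda>n. 1 / of_nat n ^ 2)"
    unfolding fps_sub_nth[of "Abs_fps _"] fps_nth_Abs_fps by (rule series_asymp)
qed

end
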